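(* Let $0\le\underline\sigma\le\overline\sigma$, and let $S$ be the $G$-expectation semigroup on $\mathrm{BUC}(\mathbb{R})$, \[\big(S(t)f\big)(x):=\sup_{\sigma\in\Sigma}\mathbb{E}\Big[f\Big(x+\int_0^t\sigma_s\,dW_s\Big)\Big]\quad\text{for }f\in\mathrm{BUC}(\mathbb{R}),\ x\in\mathbb{R},\ t\ge0.\] Let $f\in W^{2,\infty}$. Then $S(t)f\in W^{2,\infty}$ for all $t\ge0$. Moreover, \[\lim_{h\downarrow0}\frac{S(h)f-f}{h}=\tfrac12\max\big\{\underline\sigma^2f'',\overline\sigma^2f''\big\}\quad\text{almost everywhere},\] where the limit on the left-hand side exists pointwise almost everywhere.
   Context: $\mathrm{BUC}(\mathbb{R})$ is the space of bounded uniformly continuous functions $\mathbb{R}\to\mathbb{R}$ with the supremum norm. $W$ is a (one-dimensional standard) Brownian motion on a filtered probability space $(\Omega,\mathcal{F},(\mathcal{F}_t),\mathbb{P})$, and $\Sigma$ denotes the set of all progressively measurable processes with values in $[\underline\sigma,\overline\sigma]$. The family $S=(S(t))_{t\ge0}$ is a translation invariant sublinear monotone strongly continuous semigroup on $\mathrm{BUC}(\mathbb{R})$ (a standard fact). $W^{2,\infty}=W^{2,\infty}(\mathbb{R})$ is the space of functions $f\in L^\infty(\mathbb{R})$ with weak derivatives $f',f''\in L^\infty(\mathbb{R})$, identified with their continuously differentiable representatives. "Almost everywhere" refers to Lebesgue measure on $\mathbb{R}$. *)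

theory Defs
  imports "HOL-Probability.Probability"
begin

section \<open>Function spaces on the real line\<close>

definition BUC :: "(real \<Rightarrow> real) set" where
  "BUC = {f. bounded (range f) \<and> uniformly_continuous_on UNIV f}"

definition L_infinity :: "(real \<Rightarrow> real) set" where
  "L_infinity = {f \<in> borel_measurable lebesgue. \<exists>C. AE x in lebesgue. \<bar>f x\<bar> \<le> C}"

definition test_functions :: "(real \<Rightarrow> real) set" where
  "test_functions = {\<phi>. (\<forall>n x. ((deriv ^^ n) \<phi>) field_differentiable (at x)) \<and>
     compact (closure {x. \<phi> x \<noteq> 0})}"

definition locally_integrable :: "(real \<Rightarrow> real) \<Rightarrow> bool" where
  "locally_integrable f \<longleftrightarrow> (\<forall>K. compact K \<longrightarrow> set_integrable lebesgue K f)"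

text \<open>Local integrability of both functions is part of the definition: the Bochner integral of a
  non-integrable function is \<open>0\<close>, so that without it the identity below could hold vacuously.\<close>

definition has_weak_deriv :: "nat \<Rightarrow> (real \<Rightarrow> real) \<Rightarrow> (real \<Rightarrow> real) \<Rightarrow> bool" where
  "has_weak_deriv k f g \<longleftrightarrow> locally_integrable f \<and> locally_integrable g \<and>
     (\<forall>\<phi>\<in>test_functions.
        (LINT x|lebesgue. f x * (deriv ^^ k) \<phi> x) = (-1) ^ k * (LINT x|lebesgue. g x * \<phi> x))"

text \<open>Elements are genuine functions, namely the continuously differentiable representatives of
  the classes in the Sobolev space; weak derivatives are only determined almost everywhere.\<close>

definition W2_infinity :: "(real \<Rightarrow> real) set" where
  "W2_infinity = {f \<in> L_infinity. f C1_differentiable_on UNIV \<and>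
     (\<exists>g\<in>L_infinity. has_weak_deriv 1 f g) \<and> (\<exists>g\<in>L_infinity. has_weak_deriv 2 f g)}"


section \<open>Brownian motion on a filtered probability space\<close>

text \<open>Time is \<open>[0, \<infinity>)\<close>; values of the filtration and of processes at negative times are
  irrelevant. The filtration is not assumed to be complete or right-continuous.\<close>

locale filtered_prob_space = prob_space M for M :: "'a measure" +
  fixes F :: "real \<Rightarrow> 'a measure"
  assumes subalgebra_F: "0 \<le> t \<Longrightarrow> subalgebra M (F t)"
    and F_mono: "0 \<le> s \<Longrightarrow> s \<le> t \<Longrightarrow> sets (F s) \<subseteq> sets (F t)"

text \<open>The second parameter of \<^const>\<open>normal_density\<close> is the standard deviation.\<close>

locale brownian_motion = filtered_prob_space M F for M :: "'a measure" and F +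
  fixes W :: "real \<Rightarrow> 'a \<Rightarrow> real"
  assumes adapted: "0 \<le> t \<Longrightarrow> W t \<in> borel_measurable (F t)"
    and start_zero: "AE \<omega> in M. W 0 \<omega> = 0"
    and continuous_paths: "AE \<omega> in M. continuous_on {0..} (\<lambda>t. W t \<omega>)"
    and indep_increments: "0 \<le> s \<Longrightarrow> s < t \<Longrightarrow>
      indep_set (sets (F s)) (sets (vimage_algebra (space M) (\<lambda>\<omega>. W t \<omega> - W s \<omega>) borel))"
    and normal_increments: "0 \<le> s \<Longrightarrow> s < t \<Longrightarrow>
      distributed M lborel (\<lambda>\<omega>. W t \<omega> - W s \<omega>) (normal_density 0 (sqrt (t - s)))"

definition progressively_measurable ::
  "(real \<Rightarrow> 'a measure) \<Rightarrow> (real \<Rightarrow> 'a \<Rightarrow> real) \<Rightarrow> bool" where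
  "progressively_measurable F \<sigma> \<longleftrightarrow>
     (\<forall>t\<ge>0. (\<lambda>(s, \<omega>). \<sigma> s \<omega>) \<in> borel_measurable (restrict_space borel {0..t} \<Otimes>\<^sub>M F t))"

definition controls ::
  "'a measure \<Rightarrow> (real \<Rightarrow> 'a measure) \<Rightarrow> real \<Rightarrow> real \<Rightarrow> (real \<Rightarrow> 'a \<Rightarrow> real) set" where
  "controls M F a b = {\<sigma>. progressively_measurable F \<sigma> \<and>
     (\<forall>s\<ge>0. \<forall>\<omega>\<in>space M. \<sigma> s \<omega> \<in> {a..b})}"


section \<open>The Ito integral\<close>

text \<open>A simple integrand on \<open>[0, t]\<close> is given by a number \<open>n\<close> of intervals, grid points
  \<open>0 \<le> p 0 \<le> \<dots> \<le> p n \<le> t\<close> and bounded weights \<open>\<xi> i\<close>, measurable at time \<open>p i\<close>.\<close>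

definition simple_integrand ::
  "'a measure \<Rightarrow> (real \<Rightarrow> 'a measure) \<Rightarrow> real \<Rightarrow> nat \<Rightarrow> (nat \<Rightarrow> real) \<Rightarrow> (nat \<Rightarrow> 'a \<Rightarrow> real) \<Rightarrow> bool" where
  "simple_integrand M F t n p \<xi> \<longleftrightarrow>
     0 \<le> p 0 \<and> (\<forall>i<n. p i \<le> p (Suc i)) \<and> p n \<le> t \<and>
     (\<forall>i<n. \<xi> i \<in> borel_measurable (F (p i)) \<and> bounded (\<xi> i ` space M))"

definition simple_process ::
  "nat \<Rightarrow> (nat \<Rightarrow> real) \<Rightarrow> (nat \<Rightarrow> 'a \<Rightarrow> real) \<Rightarrow> real \<Rightarrow> 'a \<Rightarrow> real" where
  "simple_process n p \<xi> s \<omega> = (\<Sum>i<n. \<xi> i \<omega> * indicator {p i<..p (Suc i)} s)"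

definition simple_integral ::
  "(real \<Rightarrow> 'a \<Rightarrow> real) \<Rightarrow> nat \<Rightarrow> (nat \<Rightarrow> real) \<Rightarrow> (nat \<Rightarrow> 'a \<Rightarrow> real) \<Rightarrow> 'a \<Rightarrow> real" where
  "simple_integral W n p \<xi> \<omega> = (\<Sum>i<n. \<xi> i \<omega> * (W (p (Suc i)) \<omega> - W (p i) \<omega>))"

text \<open>The integral over \<open>[0, t]\<close> is the \<open>L\<^sup>2\<close>-limit of the integrals of simple processes that
  approximate the integrand in \<open>L\<^sup>2\<close> of the product of \<open>[0, t]\<close> and \<open>M\<close>. It is determined up to
  almost sure equality, and \<open>ito_integral\<close> selects a version.\<close>

definition is_ito_integral ::
  "'a measure \<Rightarrow> (real \<Rightarrow> 'a measure) \<Rightarrow> (real \<Rightarrow> 'a \<Rightarrow> real) \<Rightarrow> real \<Rightarrow>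
   (real \<Rightarrow> 'a \<Rightarrow> real) \<Rightarrow> ('a \<Rightarrow> real) \<Rightarrow> bool" where
  "is_ito_integral M F W t \<sigma> I \<longleftrightarrow> I \<in> borel_measurable M \<and>
     (\<exists>n p \<xi>. (\<forall>k. simple_integrand M F t (n k) (p k) (\<xi> k)) \<and>
        (\<lambda>k. \<integral>\<^sup>+\<omega>. (\<integral>\<^sup>+s\<in>{0..t}. ennreal ((simple_process (n k) (p k) (\<xi> k) s \<omega> - \<sigma> s \<omega>)\<^sup>2) \<partial>lborel) \<partial>M)
          \<longlonglongrightarrow> 0 \<and>
        (\<lambda>k. \<integral>\<^sup>+\<omega>. ennreal ((simple_integral W (n k) (p k) (\<xi> k) \<omega> - I \<omega>)\<^sup>2) \<partial>M) \<longlonglongrightarrow> 0)"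

definition ito_integral ::
  "'a measure \<Rightarrow> (real \<Rightarrow> 'a measure) \<Rightarrow> (real \<Rightarrow> 'a \<Rightarrow> real) \<Rightarrow> real \<Rightarrow>
   (real \<Rightarrow> 'a \<Rightarrow> real) \<Rightarrow> 'a \<Rightarrow> real" where
  "ito_integral M F W t \<sigma> = (SOME I. is_ito_integral M F W t \<sigma> I)"

end

theory Submission
  imports Defs
begin

text \<open>Every control is an \<open>L\<^sup>2\<close>-limit of controls that are constant on dyadic intervals, and such
  controls can be chosen in feedback form. Hence \<open>S t f\<close> is the increasing limit of the iterates
  \<open>J\<^sub>h ^^ (2 ^ k)\<close> applied to \<open>f\<close>, where \<open>h = t / 2 ^ k\<close> and \<open>J\<^sub>h g x\<close> is the supremum of
  \<open>\<bbbE> g (x + c \<surd>h Z)\<close> over constant volatilities \<open>c\<close>, with \<open>Z\<close> standard normal.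

  The functions in \<open>W\<^sup>2\<^sup>,\<^sup>\<infinity>\<close> are the bounded functions that are semiconvex and semiconcave. The
  operator \<open>J\<^sub>h\<close> preserves semiconvexity because it is a supremum of averages of translations.
  For semiconcavity, \<open>f'' \<le> K\<close> gives \<open>J\<^sub>h f \<le> f + K b\<^sup>2 h / 2\<close>, where \<open>b\<close> is the largest volatility. By
  monotonicity this persists under iteration, so the limit \<open>u\<close> satisfies
  \<open>\<bbbE> u (x + b \<surd>h Z) \<le> u x + K b\<^sup>2 h / 2\<close>, which forces \<open>u'' \<le> K\<close>.

  For the generator, \<open>f'\<close> is almost everywhere differentiable with derivative \<open>f''\<close>. At such a point
  \<open>f\<close> lies between two parabolas of curvature \<open>f'' x \<plusminus> 2 \<epsilon>\<close>, up to a quartic term, and the iterates of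
  \<open>J\<^sub>h\<close> can be estimated explicitly on such polynomials.\<close>

section \<open>Gaussian averages and the Bellman iteration\<close>

text \<open>Semiconvexity and semiconcavity need different arguments, because a supremum of
  semiconcave functions need not be semiconcave. The upper bound on the second derivative is
  therefore read off from Gaussian averages at scales tending to 0, taken with the largest
  volatility: they stay below one further step of the iteration, and the gain of that step can be
  measured on the terminal value. For \<open>b * t = 0\<close> these averages say nothing, but then
  the evolution is trivial.

  A parabola touches a function only locally, whereas a Gaussian step reaches the whole line. A
  quartic term makes the comparison global, while the fourth moment at standard deviation s is only
  3 s^4 and disappears after division by the time step.

  All functions in play are bounded and Lipschitz with constants that never deteriorate. This turns
  mean square approximation of stochastic integrals into approximation of expectations, and it lets
  a nearly optimal volatility be chosen constant on small cells, so that feedback controls are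
  measurable for elementary reasons.\<close>

abbreviation gauss :: "real measure" where
  "gauss \<equiv> density lborel std_normal_density"

interpretation gauss: prob_space gauss
  by (rule prob_space_normal_density) simp

lemma gauss_UNIV [simp]: "measure gauss UNIV = 1"
  using gauss.prob_space by simp

lemma integrable_gauss_iff:
  "g \<in> borel_measurable borel \<Longrightarrow>
    integrable gauss g \<longleftrightarrow> integrable lborel (\<lambda>z. std_normal_density z * g z :: real)"
  by (subst integrable_density) auto

lemma integral_gauss:
  "g \<in> borel_measurable borel \<Longrightarrow>
    (LINT z|gauss. g z) = (LINT z|lborel. std_normal_density z * g z :: real)"
  by (subst integral_density) auto

lemma integrable_gauss_power [simp]: "integrable gauss (\<lambda>z. z ^ k)"
  by (simp add: integrable_gauss_iff integrable_std_normal_moment)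

lemma integrable_gauss_id [simp]: "integrable gauss (\<lambda>z. z)"
  using integrable_gauss_power[of 1] by simp

lemma gauss_moments [simp]:
  "(LINT z|gauss. z) = 0" "(LINT z|gauss. z\<^sup>2) = 1" "(LINT z|gauss. z ^ 3) = 0"
  "(LINT z|gauss. z ^ 4) = 3"
  using integral_std_normal_moment_odd[of 0] integral_std_normal_moment_even[of 1]
    integral_std_normal_moment_odd[of 1] integral_std_normal_moment_even[of 2]
  by (simp_all add: integral_gauss fact_numeral)

text \<open>The class in which all estimates live: it contains the functions of
  \<open>W2_infinity\<close> for suitable constants, and averages, suprema and pointwise limits keep
  both \<open>B\<close> and \<open>L\<close>. This uniformity is what allows limits to be
  taken.\<close>

definition bounded_lipschitz :: "real \<Rightarrow> real \<Rightarrow> (real \<Rightarrow> real) \<Rightarrow> bool" where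
  "bounded_lipschitz B L g \<longleftrightarrow> (\<forall>x. \<bar>g x\<bar> \<le> B) \<and> (\<forall>x y. \<bar>g x - g y\<bar> \<le> L * \<bar>x - y\<bar>)"

lemma bounded_lipschitzD:
  assumes "bounded_lipschitz B L g"
  shows "\<bar>g x\<bar> \<le> B" "\<bar>g x - g y\<bar> \<le> L * \<bar>x - y\<bar>" "0 \<le> L"
proof -
  show *: "\<bar>g x\<bar> \<le> B" "\<bar>g x - g y\<bar> \<le> L * \<bar>x - y\<bar>" for x y
    using assms by (auto simp: bounded_lipschitz_def)
  show "0 \<le> L" using *(2)[of 0 1] by simp
qed

lemma bounded_lipschitz_lipschitz_on:
  assumes "bounded_lipschitz B L g"
  shows "L-lipschitz_on UNIV g"
  using assms bounded_lipschitzD(3)[OF assms]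
  by (intro lipschitz_onI) (auto simp: bounded_lipschitz_def dist_real_def)

lemma bounded_lipschitz_continuous: "bounded_lipschitz B L g \<Longrightarrow> continuous_on A g"
  by (meson bounded_lipschitz_lipschitz_on continuous_on_subset lipschitz_on_continuous_on subset_UNIV)

lemma bounded_lipschitz_BUC: "bounded_lipschitz B L g \<Longrightarrow> g \<in> BUC"
  using lipschitz_on_uniformly_continuous[OF bounded_lipschitz_lipschitz_on] bounded_lipschitzD(1)
  by (fastforce simp: BUC_def bounded_iff)

lemma bounded_lipschitz_measurable:
  assumes "bounded_lipschitz B L g"
  shows "g \<in> borel_measurable borel"
  using assms by (intro borel_measurable_continuous_onI bounded_lipschitz_continuous)

lemma bounded_lipschitz_integrable:
  assumes "bounded_lipschitz B L g" "prob_space M" "X \<in> borel_measurable M"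
  shows "integrable M (\<lambda>\<omega>. g (X \<omega>))"
proof -
  interpret prob_space M by fact
  note [measurable] = bounded_lipschitz_measurable[OF assms(1)] assms(3)
  show ?thesis
    by (rule integrable_const_bound[of _ B]) (use assms in \<open>auto simp: bounded_lipschitzD\<close>)
qed

text \<open>\<open>s\<close> is a standard deviation: \<open>heat s\<close> is the semigroup
  generated by half the second derivative, run for time \<open>s\<^sup>2\<close>. A constant
  volatility \<open>c\<close> during a time \<open>h\<close> corresponds to
  \<open>s = c * sqrt h\<close>.\<close>

definition heat :: "real \<Rightarrow> (real \<Rightarrow> real) \<Rightarrow> real \<Rightarrow> real" where
  "heat s g x = (LINT z|gauss. g (x + s * z))"

lemma heat_integrable [simp]:
  "bounded_lipschitz B L g \<Longrightarrow> integrable gauss (\<lambda>z. g (x + s * z))"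
  by (rule bounded_lipschitz_integrable) (auto intro: gauss.prob_space_axioms)

lemma heat_0 [simp]: "heat 0 g = g"
  by (simp add: heat_def fun_eq_iff gauss.prob_space)

lemma heat_mono:
  assumes "bounded_lipschitz B L g" "bounded_lipschitz B' L' k" "\<And>y. g y \<le> k y"
  shows "heat s g x \<le> heat s k x"
  unfolding heat_def using assms by (intro integral_mono heat_integrable) auto

lemma heat_add_const:
  assumes "bounded_lipschitz B L g"
  shows "heat s (\<lambda>y. g y + c) x = heat s g x + c"
  unfolding heat_def using heat_integrable[OF assms] by (simp add: gauss.prob_space)

lemma heat_abs_le:
  assumes "bounded_lipschitz B L g"
  shows "\<bar>heat s g x\<bar> \<le> B"
proof -
  have "heat s g x \<le> (LINT z|gauss. B)" "(LINT z|gauss. - B) \<le> heat s g x"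
    unfolding heat_def
    by (intro integral_mono heat_integrable[OF assms]; use bounded_lipschitzD(1)[OF assms] in
        \<open>auto simp: abs_le_iff minus_le_iff\<close>)+
  then show ?thesis by (auto simp: gauss.prob_space)
qed

lemma heat_lipschitz:
  assumes "bounded_lipschitz B L g"
  shows "\<bar>heat s g x - heat s g y\<bar> \<le> L * \<bar>x - y\<bar>"
proof -
  have "\<bar>heat s g x - heat s g y\<bar> = \<bar>LINT z|gauss. g (x + s * z) - g (y + s * z)\<bar>"
    unfolding heat_def using heat_integrable[OF assms] by simp
  also have "\<dots> \<le> (LINT z|gauss. \<bar>g (x + s * z) - g (y + s * z)\<bar>)" by simp
  also have "\<dots> \<le> (LINT z|gauss. L * \<bar>x - y\<bar>)"
  proof (rule integral_mono)
    show "\<bar>g (x + s * z) - g (y + s * z)\<bar> \<le> L * \<bar>x - y\<bar>" for z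
      using bounded_lipschitzD(2)[OF assms, of "x + s * z" "y + s * z"] by simp
  qed (use heat_integrable[OF assms] in auto)
  finally show ?thesis by (simp add: gauss.prob_space)
qed

lemma bounded_lipschitz_heat:
  "bounded_lipschitz B L g \<Longrightarrow> bounded_lipschitz B L (heat s g)"
  by (simp add: bounded_lipschitz_def[of _ _ "heat s g"] heat_abs_le heat_lipschitz)

text \<open>The sum of two independent standard normal variables is distributed as
  \<open>sqrt 2\<close> times a single one. Equal scales suffice, as time steps are only ever
  doubled.\<close>

lemma heat_heat:
  assumes "bounded_lipschitz B L g"
  shows "heat s (heat s g) x = heat (s * sqrt 2) g x"
proof -
  interpret P: pair_prob_space gauss gauss ..
  let ?P = "gauss \<Otimes>\<^sub>M gauss"
  note [measurable] = bounded_lipschitz_measurable[OF assms]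
  have int: "integrable ?P (\<lambda>p. g (x + s * (fst p + snd p)))"
    by (rule bounded_lipschitz_integrable[OF assms P.prob_space_axioms]) measurable
  have 1: "distr ?P borel fst = gauss"
    using gauss.distr_pair_fst[of gauss] by (simp cong: distr_cong)
  have 2: "distr ?P borel snd = gauss"
  proof (rule measure_eqI)
    fix A assume "A \<in> sets (distr ?P borel snd)"
    then have A: "A \<in> sets borel" by simp
    then have "snd -` A \<inter> space ?P = UNIV \<times> A" by (auto simp: space_pair_measure)
    with A show "emeasure (distr ?P borel snd) A = emeasure gauss A"
      using gauss.emeasure_space_1 by (simp add: emeasure_distr gauss.emeasure_pair_measure_Times)
  qed simp
  have fs: "distributed ?P lborel fst std_normal_density" "distributed ?P lborel snd std_normal_density"
    using 1 2 by (auto simp: distributed_def cong: distr_cong)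
  have "P.indep_var borel fst borel snd"
    unfolding P.indep_var_distribution_eq 1 2
    by (simp add: distr_id2 cong: sets_pair_measure_cong)
  from P.add_indep_normal[OF this _ _ fs]
  have sum: "distributed ?P lborel (\<lambda>p. fst p + snd p) (normal_density 0 (sqrt 2))" by simp
  have sc: "distributed gauss lborel (\<lambda>z. 0 + sqrt 2 * z) (normal_density (0 + sqrt 2 * 0) (\<bar>sqrt 2\<bar> * 1))"
    by (rule gauss.normal_density_affine) (auto simp: distributed_def distr_id2)
  have "heat s (heat s g) x = (LINT z|gauss. LINT w|gauss. g (x + s * (z + w)))"
    unfolding heat_def by (simp add: algebra_simps)
  also have "\<dots> = (LINT p|?P. g (x + s * (fst p + snd p)))"
    using P.integral_fst'[of "\<lambda>p. g (x + s * (fst p + snd p))"] int by simp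
  also have "\<dots> = (LINT y|lborel. normal_density 0 (sqrt 2) y * g (x + s * y))"
    using distributed_integral[OF sum, of "\<lambda>y. g (x + s * y)"] by simp
  also have "\<dots> = heat (s * sqrt 2) g x"
    using distributed_integral[OF sc, of "\<lambda>y. g (x + s * y)"] by (simp add: heat_def mult.assoc)
  finally show ?thesis .
qed

section \<open>One step of the iteration and its dyadic limit\<close>

definition bellman :: "real \<Rightarrow> real \<Rightarrow> real \<Rightarrow> (real \<Rightarrow> real) \<Rightarrow> real \<Rightarrow> real" where
  "bellman a b h g x = (SUP c\<in>{a..b}. heat (c * sqrt h) g x)"

locale volatility_band =
  fixes a b :: real
  assumes a_nonneg: "0 \<le> a" and a_le_b: "a \<le> b"
begin

lemma heat_le_bellman:
  assumes "bounded_lipschitz B L g" "c \<in> {a..b}"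
  shows "heat (c * sqrt h) g x \<le> bellman a b h g x"
  unfolding bellman_def
  by (rule cSUP_upper[OF assms(2)])
    (use heat_abs_le[OF assms(1)] in \<open>auto simp: abs_le_iff intro!: bdd_aboveI2[of _ _ B]\<close>)

lemma bellman_le:
  assumes "\<And>c. c \<in> {a..b} \<Longrightarrow> heat (c * sqrt h) g x \<le> m"
  shows "bellman a b h g x \<le> m"
  unfolding bellman_def by (rule cSUP_least) (use assms a_le_b in auto)

lemma bellman_approx:
  assumes "0 < \<epsilon>"
  obtains c where "c \<in> {a..b}" "bellman a b h g x - \<epsilon> < heat (c * sqrt h) g x"
  by (metis assms bellman_le diff_less_eq less_add_same_cancel1 linorder_not_less)

lemma bellman_mono:
  assumes "bounded_lipschitz B L g" "bounded_lipschitz B' L' k" "\<And>y. g y \<le> k y"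
  shows "bellman a b h g x \<le> bellman a b h k x"
  using heat_mono[OF assms] heat_le_bellman[OF assms(2)]
  by (intro bellman_le) (meson order_trans)

lemma bounded_lipschitz_bellman:
  assumes "bounded_lipschitz B L g"
  shows "bounded_lipschitz B L (bellman a b h g)"
proof -
  have low: "- B \<le> bellman a b h g x" for x
    using heat_abs_le[OF assms, of "b * sqrt h" x] heat_le_bellman[OF assms, of b h x] a_le_b
    by (auto simp: abs_le_iff)
  have up: "bellman a b h g x \<le> B" for x
    using heat_abs_le[OF assms] by (intro bellman_le) (auto simp: abs_le_iff)
  have "bellman a b h g x \<le> bellman a b h g y + L * \<bar>x - y\<bar>" for x y
  proof (rule bellman_le)
    fix c assume "c \<in> {a..b}"
    then show "heat (c * sqrt h) g x \<le> bellman a b h g y + L * \<bar>x - y\<bar>"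
      using heat_lipschitz[OF assms, of "c * sqrt h" x y] heat_le_bellman[OF assms, of c h y]
      by (auto simp: abs_le_iff)
  qed
  note lip = this
  have "\<bar>bellman a b h g x - bellman a b h g y\<bar> \<le> L * \<bar>x - y\<bar>" for x y
    using lip[of x y] lip[of y x] by (simp add: abs_le_iff abs_minus_commute)
  moreover have "\<bar>bellman a b h g x\<bar> \<le> B" for x
    using low[of x] up[of x] by (simp add: abs_le_iff)
  ultimately show ?thesis by (simp add: bounded_lipschitz_def)
qed

lemma bounded_lipschitz_bellman_pow:
  assumes "bounded_lipschitz B L g"
  shows "bounded_lipschitz B L ((bellman a b h ^^ n) g)"
  by (induction n) (auto intro: assms bounded_lipschitz_bellman)

lemma bellman_pow_mono:
  assumes "bounded_lipschitz B L g" "bounded_lipschitz B' L' k" "\<And>y. g y \<le> k y"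
  shows "(bellman a b h ^^ n) g x \<le> (bellman a b h ^^ n) k x"
  using assms
proof (induction n arbitrary: x)
  case (Suc n)
  then show ?case
    by (auto intro!: bellman_mono bounded_lipschitz_bellman_pow)
qed simp

lemma bounded_lipschitz_add_const:
  "bounded_lipschitz B L g \<Longrightarrow> bounded_lipschitz (B + \<bar>c\<bar>) L (\<lambda>y. g y + c)"
  by (auto simp: bounded_lipschitz_def intro: order_trans[OF abs_triangle_ineq])

lemma bellman_add_const:
  assumes "bounded_lipschitz B L g"
  shows "bellman a b h (\<lambda>y. g y + c) x = bellman a b h g x + c"
proof (rule antisym)
  show "bellman a b h (\<lambda>y. g y + c) x \<le> bellman a b h g x + c"
    by (rule bellman_le) (simp add: heat_add_const[OF assms] heat_le_bellman[OF assms])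
  have "bellman a b h g x \<le> bellman a b h (\<lambda>y. g y + c) x - c"
  proof (rule bellman_le)
    fix c' assume "c' \<in> {a..b}"
    then show "heat (c' * sqrt h) g x \<le> bellman a b h (\<lambda>y. g y + c) x - c"
      using heat_le_bellman[OF bounded_lipschitz_add_const[OF assms], of c' h c x]
      by (simp add: heat_add_const[OF assms])
  qed
  then show "bellman a b h g x + c \<le> bellman a b h (\<lambda>y. g y + c) x" by simp
qed

lemma bellman_pow_add_const:
  assumes "bounded_lipschitz B L g"
  shows "(bellman a b h ^^ n) (\<lambda>y. g y + c) = (\<lambda>y. (bellman a b h ^^ n) g y + c)"
  by (induction n) (auto simp: bellman_add_const[OF bounded_lipschitz_bellman_pow[OF assms]])

text \<open>Keeping one volatility for time \<open>2 * h\<close> amounts to using it in two steps of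
  length \<open>h\<close>; two steps also permit a change in between that depends on the position
  reached.\<close>

lemma bellman_double:
  assumes "bounded_lipschitz B L g" "0 \<le> h"
  shows "bellman a b (2 * h) g x \<le> bellman a b h (bellman a b h g) x"
proof (rule bellman_le)
  fix c assume c: "c \<in> {a..b}"
  have "heat (c * sqrt (2 * h)) g x = heat (c * sqrt h) (heat (c * sqrt h) g) x"
    by (simp add: heat_heat[OF assms(1)] real_sqrt_mult ac_simps)
  also have "\<dots> \<le> heat (c * sqrt h) (bellman a b h g) x"
    by (intro heat_mono[OF bounded_lipschitz_heat[OF assms(1)] bounded_lipschitz_bellman[OF assms(1)]]
        heat_le_bellman[OF assms(1) c])
  also have "\<dots> \<le> bellman a b h (bellman a b h g) x"
    by (rule heat_le_bellman[OF bounded_lipschitz_bellman[OF assms(1)] c])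
  finally show "heat (c * sqrt (2 * h)) g x \<le> \<dots>" .
qed

definition nisio_approx :: "real \<Rightarrow> nat \<Rightarrow> (real \<Rightarrow> real) \<Rightarrow> real \<Rightarrow> real" where
  "nisio_approx t k = bellman a b (t / 2 ^ k) ^^ (2 ^ k)"

lemma bounded_lipschitz_nisio_approx:
  "bounded_lipschitz B L g \<Longrightarrow> bounded_lipschitz B L (nisio_approx t k g)"
  unfolding nisio_approx_def by (rule bounded_lipschitz_bellman_pow)

lemma bellman_pow_double:
  assumes "bounded_lipschitz B L g" "0 \<le> h"
  shows "(bellman a b (2 * h) ^^ n) g x \<le> (bellman a b h ^^ (2 * n)) g x"
proof (induction n arbitrary: x)
  case (Suc n)
  have "(bellman a b (2 * h) ^^ Suc n) g x \<le> bellman a b (2 * h) ((bellman a b h ^^ (2 * n)) g) x"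
    using Suc by (auto intro!: bellman_mono bounded_lipschitz_bellman_pow assms)
  also have "\<dots> \<le> bellman a b h (bellman a b h ((bellman a b h ^^ (2 * n)) g)) x"
    by (rule bellman_double[OF bounded_lipschitz_bellman_pow[OF assms(1)] assms(2)])
  finally show ?case by simp
qed simp

lemma nisio_approx_Suc:
  assumes "bounded_lipschitz B L g" "0 \<le> t"
  shows "nisio_approx t k g x \<le> nisio_approx t (Suc k) g x"
  using bellman_pow_double[OF assms(1), of "t / 2 ^ Suc k" "2 ^ k"] assms(2)
  by (simp add: nisio_approx_def)

text \<open>The Nisio construction of a semigroup as an upper envelope. Along dyadic partitions the
  iterates of bounded Lipschitz data increase in \<open>k\<close> when \<open>0 \<le> t\<close>, so
  the supremum is also their limit.\<close>

definition nisio :: "real \<Rightarrow> (real \<Rightarrow> real) \<Rightarrow> real \<Rightarrow> real" where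
  "nisio t g x = (SUP k. nisio_approx t k g x)"

lemma nisio_limit:
  assumes "bounded_lipschitz B L g" "0 \<le> t"
  shows "(\<lambda>k. nisio_approx t k g x) \<longlonglongrightarrow> nisio t g x"
    and "nisio_approx t k g x \<le> nisio t g x"
proof -
  have bdd: "bdd_above (range (\<lambda>k. nisio_approx t k g x))"
    using bounded_lipschitzD(1)[OF bounded_lipschitz_nisio_approx[OF assms(1)]]
    by (auto simp: abs_le_iff intro!: bdd_aboveI2[of _ _ B])
  have inc: "incseq (\<lambda>k. nisio_approx t k g x)"
    by (intro incseq_SucI nisio_approx_Suc[OF assms])
  show "(\<lambda>k. nisio_approx t k g x) \<longlonglongrightarrow> nisio t g x"
    unfolding nisio_def by (rule LIMSEQ_incseq_SUP[OF bdd inc])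
  show "nisio_approx t k g x \<le> nisio t g x"
    unfolding nisio_def by (rule cSUP_upper[OF _ bdd]) simp
qed

lemma bounded_lipschitz_nisio:
  assumes "bounded_lipschitz B L g" "0 \<le> t"
  shows "bounded_lipschitz B L (nisio t g)"
proof -
  note lim = nisio_limit(1)[OF assms] and bl = bounded_lipschitz_nisio_approx[OF assms(1)]
  have "\<bar>nisio t g x\<bar> \<le> B" for x
    by (rule LIMSEQ_le_const2[OF tendsto_rabs[OF lim]]) (use bounded_lipschitzD(1)[OF bl] in blast)
  moreover have "\<bar>nisio t g x - nisio t g y\<bar> \<le> L * \<bar>x - y\<bar>" for x y
    by (rule LIMSEQ_le_const2[OF tendsto_rabs[OF tendsto_diff[OF lim lim]]])
      (use bounded_lipschitzD(2)[OF bl] in blast)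
  ultimately show ?thesis by (simp add: bounded_lipschitz_def)
qed

lemma heat_le_nisio:
  assumes "bounded_lipschitz B L g" "0 \<le> t" "c \<in> {a..b}"
  shows "heat (c * sqrt t) g x \<le> nisio t g x"
  using nisio_limit(2)[OF assms(1,2), where k = 0] heat_le_bellman[OF assms(1,3)]
  by (auto simp: nisio_approx_def intro: order_trans)

end

section \<open>Polynomial barriers of degree four\<close>

lemma heat_quartic:
  fixes r :: real
  shows "integrable gauss (\<lambda>z. A + p * (r + s * z) + C * (r + s * z)\<^sup>2 + D * (r + s * z) ^ 4)"
    and "(LINT z|gauss. A + p * (r + s * z) + C * (r + s * z)\<^sup>2 + D * (r + s * z) ^ 4) =
      A + p * r + C * (r\<^sup>2 + s\<^sup>2) + D * (r ^ 4 + 6 * r\<^sup>2 * s\<^sup>2 + 3 * s ^ 4)"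
proof -
  have eq: "A + p * (r + s * z) + C * (r + s * z)\<^sup>2 + D * (r + s * z) ^ 4 =
      (A + p * r + C * r\<^sup>2 + D * r ^ 4) + (p * s + 2 * C * r * s + 4 * D * r ^ 3 * s) * z
      + (C * s\<^sup>2 + 6 * D * r\<^sup>2 * s\<^sup>2) * z\<^sup>2 + (4 * D * r * s ^ 3) * z ^ 3 + (D * s ^ 4) * z ^ 4" for z
    by (simp add: power2_eq_square power3_eq_cube power4_eq_xxxx algebra_simps)
  show "integrable gauss (\<lambda>z. A + p * (r + s * z) + C * (r + s * z)\<^sup>2 + D * (r + s * z) ^ 4)"
    unfolding eq by simp
  show "(LINT z|gauss. A + p * (r + s * z) + C * (r + s * z)\<^sup>2 + D * (r + s * z) ^ 4) =
      A + p * r + C * (r\<^sup>2 + s\<^sup>2) + D * (r ^ 4 + 6 * r\<^sup>2 * s\<^sup>2 + 3 * s ^ 4)"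
    unfolding eq by (simp add: algebra_simps)
qed

lemma heat_le_quartic:
  assumes "bounded_lipschitz B L g"
    and "\<And>y. g y \<le> A + p * (y - x) + C * (y - x)\<^sup>2 + D * (y - x) ^ 4"
  shows "heat s g y \<le> A + p * (y - x) + C * ((y - x)\<^sup>2 + s\<^sup>2)
    + D * ((y - x) ^ 4 + 6 * (y - x)\<^sup>2 * s\<^sup>2 + 3 * s ^ 4)"
  unfolding heat_def heat_quartic(2)[symmetric]
proof (rule integral_mono[OF heat_integrable[OF assms(1)] heat_quartic(1)])
  show "g (y + s * z) \<le> A + p * (y - x + s * z) + C * (y - x + s * z)\<^sup>2 + D * (y - x + s * z) ^ 4" for z
    using assms(2)[of "y + s * z"] by (simp add: algebra_simps)
qed

text \<open>The lower bound is wanted at the point of contact only, because a single step with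
  constant volatility suffices from below. The upper bound has to hold at every point, since it is
  iterated.\<close>

lemma heat_ge_quartic:
  assumes "bounded_lipschitz B L g"
    and "\<And>y. g y \<ge> A + p * (y - x) + C * (y - x)\<^sup>2 - D * (y - x) ^ 4"
  shows "heat s g x \<ge> A + C * s\<^sup>2 - 3 * D * s ^ 4"
proof -
  have "(LINT z|gauss. A + p * (0 + s * z) + C * (0 + s * z)\<^sup>2 + (- D) * (0 + s * z) ^ 4) \<le> heat s g x"
    unfolding heat_def
  proof (rule integral_mono[OF heat_quartic(1) heat_integrable[OF assms(1)]])
    show "A + p * (0 + s * z) + C * (0 + s * z)\<^sup>2 + (- D) * (0 + s * z) ^ 4 \<le> g (x + s * z)" for z
      using assms(2)[of "x + s * z"] by simp
  qed
  then show ?thesis unfolding heat_quartic(2) by simp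
qed

context volatility_band
begin

text \<open>A step of variance \<open>c\<^sup>2 * h\<close> feeds the quartic term into the
  quadratic coefficient and both into the constant. With \<open>c = b\<close>, the quadratic
  coefficient gains \<open>6 * D * b\<^sup>2 * h\<close> per step. At time \<open>\<tau>\<close> the
  constant then gains \<open>6 * D * b ^ 4 * \<tau> * h\<close> from the accumulated part of that
  coefficient and \<open>3 * D * b ^ 4 * h\<^sup>2\<close> from the fourth moment; together this is
  exactly the increment of \<open>3 * D * b ^ 4 * \<tau>\<^sup>2\<close>.\<close>

lemma bellman_pow_le_quartic:
  assumes bl: "bounded_lipschitz B L g" and "0 \<le> D" "0 \<le> h"
    and le: "\<And>y. g y \<le> A + p * (y - x) + C * (y - x)\<^sup>2 + D * (y - x) ^ 4"
    and m: "C * a\<^sup>2 \<le> m" "C * b\<^sup>2 \<le> m"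
  shows "(bellman a b h ^^ n) g y \<le> (A + m * (n * h) + 3 * D * b ^ 4 * (n * h)\<^sup>2) + p * (y - x)
    + (C + 6 * D * b\<^sup>2 * (n * h)) * (y - x)\<^sup>2 + D * (y - x) ^ 4"
proof (induction n arbitrary: y)
  case 0
  show ?case using le by simp
next
  case (Suc n)
  define \<tau> where "\<tau> = n * h"
  have "0 \<le> \<tau>" using assms by (simp add: \<tau>_def)
  have \<tau>: "Suc n * h = \<tau> + h" by (simp add: \<tau>_def algebra_simps)
  show ?case
    unfolding funpow.simps o_def \<tau>
  proof (rule bellman_le)
    fix c assume c: "c \<in> {a..b}"
    then have c2: "c\<^sup>2 \<le> b\<^sup>2" "a\<^sup>2 \<le> c\<^sup>2" using a_nonneg by (auto intro!: power_mono)
    \<comment> \<open>\<open>C * c\<^sup>2\<close> is monotone in \<open>c\<^sup>2\<close>, so one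
      of the endpoints bounds it; the sign of \<open>C\<close> tells which.\<close>
    have cm: "C * c\<^sup>2 \<le> m"
    proof (cases "0 \<le> C")
      case True
      then show ?thesis using m c2 by (meson mult_left_mono order_trans)
    next
      case False
      then show ?thesis using m c2 by (meson mult_left_mono_neg order_trans linorder_le_cases)
    qed
    have s2: "(c * sqrt h)\<^sup>2 = c\<^sup>2 * h" using assms by (simp add: power_mult_distrib)
    have s4: "(c * sqrt h) ^ 4 = (c\<^sup>2 * h)\<^sup>2" unfolding s2[symmetric] by simp
    have "heat (c * sqrt h) ((bellman a b h ^^ n) g) y \<le>
        (A + m * \<tau> + 3 * D * b ^ 4 * \<tau>\<^sup>2) + p * (y - x) + (C + 6 * D * b\<^sup>2 * \<tau>) * ((y - x)\<^sup>2 + c\<^sup>2 * h)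
        + D * ((y - x) ^ 4 + 6 * (y - x)\<^sup>2 * (c\<^sup>2 * h) + 3 * (c\<^sup>2 * h)\<^sup>2)"
      using heat_le_quartic[OF bounded_lipschitz_bellman_pow[OF bl] Suc.IH, of "c * sqrt h" y]
      unfolding s2 s4 \<tau>_def .
    also have "\<dots> \<le> (A + m * (\<tau> + h) + 3 * D * b ^ 4 * (\<tau> + h)\<^sup>2) + p * (y - x)
      + (C + 6 * D * b\<^sup>2 * (\<tau> + h)) * (y - x)\<^sup>2 + D * (y - x) ^ 4"
    proof -
      have 1: "C * c\<^sup>2 * h \<le> m * h" using cm assms by (intro mult_right_mono) auto
      have cb: "c\<^sup>2 * h \<le> b\<^sup>2 * h" "0 \<le> c\<^sup>2 * h" using c2 assms by (auto intro: mult_right_mono)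
      have 2: "D * b\<^sup>2 * \<tau> * (c\<^sup>2 * h) \<le> D * b\<^sup>2 * \<tau> * (b\<^sup>2 * h)"
        using cb assms \<open>0 \<le> \<tau>\<close> by (intro mult_left_mono) auto
      have 3: "D * (y - x)\<^sup>2 * (c\<^sup>2 * h) \<le> D * (y - x)\<^sup>2 * (b\<^sup>2 * h)"
        using cb assms by (intro mult_left_mono) auto
      have 4: "D * (c\<^sup>2 * h)\<^sup>2 \<le> D * (b\<^sup>2 * h)\<^sup>2"
        using cb assms by (intro mult_left_mono power_mono) auto
      have "b ^ 4 = b\<^sup>2 * b\<^sup>2" by (simp add: power2_eq_square power4_eq_xxxx)
      then show ?thesis
        using 1 2 3 4 by (simp add: algebra_simps power2_sum power_mult_distrib)
    qed
    finally show "heat (c * sqrt h) ((bellman a b h ^^ n) g) y \<le> \<dots>" .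
  qed
qed

text \<open>The bound on the iterates depends on the number of steps only through the elapsed time,
  hence it survives the limit. The terms in \<open>y - x\<close> vanish at the centre.\<close>

lemma nisio_le_quartic:
  assumes bl: "bounded_lipschitz B L g" and "0 \<le> D" "0 \<le> t"
    and le: "\<And>y. g y \<le> A + p * (y - x) + C * (y - x)\<^sup>2 + D * (y - x) ^ 4"
    and m: "C * a\<^sup>2 \<le> m" "C * b\<^sup>2 \<le> m"
  shows "nisio t g x \<le> A + m * t + 3 * D * b ^ 4 * t\<^sup>2"
proof (rule LIMSEQ_le_const2[OF nisio_limit(1)[OF bl \<open>0 \<le> t\<close>]])
  have "nisio_approx t k g x \<le> A + m * t + 3 * D * b ^ 4 * t\<^sup>2" for k
    using bellman_pow_le_quartic[OF bl \<open>0 \<le> D\<close> _ le m, of "t / 2 ^ k" "2 ^ k" x] \<open>0 \<le> t\<close>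
    by (simp add: nisio_approx_def)
  then show "\<exists>N. \<forall>k\<ge>N. nisio_approx t k g x \<le> A + m * t + 3 * D * b ^ 4 * t\<^sup>2" by blast
qed

end

section \<open>Semiconvexity, semiconcavity and quadratic approximation\<close>

text \<open>Equivalently, \<open>u x + K / 2 * x\<^sup>2\<close> is convex. The form below passes directly to averages,
  suprema and limits.\<close>

definition semiconvex :: "real \<Rightarrow> (real \<Rightarrow> real) \<Rightarrow> bool" where
  "semiconvex K u \<longleftrightarrow> (\<forall>x y l. 0 \<le> l \<and> l \<le> 1 \<longrightarrow>
    u ((1 - l) * x + l * y) \<le> (1 - l) * u x + l * u y + K / 2 * (l * (1 - l) * (x - y)\<^sup>2))"

lemma semiconvex_heat:
  assumes sc: "semiconvex K g" and bl: "bounded_lipschitz B L g"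
  shows "semiconvex K (heat s g)"
  unfolding semiconvex_def
proof (intro allI impI)
  fix x y l :: real assume l: "0 \<le> l \<and> l \<le> 1"
  note [simp] = heat_integrable[OF bl]
  have "heat s g ((1 - l) * x + l * y) \<le>
      (LINT z|gauss. (1 - l) * g (x + s * z) + l * g (y + s * z) + K / 2 * (l * (1 - l) * (x - y)\<^sup>2))"
    unfolding heat_def
  proof (rule integral_mono)
    fix z
    have "(1 - l) * x + l * y + s * z = (1 - l) * (x + s * z) + l * (y + s * z)"
      by (simp add: algebra_simps)
    then show "g ((1 - l) * x + l * y + s * z) \<le>
        (1 - l) * g (x + s * z) + l * g (y + s * z) + K / 2 * (l * (1 - l) * (x - y)\<^sup>2)"
      using sc l unfolding semiconvex_def
      by (metis add_diff_cancel_right)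
  qed auto
  also have "\<dots> = (1 - l) * heat s g x + l * heat s g y + K / 2 * (l * (1 - l) * (x - y)\<^sup>2)"
    by (simp add: heat_def)
  finally show "heat s g ((1 - l) * x + l * y) \<le> \<dots>" .
qed

lemma semiconvex_limit:
  assumes "\<And>k. semiconvex K (g k)" "\<And>x. (\<lambda>k. g k x) \<longlonglongrightarrow> u x"
  shows "semiconvex K u"
  unfolding semiconvex_def
proof (intro allI impI)
  fix x y l :: real assume l: "0 \<le> l \<and> l \<le> 1"
  show "u ((1 - l) * x + l * y) \<le> (1 - l) * u x + l * u y + K / 2 * (l * (1 - l) * (x - y)\<^sup>2)"
  proof (rule LIMSEQ_le[OF assms(2)])
    show "(\<lambda>k. (1 - l) * g k x + l * g k y + K / 2 * (l * (1 - l) * (x - y)\<^sup>2)) \<longlonglongrightarrow>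
        (1 - l) * u x + l * u y + K / 2 * (l * (1 - l) * (x - y)\<^sup>2)"
      by (intro tendsto_intros assms(2))
    show "\<exists>N. \<forall>k\<ge>N. g k ((1 - l) * x + l * y)
        \<le> (1 - l) * g k x + l * g k y + K / 2 * (l * (1 - l) * (x - y)\<^sup>2)"
      using assms(1) l unfolding semiconvex_def by blast
  qed
qed

text \<open>A volatility used at the intermediate point is used at both endpoints as well. For the
  reversed inequality the endpoints might prefer different volatilities, which is why semiconcavity
  does not pass through the supremum in this way.\<close>

lemma (in volatility_band) semiconvex_bellman:
  assumes sc: "semiconvex K g" and bl: "bounded_lipschitz B L g"
  shows "semiconvex K (bellman a b h g)"
  unfolding semiconvex_def
proof (intro allI impI bellman_le)
  fix x y l c :: real assume l: "0 \<le> l \<and> l \<le> 1" and c: "c \<in> {a..b}"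
  have "heat (c * sqrt h) g ((1 - l) * x + l * y) \<le>
      (1 - l) * heat (c * sqrt h) g x + l * heat (c * sqrt h) g y + K / 2 * (l * (1 - l) * (x - y)\<^sup>2)"
    using semiconvex_heat[OF sc bl] l unfolding semiconvex_def by blast
  also have "\<dots> \<le> (1 - l) * bellman a b h g x + l * bellman a b h g y + K / 2 * (l * (1 - l) * (x - y)\<^sup>2)"
    using l heat_le_bellman[OF bl c]
    by (intro add_right_mono add_mono mult_left_mono) auto
  finally show "heat (c * sqrt h) g ((1 - l) * x + l * y) \<le> \<dots>" .
qed

lemma (in volatility_band) semiconvex_nisio:
  assumes sc: "semiconvex K g" and bl: "bounded_lipschitz B L g" and t: "0 \<le> t"
  shows "semiconvex K (nisio t g)"
proof (rule semiconvex_limit[OF _ nisio_limit(1)[OF bl t]])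
  have "semiconvex K ((bellman a b h ^^ n) g)" for h n
    by (induction n) (auto intro: sc semiconvex_bellman bounded_lipschitz_bellman_pow[OF bl])
  then show "semiconvex K (nisio_approx t k g)" for k
    by (simp add: nisio_approx_def)
qed

text \<open>A two-sided bound by \<open>K\<close> on the second derivative, stated without
  derivatives so that it can be obtained from supporting parabolas. It makes \<open>d\<close> the
  derivative of \<open>u\<close> and \<open>K\<close>-Lipschitz.\<close>

definition quadratic_approx :: "real \<Rightarrow> (real \<Rightarrow> real) \<Rightarrow> (real \<Rightarrow> real) \<Rightarrow> bool" where
  "quadratic_approx K u d \<longleftrightarrow> (\<forall>x y. \<bar>u y - u x - d x * (y - x)\<bar> \<le> K / 2 * (y - x)\<^sup>2)"

lemma quadratic_approx_nonneg: "quadratic_approx K u d \<Longrightarrow> 0 \<le> K"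
proof -
  assume "quadratic_approx K u d"
  then have "\<bar>u 1 - u 0 - d 0 * (1 - 0)\<bar> \<le> K / 2 * (1 - 0)\<^sup>2"
    unfolding quadratic_approx_def by blast
  then have "\<bar>u 1 - u 0 - d 0\<bar> \<le> K / 2" by simp
  then show ?thesis by linarith
qed

lemma quadratic_approx_imp_semiconvex:
  assumes "quadratic_approx K u d"
  shows "semiconvex K u"
  unfolding semiconvex_def
proof (intro allI impI)
  fix x y l :: real assume l: "0 \<le> l \<and> l \<le> 1"
  define p where "p = (1 - l) * x + l * y"
  have xp: "x - p = l * (x - y)" and yp: "y - p = (1 - l) * (y - x)"
    by (simp_all add: p_def algebra_simps)
  have low: "u p + d p * (w - p) - K / 2 * (w - p)\<^sup>2 \<le> u w" for w
    using assms[unfolded quadratic_approx_def, rule_format, of w p] by linarith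
  \<comment> \<open>The lower parabolas at the barycentre \<open>p\<close> are averaged: the slopes
    cancel, and the squares add up to \<open>l * (1 - l) * (x - y)\<^sup>2\<close>.\<close>
  have "(1 - l) * (u p + d p * (x - p) - K / 2 * (x - p)\<^sup>2) + l * (u p + d p * (y - p) - K / 2 * (y - p)\<^sup>2)
      \<le> (1 - l) * u x + l * u y"
    using l low by (intro add_mono mult_left_mono) auto
  moreover have "(1 - l) * (u p + d p * (x - p) - K / 2 * (x - p)\<^sup>2) + l * (u p + d p * (y - p) - K / 2 * (y - p)\<^sup>2)
      = u p - K / 2 * (l * (1 - l) * (x - y)\<^sup>2)"
    unfolding xp yp by (simp add: power2_eq_square field_simps)
  ultimately show "u ((1 - l) * x + l * y) \<le> (1 - l) * u x + l * u y + K / 2 * (l * (1 - l) * (x - y)\<^sup>2)"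
    by (simp add: p_def)
qed

text \<open>A subgradient \<open>q\<close> of the convex function
  \<open>u y + K / 2 * y\<^sup>2\<close> at \<open>x\<close> gives the slope
  \<open>q - K * x\<close>, since
  \<open>y\<^sup>2 = x\<^sup>2 + 2 * x * (y - x) + (y - x)\<^sup>2\<close>.\<close>

lemma semiconvex_support:
  assumes "semiconvex K u"
  obtains p where "\<And>y. u y \<ge> u x + p * (y - x) - K / 2 * (y - x)\<^sup>2"
proof -
  define v where "v x = u x + K / 2 * x\<^sup>2" for x
  have "convex_on UNIV v"
  proof (rule convex_onI)
    fix l x y :: real assume "0 < l" "l < 1"
    then have "u ((1 - l) * x + l * y) \<le> (1 - l) * u x + l * u y + K / 2 * (l * (1 - l) * (x - y)\<^sup>2)"
      using assms by (auto simp: semiconvex_def)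
    moreover have "(1 - l) * x\<^sup>2 + l * y\<^sup>2 = ((1 - l) * x + l * y)\<^sup>2 + l * (1 - l) * (x - y)\<^sup>2"
      by (simp add: power2_eq_square algebra_simps)
    then have "K / 2 * ((1 - l) * x\<^sup>2 + l * y\<^sup>2) = K / 2 * ((1 - l) * x + l * y)\<^sup>2 + K / 2 * (l * (1 - l) * (x - y)\<^sup>2)"
      by (simp only: distrib_left)
    moreover have "(1 - l) * v x + l * v y = (1 - l) * u x + l * u y + K / 2 * ((1 - l) * x\<^sup>2 + l * y\<^sup>2)"
    proof -
      have "(1 - l) * (u x + k * x\<^sup>2) + l * (u y + k * y\<^sup>2) =
          (1 - l) * u x + l * u y + k * ((1 - l) * x\<^sup>2 + l * y\<^sup>2)" for k :: real
        by (simp add: algebra_simps)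
      then show ?thesis by (simp only: v_def)
    qed
    ultimately show "v ((1 - l) *\<^sub>R x + l *\<^sub>R y) \<le> (1 - l) * v x + l * v y"
      by (simp add: v_def add_divide_distrib)
  qed simp
  then obtain q where "\<And>y. v y \<ge> v x + q * (y - x)"
    using convex_le_Inf_differential[of UNIV v x] by auto
  then have "u y \<ge> u x + (q - K * x) * (y - x) - K / 2 * (y - x)\<^sup>2" for y
    using \<open>\<And>y. v y \<ge> v x + q * (y - x)\<close>[of y]
    by (simp add: v_def power2_eq_square field_simps)
  then show ?thesis by (rule that)
qed

text \<open>A parabola from below with slope \<open>p\<close> and one from above with slope
  \<open>- q\<close> meet at \<open>x\<close>. Different slopes would make them cross nearby, so one
  slope serves both sides.\<close>

lemma semiconvex_imp_quadratic_approx: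
  assumes "semiconvex K u" "semiconvex K (\<lambda>x. - u x)" "0 \<le> K"
  shows "\<exists>d. quadratic_approx K u d"
proof -
  have "\<exists>p. \<forall>y. \<bar>u y - u x - p * (y - x)\<bar> \<le> K / 2 * (y - x)\<^sup>2" for x
  proof -
    obtain p where p: "\<And>y. u y \<ge> u x + p * (y - x) - K / 2 * (y - x)\<^sup>2"
      using semiconvex_support[OF assms(1)] by blast
    obtain q where q: "\<And>y. - u y \<ge> - u x + q * (y - x) - K / 2 * (y - x)\<^sup>2"
      using semiconvex_support[OF assms(2)] by blast
    define r where "r = p + q"
    have "q = - p"
    proof (rule ccontr)
      assume "q \<noteq> - p"
      then have "r \<noteq> 0" by (simp add: r_def)
      \<comment> \<open>An increment in the direction of \<open>r\<close>, so small that
        \<open>r * h\<close> exceeds \<open>K * h\<^sup>2\<close>; the summand 1 covers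
        \<open>K = 0\<close>.\<close>
      define h where "h = r / (2 * K + 1)"
      have "r * h \<le> K * h\<^sup>2"
        using p[of "x + h"] q[of "x + h"] by (simp add: r_def algebra_simps)
      moreover have "r = (2 * K + 1) * h" using assms(3) by (simp add: h_def)
      ultimately have "(K + 1) * h\<^sup>2 \<le> 0" by (simp add: power2_eq_square algebra_simps)
      moreover have "h \<noteq> 0" using \<open>r \<noteq> 0\<close> \<open>r = (2 * K + 1) * h\<close> by auto
      ultimately show False using assms(3) by (simp add: mult_le_0_iff)
    qed
    then have "\<bar>u y - u x - p * (y - x)\<bar> \<le> K / 2 * (y - x)\<^sup>2" for y
      using p[of y] q[of y] unfolding abs_le_iff by simp
    then show ?thesis by blast
  qed
  then show ?thesis unfolding quadratic_approx_def by metis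
qed

text \<open>A function touched from below by a parabola of curvature above \<open>K\<close> would violate the
  mean value inequality at the point of contact.\<close>

lemma semiconcave_of_heat_le:
  assumes bl: "bounded_lipschitz B L u"
    and \<eta>: "\<eta> \<longlonglongrightarrow> 0" "\<And>j. \<eta> j \<noteq> 0"
    and le: "\<And>j x. heat (\<eta> j) u x \<le> u x + K / 2 * (\<eta> j)\<^sup>2"
  shows "semiconvex K (\<lambda>x. - u x)"
proof (rule ccontr)
  assume "\<not> semiconvex K (\<lambda>x. - u x)"
  then obtain x0 y0 l0 where l0: "0 \<le> l0" "l0 \<le> 1"
    and "\<not> - u ((1 - l0) * x0 + l0 * y0) \<le> (1 - l0) * - u x0 + l0 * - u y0
      + K / 2 * (l0 * (1 - l0) * (x0 - y0)\<^sup>2)"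
    unfolding semiconvex_def by blast
  then have viol0: "u ((1 - l0) * x0 + l0 * y0) < (1 - l0) * u x0 + l0 * u y0
      - K / 2 * (l0 * (1 - l0) * (x0 - y0)\<^sup>2)"
    by simp
  have ne: "x0 \<noteq> y0" using viol0 by (auto simp: algebra_simps)
  obtain x y l where xy: "x < y" and l: "0 \<le> l" "l \<le> 1"
    and viol: "u ((1 - l) * x + l * y) < (1 - l) * u x + l * u y - K / 2 * (l * (1 - l) * (x - y)\<^sup>2)"
  proof (cases "x0 < y0")
    case True
    then show ?thesis using that l0 viol0 by blast
  next
    case False
    then have "y0 < x0" using ne by simp
    moreover have "u ((1 - (1 - l0)) * y0 + (1 - l0) * x0) < (1 - (1 - l0)) * u y0 + (1 - l0) * u x0
        - K / 2 * ((1 - l0) * (1 - (1 - l0)) * (y0 - x0)\<^sup>2)"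
      using viol0 by (simp add: ac_simps power2_commute)
    ultimately show ?thesis using that[of y0 x0 "1 - l0"] l0 by simp
  qed
  define p where "p = (1 - l) * x + l * y"
  define m where "m = (u y - u x) / (y - x)"
  define w where "w = l * (1 - l) * (x - y)\<^sup>2"
  define gap where "gap = (1 - l) * u x + l * u y - K / 2 * w - u p"
  have gap: "0 < gap" using viol by (simp add: gap_def w_def p_def)
  have w: "0 \<le> w" using l by (simp add: w_def)
  \<comment> \<open>\<open>gap\<close> is the amount by which the inequality fails at
    \<open>p\<close>. Raising the curvature from \<open>K\<close> to \<open>K + 2 * \<kappa>\<close>
    lowers the comparison parabola at \<open>p\<close> by \<open>\<kappa> * w\<close>, at most half
    of the gap; the 1 in the denominator allows for \<open>w = 0\<close>.\<close>
  define \<kappa> where "\<kappa> = gap / (2 * (w + 1))"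
  have \<kappa>: "0 < \<kappa>" "\<kappa> * w < gap"
  proof -
    show "0 < \<kappa>" using gap w by (simp add: \<kappa>_def)
    have "\<kappa> * w \<le> \<kappa> * (w + 1)" using \<open>0 < \<kappa>\<close> by simp
    also have "\<dots> = gap / 2" using w by (simp add: \<kappa>_def field_simps)
    also have "\<dots> < gap" using gap by simp
    finally show "\<kappa> * w < gap" .
  qed
  \<comment> \<open>The parabola that agrees with \<open>u\<close> at \<open>x\<close> and
    \<open>y\<close> and has second derivative \<open>K + 2 * \<kappa>\<close>. Since
    \<open>u - q\<close> vanishes at both ends and is negative at \<open>p\<close>, it has an
    interior minimum, where a vertical translate of \<open>q\<close> touches \<open>u\<close> from
    below.\<close>
  define q where "q z = u x + m * (z - x) + (K / 2 + \<kappa>) * ((z - x) * (z - y))" for z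
  define \<psi> where "\<psi> z = u z - q z" for z
  have p: "p \<in> {x..y}"
  proof -
    have "0 \<le> l * (y - x)" "0 \<le> (1 - l) * (y - x)" using l xy by simp_all
    then show ?thesis by (simp add: p_def algebra_simps)
  qed
  have "m * (y - x) = u y - u x" using xy by (simp add: m_def)
  have \<psi>xy: "\<psi> x = 0" "\<psi> y = 0"
    using \<open>m * (y - x) = u y - u x\<close> by (simp_all add: \<psi>_def q_def)
  have "\<psi> p < 0"
  proof -
    have px: "p - x = l * (y - x)" and py: "p - y = (1 - l) * (x - y)"
      by (simp_all add: p_def algebra_simps)
    have w_eq: "(p - x) * (p - y) = - w"
      unfolding px py by (simp add: w_def power2_eq_square algebra_simps)
    have m_eq: "m * (p - x) = l * (u y - u x)"
      unfolding px using \<open>m * (y - x) = u y - u x\<close> by (metis mult.left_commute)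
    have "\<psi> p = u p - (u x + l * (u y - u x) + (K / 2 + \<kappa>) * - w)"
      by (simp only: \<psi>_def q_def w_eq m_eq)
    then have "\<psi> p = \<kappa> * w - gap"
      by (simp add: gap_def algebra_simps)
    then show ?thesis using \<kappa> by simp
  qed
  have "continuous_on {x..y} \<psi>"
    unfolding \<psi>_def q_def by (intro continuous_intros bounded_lipschitz_continuous[OF bl])
  then obtain z where z: "z \<in> {x..y}" and min: "\<And>v. v \<in> {x..y} \<Longrightarrow> \<psi> z \<le> \<psi> v"
    using continuous_attains_inf[of "{x..y}" \<psi>] p by auto
  have "\<psi> z < 0" using min[OF p] \<open>\<psi> p < 0\<close> by simp
  then have z': "x < z" "z < y" using z \<psi>xy by (auto simp: less_le)
  define r where "r = min (z - x) (y - z)"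
  have r: "0 < r" using z' by (simp add: r_def)
  \<comment> \<open>\<open>A\<close> is the slope of \<open>q\<close> at the contact point
    \<open>z\<close>. Outside \<open>{x..y}\<close> the comparison with \<open>q\<close> is lost,
    but there the distance from \<open>z\<close> is at least \<open>r\<close>; the three summands of
    \<open>D\<close> absorb the oscillation of \<open>u\<close>, the linear term and the quadratic
    term.\<close>
  define A where "A = m + (K / 2 + \<kappa>) * (2 * z - x - y)"
  define D where "D = 2 * B / r ^ 4 + \<bar>A\<bar> / r ^ 3 + \<bar>K / 2 + \<kappa>\<bar> / r\<^sup>2"
  have B: "0 \<le> B" using bounded_lipschitzD(1)[OF bl, of 0] by simp
  have D0: "0 \<le> D" using r B by (simp add: D_def)
  have touch: "u v \<ge> u z + A * (v - z) + (K / 2 + \<kappa>) * (v - z)\<^sup>2 - D * (v - z) ^ 4" for v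
  proof (cases "v \<in> {x..y}")
    case True
    have "q v - q z = A * (v - z) + (K / 2 + \<kappa>) * (v - z)\<^sup>2"
    proof -
      have "(u x + m * (v - x) + k * ((v - x) * (v - y))) - (u x + m * (z - x) + k * ((z - x) * (z - y)))
          = (m + k * (2 * z - x - y)) * (v - z) + k * (v - z)\<^sup>2" for k
        by (simp add: power2_eq_square algebra_simps)
      then show ?thesis by (simp only: q_def A_def)
    qed
    moreover have "0 \<le> D * (v - z) ^ 4" using D0 by simp
    ultimately show ?thesis using min[OF True] by (simp add: \<psi>_def)
  next
    case False
    define s where "s = \<bar>v - z\<bar>"
    have rs: "r \<le> s" using False z by (auto simp: s_def r_def)
    have s4: "(v - z) ^ 4 = s ^ 4" "(v - z)\<^sup>2 = s\<^sup>2" by (simp_all add: s_def)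
    have 1: "2 * B \<le> 2 * B / r ^ 4 * s ^ 4"
      using mult_left_mono[OF power_mono[OF rs, of 4], of "2 * B / r ^ 4"] r B by simp
    have 2: "\<bar>A\<bar> * s \<le> \<bar>A\<bar> / r ^ 3 * s ^ 4"
      using mult_left_mono[OF power_mono[OF rs, of 3], of "\<bar>A\<bar> / r ^ 3 * s"] r rs
      by (simp add: power3_eq_cube power4_eq_xxxx ac_simps)
    have 3: "\<bar>K / 2 + \<kappa>\<bar> * s\<^sup>2 \<le> \<bar>K / 2 + \<kappa>\<bar> / r\<^sup>2 * s ^ 4"
      using mult_left_mono[OF power_mono[OF rs, of 2], of "\<bar>K / 2 + \<kappa>\<bar> / r\<^sup>2 * s\<^sup>2"] r rs
      by (simp add: power2_eq_square power4_eq_xxxx ac_simps)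
    have "A * (v - z) \<le> \<bar>A\<bar> * s" by (simp add: s_def abs_mult[symmetric])
    moreover have "(K / 2 + \<kappa>) * s\<^sup>2 \<le> \<bar>K / 2 + \<kappa>\<bar> * s\<^sup>2" by (intro mult_right_mono) auto
    moreover have "u z - u v \<le> 2 * B"
      using bounded_lipschitzD(1)[OF bl, of z] bounded_lipschitzD(1)[OF bl, of v] by simp
    moreover have "D * s ^ 4 = 2 * B / r ^ 4 * s ^ 4 + \<bar>A\<bar> / r ^ 3 * s ^ 4 + \<bar>K / 2 + \<kappa>\<bar> / r\<^sup>2 * s ^ 4"
      by (simp add: D_def distrib_right)
    ultimately show ?thesis using 1 2 3 unfolding s4 by linarith
  qed
  \<comment> \<open>At the contact point the average gains
    \<open>(K / 2 + \<kappa>) * (\<eta> j)\<^sup>2\<close> up to a fourth order loss, while the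
    hypothesis permits only \<open>K / 2 * (\<eta> j)\<^sup>2\<close>.\<close>
  have "\<kappa> \<le> 3 * D * (\<eta> j)\<^sup>2" for j
  proof -
    have "u z + (K / 2 + \<kappa>) * (\<eta> j)\<^sup>2 - 3 * D * \<eta> j ^ 4 \<le> u z + K / 2 * (\<eta> j)\<^sup>2"
      using heat_ge_quartic[OF bl touch, of "\<eta> j"] le[of j z] by simp
    then have "\<kappa> * (\<eta> j)\<^sup>2 \<le> (3 * D * (\<eta> j)\<^sup>2) * (\<eta> j)\<^sup>2"
      by (simp add: power2_eq_square power4_eq_xxxx algebra_simps)
    then show ?thesis using \<eta>(2)[of j] by (simp add: mult_le_cancel_right)
  qed
  moreover have "(\<lambda>j. 3 * D * (\<eta> j)\<^sup>2) \<longlonglongrightarrow> 3 * D * 0\<^sup>2"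
    by (intro tendsto_intros \<eta>)
  ultimately have "\<kappa> \<le> 3 * D * 0\<^sup>2" by (intro LIMSEQ_le_const) auto
  then show False using \<kappa> by simp
qed

section \<open>Second order bounds for the limit\<close>

context volatility_band
begin

text \<open>The first step of the iteration for the terminal value gains at most \<open>K b\<^sup>2 h / 2\<close>, and this
  gain is propagated by the monotone, translation invariant iteration.\<close>

lemma heat_bellman_pow_le:
  assumes q: "quadratic_approx K g d" and bl: "bounded_lipschitz B L g" and h: "0 \<le> h"
  shows "heat (b * sqrt h) ((bellman a b h ^^ n) g) x \<le> (bellman a b h ^^ n) g x + K / 2 * b\<^sup>2 * h"
proof -
  have K: "0 \<le> K" by (rule quadratic_approx_nonneg[OF q])
  have one: "bellman a b h g y \<le> g y + K / 2 * b\<^sup>2 * h" for y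
  proof -
    have le: "g v \<le> g y + d y * (v - y) + K / 2 * (v - y)\<^sup>2 + 0 * (v - y) ^ 4" for v
      using q[unfolded quadratic_approx_def, rule_format, of v y] by linarith
    have "K / 2 * a\<^sup>2 \<le> K / 2 * b\<^sup>2"
      using K a_nonneg a_le_b by (intro mult_left_mono power_mono) auto
    from bellman_pow_le_quartic[OF bl _ h le this order_refl, of 1 y]
    show ?thesis by simp
  qed
  have "heat (b * sqrt h) ((bellman a b h ^^ n) g) x \<le> bellman a b h ((bellman a b h ^^ n) g) x"
    by (rule heat_le_bellman[OF bounded_lipschitz_bellman_pow[OF bl]]) (simp add: a_le_b)
  \<comment> \<open>The additional step is moved from the outside of the iteration to the terminal
    value, where it can be estimated.\<close>
  also have "\<dots> = (bellman a b h ^^ n) (bellman a b h g) x"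
    by (simp add: funpow_swap1)
  also have "\<dots> \<le> (bellman a b h ^^ n) (\<lambda>y. g y + K / 2 * b\<^sup>2 * h) x"
    by (rule bellman_pow_mono[OF bounded_lipschitz_bellman[OF bl] bounded_lipschitz_add_const[OF bl] one])
  also have "\<dots> = (bellman a b h ^^ n) g x + K / 2 * b\<^sup>2 * h"
    by (simp add: bellman_pow_add_const[OF bl])
  finally show ?thesis .
qed

text \<open>Averaging twice doubles the variance and, by monotonicity, at most doubles the error. A
  bound that is linear in the variance thus passes from short to long steps.\<close>

lemma heat_double_le:
  assumes bl: "bounded_lipschitz B L u" and le: "\<And>x. heat s u x \<le> u x + C"
  shows "heat (s * sqrt 2) u x \<le> u x + 2 * C"
proof -
  have "heat (s * sqrt 2) u x \<le> heat s (\<lambda>y. u y + C) x"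
    unfolding heat_heat[OF bl, symmetric]
    by (rule heat_mono[OF bounded_lipschitz_heat[OF bl] bounded_lipschitz_add_const[OF bl] le])
  also have "\<dots> \<le> u x + 2 * C"
    using le[of x] by (simp add: heat_add_const[OF bl])
  finally show ?thesis .
qed

text \<open>An iterate satisfies the inequality at the scale of its own step, which shrinks in the
  limit. To stay at the fixed scale \<open>t / 2 ^ j\<close>, the estimate for the iterate of level
  \<open>j + i\<close> is doubled \<open>i\<close> times; then \<open>i\<close> tends to
  infinity.\<close>

lemma heat_nisio_le:
  assumes q: "quadratic_approx K g d" and bl: "bounded_lipschitz B L g" and t: "0 \<le> t"
  shows "heat (b * sqrt (t / 2 ^ j)) (nisio t g) x \<le> nisio t g x + K / 2 * b\<^sup>2 * (t / 2 ^ j)"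
proof -
  note [measurable] = bounded_lipschitz_measurable[OF bounded_lipschitz_nisio_approx[OF bl]]
    bounded_lipschitz_measurable[OF bounded_lipschitz_nisio[OF bl t]]
  note bla = bounded_lipschitz_nisio_approx[OF bl]
  have approx: "heat (b * sqrt (t / 2 ^ j)) (nisio_approx t (j + i) g) y
      \<le> nisio_approx t (j + i) g y + K / 2 * b\<^sup>2 * (t / 2 ^ j)" for i y
  proof -
    have "heat (b * sqrt (t / 2 ^ (j + i) * 2 ^ n)) (nisio_approx t (j + i) g) y
      \<le> nisio_approx t (j + i) g y + K / 2 * b\<^sup>2 * (t / 2 ^ (j + i) * 2 ^ n)" for n y
    proof (induction n arbitrary: y)
      case 0
      show ?case using heat_bellman_pow_le[OF q bl, of "t / 2 ^ (j + i)" "2 ^ (j + i)" y] t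
        by (simp add: nisio_approx_def)
    next
      case (Suc n)
      from heat_double_le[OF bla Suc.IH, of y]
      show ?case by (simp add: real_sqrt_mult real_sqrt_divide ac_simps)
    qed
    from this[of i y] show ?thesis by (simp add: power_add)
  qed
  have lim: "(\<lambda>i. nisio_approx t (j + i) g y) \<longlonglongrightarrow> nisio t g y" for y
    unfolding add.commute[of j]
    by (rule LIMSEQ_ignore_initial_segment[OF nisio_limit(1)[OF bl t]])
  have "(\<lambda>i. heat (b * sqrt (t / 2 ^ j)) (nisio_approx t (j + i) g) x) \<longlonglongrightarrow>
      heat (b * sqrt (t / 2 ^ j)) (nisio t g) x"
    unfolding heat_def
  proof (rule integral_dominated_convergence[where w = "\<lambda>_. B"])
    show "AE z in gauss. norm (nisio_approx t (j + i) g (x + b * sqrt (t / 2 ^ j) * z)) \<le> B" for i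
      using bounded_lipschitzD(1)[OF bla] by simp
  qed (use lim in auto)
  then show ?thesis
    by (rule LIMSEQ_le[OF _ tendsto_add[OF lim tendsto_const]]) (use approx in auto)
qed

lemma quadratic_approx_nisio:
  assumes q: "quadratic_approx K g d" and bl: "bounded_lipschitz B L g" and t: "0 \<le> t"
  shows "\<exists>d'. quadratic_approx K (nisio t g) d'"
proof (cases "b * t = 0")
  case True
  \<comment> \<open>Without noise every step is the identity, and so is the limit.\<close>
  have "bellman a b (t / 2 ^ k) g' = g'" for k g'
  proof -
    have "heat (c * sqrt (t / 2 ^ k)) g' = g'" if "c \<in> {a..b}" for c
    proof -
      have "c * sqrt (t / 2 ^ k) = 0" using True that a_nonneg by (cases "b = 0") auto
      then show ?thesis by (simp only: heat_0)
    qed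
    then show ?thesis using a_le_b by (simp add: bellman_def fun_eq_iff)
  qed
  then have "bellman a b (t / 2 ^ k) ^^ n = id" for n k
    by (induction n) (auto simp: fun_eq_iff)
  then have "nisio t g = g" by (simp add: nisio_def nisio_approx_def fun_eq_iff)
  then show ?thesis using q by auto
next
  case False
  define \<eta> where "\<eta> j = b * sqrt (t / 2 ^ j)" for j
  have "(\<lambda>j. b * sqrt (t * (1 / 2) ^ j)) \<longlonglongrightarrow> b * sqrt (t * 0)"
    by (intro tendsto_intros) auto
  then have \<eta>: "\<eta> \<longlonglongrightarrow> 0" by (simp add: \<eta>_def[abs_def] power_divide)
  have "semiconvex K (\<lambda>x. - nisio t g x)"
  proof (rule semiconcave_of_heat_le[OF bounded_lipschitz_nisio[OF bl t] \<eta>])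
    show "\<eta> j \<noteq> 0" for j using False by (simp add: \<eta>_def)
    show "heat (\<eta> j) (nisio t g) x \<le> nisio t g x + K / 2 * (\<eta> j)\<^sup>2" for j x
      using heat_nisio_le[OF q bl t, of j x] t by (simp add: \<eta>_def power_mult_distrib)
  qed
  moreover have "semiconvex K (nisio t g)"
    by (rule semiconvex_nisio[OF quadratic_approx_imp_semiconvex[OF q] bl t])
  ultimately show ?thesis
    using semiconvex_imp_quadratic_approx quadratic_approx_nonneg[OF q] by blast
qed

end

section \<open>Lebesgue differentiation\<close>

lemma lebesgue_differentiation_right:
  fixes g :: "real \<Rightarrow> real"
  assumes "\<And>u v. g integrable_on {u..v}"
  obtains N where "negligible N"
    "\<And>x e. x \<notin> N \<Longrightarrow> 0 < e \<Longrightarrow> \<exists>d>0. \<forall>h. 0 \<le> h \<and> h < d \<longrightarrow> \<bar>integral {x..x + h} g - g x * h\<bar> \<le> e * h"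
proof -
  obtain N where N: "negligible N"
    "\<And>x e. x \<notin> N \<Longrightarrow> 0 < e \<Longrightarrow> \<exists>d>0. \<forall>h. 0 < h \<and> h < d \<longrightarrow>
        norm (integral (cbox x (x + h *\<^sub>R One)) g /\<^sub>R h ^ DIM(real) - g x) < e"
    using integrable_ccontinuous_explicit[of g] assms by (metis cbox_interval)
  show ?thesis
  proof (rule that[OF N(1)])
    fix x e :: real assume "x \<notin> N" "0 < e"
    then obtain d where d: "0 < d" "\<And>h. 0 < h \<Longrightarrow> h < d \<Longrightarrow> \<bar>integral {x..x + h} g / h - g x\<bar> < e"
      using N(2)[of x e] by (auto simp: divide_inverse mult.commute)
    have "\<bar>integral {x..x + h} g - g x * h\<bar> \<le> e * h" if "0 \<le> h" "h < d" for h
    proof (cases "h = 0")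
      case False
      then have h: "0 < h" using that by simp
      have "integral {x..x + h} g - g x * h = (integral {x..x + h} g / h - g x) * h"
        using h by (simp add: field_simps)
      then have "\<bar>integral {x..x + h} g - g x * h\<bar> = \<bar>integral {x..x + h} g / h - g x\<bar> * h"
        using h by (simp add: abs_mult)
      then show ?thesis using d(2)[OF h that(2)] h by simp
    qed simp
    then show "\<exists>d>0. \<forall>h. 0 \<le> h \<and> h < d \<longrightarrow> \<bar>integral {x..x + h} g - g x * h\<bar> \<le> e * h"
      using d(1) by blast
  qed
qed

text \<open>Averages to the left of \<open>x\<close> are averages of the reflected function to the
  right of \<open>- x\<close>. Both sides are combined because \<open>x\<close> may lie anywhere in
  the interval, as two-sided differentiability of an antiderivative requires.\<close>

lemma lebesgue_differentiation:
  fixes g :: "real \<Rightarrow> real"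
  assumes g: "\<And>u v. g integrable_on {u..v}"
  shows "AE x in lebesgue. \<forall>e>0. \<exists>d>0. \<forall>u v. x - d < u \<and> u \<le> x \<and> x \<le> v \<and> v < x + d \<longrightarrow>
    \<bar>integral {u..v} g - g x * (v - u)\<bar> \<le> e * (v - u)"
proof -
  obtain N where N: "negligible N"
    "\<And>x e. x \<notin> N \<Longrightarrow> 0 < e \<Longrightarrow> \<exists>d>0. \<forall>h. 0 \<le> h \<and> h < d \<longrightarrow> \<bar>integral {x..x + h} g - g x * h\<bar> \<le> e * h"
    using lebesgue_differentiation_right[OF g] by blast
  have "(\<lambda>x. g (- x)) integrable_on {u..v}" for u v
    using g[of "- v" "- u"] Henstock_Kurzweil_Integration.integrable_reflect_real[of g "- v" "- u"]
    by simp (metis Henstock_Kurzweil_Integration.integrable_reflect_real minus_minus)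
  from lebesgue_differentiation_right[OF this]
  obtain N' where N': "negligible N'"
    "\<And>x e. x \<notin> N' \<Longrightarrow> 0 < e \<Longrightarrow> \<exists>d>0. \<forall>h. 0 \<le> h \<and> h < d \<longrightarrow>
        \<bar>integral {x..x + h} (\<lambda>x. g (- x)) - g (- x) * h\<bar> \<le> e * h"
    by blast
  have "negligible (N \<union> uminus ` N')"
    using N(1) N'(1)
    by (intro negligible_Un negligible_differentiable_image_negligible)
      (auto intro!: derivative_intros)
  then have null: "N \<union> uminus ` N' \<in> null_sets lebesgue" by (simp add: negligible_iff_null_sets)
  show ?thesis
  proof (rule AE_I'[OF null], rule subsetI, rule ccontr)
    let ?P = "\<lambda>x e. \<exists>d>0. \<forall>u v. x - d < u \<and> u \<le> x \<and> x \<le> v \<and> v < x + d \<longrightarrow>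
        \<bar>integral {u..v} g - g x * (v - u)\<bar> \<le> e * (v - u)"
    fix x assume "x \<in> {x \<in> space lebesgue. \<not> (\<forall>e>0. ?P x e)}" and xN: "x \<notin> N \<union> uminus ` N'"
    then obtain e where e: "0 < e" and no: "\<not> ?P x e" by blast
    have "x \<notin> N" "- x \<notin> N'" using xN by (auto simp: image_iff)
    show False
    proof -
      from N(2)[OF \<open>x \<notin> N\<close> e] obtain d where d: "0 < d"
        "\<forall>h. 0 \<le> h \<and> h < d \<longrightarrow> \<bar>integral {x..x + h} g - g x * h\<bar> \<le> e * h"
        by (elim exE conjE)
      from N'(2)[OF \<open>- x \<notin> N'\<close> e] obtain d' where d': "0 < d'"
        "\<forall>h. 0 \<le> h \<and> h < d' \<longrightarrow>
          \<bar>integral {- x..- x + h} (\<lambda>x. g (- x)) - g (- (- x)) * h\<bar> \<le> e * h"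
        by (elim exE conjE)
      have bound: "\<bar>integral {u..v} g - g x * (v - u)\<bar> \<le> e * (v - u)"
        if "x - min d d' < u" "u \<le> x" "x \<le> v" "v < x + min d d'" for u v
      proof -
        have right: "\<bar>integral {x..v} g - g x * (v - x)\<bar> \<le> e * (v - x)"
          using d(2)[rule_format, of "v - x"] that by simp
        have "integral {- x..- u} (\<lambda>x. g (- x)) = integral {u..x} g"
          using integral_reflect_real[of x u g] by simp
        then have left: "\<bar>integral {u..x} g - g x * (x - u)\<bar> \<le> e * (x - u)"
          using d'(2)[rule_format, of "x - u"] that by simp
        have "integral {u..v} g = integral {u..x} g + integral {x..v} g"
          using Henstock_Kurzweil_Integration.integral_combine[OF that(2,3) g] by simp
        then have "integral {u..v} g - g x * (v - u) =
            (integral {u..x} g - g x * (x - u)) + (integral {x..v} g - g x * (v - x))"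
          by (simp add: algebra_simps)
        then have "\<bar>integral {u..v} g - g x * (v - u)\<bar> \<le> e * (x - u) + e * (v - x)"
          using left right by linarith
        also have "\<dots> = e * (v - u)" by (simp add: algebra_simps)
        finally show ?thesis .
      qed
      have "\<exists>d>0. \<forall>u v. x - d < u \<and> u \<le> x \<and> x \<le> v \<and> v < x + d \<longrightarrow>
          \<bar>integral {u..v} g - g x * (v - u)\<bar> \<le> e * (v - u)"
        by (intro exI[of _ "min d d'"] conjI allI impI; (elim conjE, rule bound)?) (use d(1) d'(1) in auto)
      with no show False by (rule notE)
    qed
  qed
qed

section \<open>Smooth test functions and weak derivatives\<close>

text \<open>The polynomial factor makes this family closed under differentiation.\<close>

definition flat_exp :: "real poly \<Rightarrow> real \<Rightarrow> real" where
  "flat_exp P x = (if 0 < x then poly P (1 / x) * exp (- (1 / x)) else 0)"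

lemma poly_exp_tendsto_0: "((\<lambda>y. poly P y * exp (- y)) \<longlongrightarrow> (0 :: real)) at_top"
proof -
  have "((\<lambda>y. \<Sum>i\<le>degree P. coeff P i * (y ^ i / exp y)) \<longlongrightarrow> (\<Sum>i\<le>degree P. coeff P i * 0)) at_top"
    by (intro tendsto_intros tendsto_power_div_exp_0)
  then show ?thesis
    by (simp add: poly_altdef exp_minus sum_distrib_right divide_inverse mult.assoc)
qed

text \<open>With \<open>y = 1 / x\<close>, the chain rule turns \<open>poly P y * exp (- y)\<close>
  into \<open>y\<^sup>2 * (poly P y - poly (pderiv P) y) * exp (- y)\<close>. At 0 the difference
  quotient from the right is \<open>y * poly P y * exp (- y)\<close>, which tends to 0, so the
  extension by 0 is differentiable.\<close>

lemma flat_exp_deriv: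
  "(flat_exp P has_real_derivative flat_exp ([:0, 0, 1:] * (P - pderiv P)) x) (at x)"
proof -
  consider "0 < x" | "x < 0" | "x = 0" by linarith
  then show ?thesis
  proof cases
    case 1
    have "((\<lambda>x. poly P (1 / x) * exp (- (1 / x))) has_real_derivative
        poly P (1 / x) * (exp (- (1 / x)) * (1 / x\<^sup>2)) + poly (pderiv P) (1 / x) * (- 1 / x\<^sup>2) * exp (- (1 / x))) (at x)"
      using 1 by (auto intro!: derivative_eq_intros DERIV_chain2[OF poly_DERIV] simp: power2_eq_square field_simps)
    moreover have "poly P (1 / x) * (exp (- (1 / x)) * (1 / x\<^sup>2)) + poly (pderiv P) (1 / x) * (- 1 / x\<^sup>2) * exp (- (1 / x))
        = flat_exp ([:0, 0, 1:] * (P - pderiv P)) x"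
      using 1 by (simp add: flat_exp_def power2_eq_square field_simps)
    ultimately have "((\<lambda>x. poly P (1 / x) * exp (- (1 / x))) has_real_derivative
        flat_exp ([:0, 0, 1:] * (P - pderiv P)) x) (at x)" by simp
    moreover have "\<forall>\<^sub>F y in nhds x. flat_exp P y = poly P (1 / y) * exp (- (1 / y))"
      using eventually_nhds_in_open[of "{0<..}" x] 1
      by (auto elim!: eventually_mono simp: flat_exp_def)
    ultimately show ?thesis by (subst DERIV_cong_ev[OF refl _ refl]) auto
  next
    case 2
    have "\<forall>\<^sub>F y in nhds x. flat_exp P y = 0"
      using eventually_nhds_in_open[of "{..<0}" x] 2
      by (auto elim!: eventually_mono simp: flat_exp_def)
    then show ?thesis
      by (subst DERIV_cong_ev[OF refl _ refl, where g = "\<lambda>_. 0"]) (use 2 in \<open>auto simp: flat_exp_def\<close>)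
  next
    case 3
    have right: "((\<lambda>h. flat_exp P h / h) \<longlongrightarrow> 0) (at_right 0)"
    proof -
      have "((\<lambda>h. poly ([:0, 1:] * P) (inverse h) * exp (- inverse h)) \<longlongrightarrow> (0 :: real)) (at_right 0)"
        by (rule filterlim_compose[OF poly_exp_tendsto_0 filterlim_inverse_at_top_right])
      then show ?thesis
        by (rule Lim_transform_eventually)
          (auto simp: eventually_at_filter flat_exp_def field_simps inverse_eq_divide intro!: always_eventually)
    qed
    moreover have "((\<lambda>h. flat_exp P h / h) \<longlongrightarrow> 0) (at_left 0)"
      by (rule Lim_transform_eventually[OF tendsto_const])
        (auto simp: eventually_at_filter flat_exp_def intro!: always_eventually)
    ultimately have "((\<lambda>h. flat_exp P h / h) \<longlongrightarrow> 0) (at 0)"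
      by (simp add: filterlim_at_split)
    then show ?thesis using 3 by (simp add: DERIV_def flat_exp_def)
  qed
qed

inductive bump_sum :: "(real \<Rightarrow> real) \<Rightarrow> bool" where
  base: "bump_sum (\<lambda>x. flat_exp P x * flat_exp Q (1 - x))"
| add: "bump_sum f \<Longrightarrow> bump_sum g \<Longrightarrow> bump_sum (\<lambda>x. f x + g x)"

lemma bump_sum_deriv:
  "bump_sum f \<Longrightarrow> \<exists>g. bump_sum g \<and> (\<forall>x. (f has_real_derivative g x) (at x))"
proof (induction rule: bump_sum.induct)
  case (base P Q)
  let ?D = "\<lambda>P. [:0, 0, 1:] * (P - pderiv P)"
  let ?g = "\<lambda>x. flat_exp (?D P) x * flat_exp Q (1 - x) + flat_exp P x * flat_exp (- ?D Q) (1 - x)"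
  have neg: "flat_exp (- R) y = - flat_exp R y" for R y by (simp add: flat_exp_def)
  have "((\<lambda>x. flat_exp P x * flat_exp Q (1 - x)) has_real_derivative ?g x) (at x)" for x
    unfolding neg
    by (rule derivative_eq_intros flat_exp_deriv DERIV_chain2[OF flat_exp_deriv] refl | simp)+
  moreover have "bump_sum ?g" by (intro bump_sum.intros)
  ultimately show ?case by blast
next
  case (add f g)
  then obtain f' g' where "bump_sum f'" "bump_sum g'" "\<And>x. (f has_real_derivative f' x) (at x)"
    "\<And>x. (g has_real_derivative g' x) (at x)" by blast
  then show ?case by (intro exI[of _ "\<lambda>x. f' x + g' x"]) (auto intro: bump_sum.add DERIV_add)
qed

text \<open>The successive derivatives are carried along as data: after rescaling, translation or
  integration they are given by a formula, without iterating \<open>deriv\<close>.\<close>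

definition derivative_chain :: "(nat \<Rightarrow> real \<Rightarrow> real) \<Rightarrow> bool" where
  "derivative_chain D \<longleftrightarrow> (\<forall>n x. (D n has_real_derivative D (Suc n) x) (at x))"

lemma derivative_chainD: "derivative_chain D \<Longrightarrow> (D n has_real_derivative D (Suc n) x) (at x)"
  by (simp add: derivative_chain_def)

lemma derivative_chain_continuous: "derivative_chain D \<Longrightarrow> continuous_on A (D n)"
  by (meson DERIV_isCont continuous_at_imp_continuous_on derivative_chainD)

lemma derivative_chain_deriv:
  assumes "derivative_chain D"
  shows "(deriv ^^ n) (D 0) = D n"
proof (induction n)
  case (Suc n)
  have "deriv (D n) = D (Suc n)"
    by (rule ext) (rule DERIV_imp_deriv[OF derivative_chainD[OF assms]])
  then show ?case using Suc by simp
qed simp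

lemma derivative_chain_zero:
  assumes D: "derivative_chain D" and zero: "\<And>x. x \<notin> {A..B} \<Longrightarrow> D 0 x = 0" and "x \<notin> {A..B}"
  shows "D n x = 0"
  using assms(3)
proof (induction n arbitrary: x)
  case (Suc n)
  have "open (- {A..B})" by (rule open_Compl[OF closed_atLeastAtMost])
  then have "\<forall>\<^sub>F y in nhds x. D n y = 0"
    using eventually_nhds_in_open[of "- {A..B}" x] Suc by (auto elim!: eventually_mono)
  then have "(D n has_real_derivative 0) (at x)"
    by (subst DERIV_cong_ev[OF refl _ refl, where g = "\<lambda>_. 0"]) auto
  then show ?case using derivative_chainD[OF D] DERIV_unique by blast
qed (rule zero)

lemma derivative_chain_test_function:
  assumes D: "derivative_chain D" and zero: "\<And>x. x \<notin> {A..B} \<Longrightarrow> D 0 x = 0"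
  shows "D 0 \<in> test_functions"
proof -
  have "{x. D 0 x \<noteq> 0} \<subseteq> {A..B}" using zero by blast
  then have "bounded {x. D 0 x \<noteq> 0}" using bounded_subset bounded_closed_interval by blast
  then show ?thesis
    using derivative_chainD[OF D]
    by (auto simp: test_functions_def derivative_chain_deriv[OF D] field_differentiable_def)
qed

lemma smooth_bump:
  obtains D where "derivative_chain D" "\<And>x. 0 \<le> D 0 x" "\<And>x. x \<notin> {0<..<1} \<Longrightarrow> D 0 x = 0"
    "\<And>x. x \<in> {0<..<1} \<Longrightarrow> 0 < D 0 x"
proof -
  let ?b = "\<lambda>x. flat_exp 1 x * flat_exp 1 (1 - x)"
  \<comment> \<open>The clause for \<open>n = 0\<close> pins the start of the chain, which dependent
    choice would leave open.\<close>
  have "\<exists>D. \<forall>n :: nat. (bump_sum (D n) \<and> (n = 0 \<longrightarrow> D n = ?b)) \<and>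
      (\<forall>x. (D n has_real_derivative D (Suc n) x) (at x))"
  proof (rule dependent_nat_choice)
    show "\<exists>f. bump_sum f \<and> ((0 :: nat) = 0 \<longrightarrow> f = ?b)" using bump_sum.base[of 1 1] by auto
  next
    fix f and n :: nat assume "bump_sum f \<and> (n = 0 \<longrightarrow> f = ?b)"
    then show "\<exists>g. (bump_sum g \<and> (Suc n = 0 \<longrightarrow> g = ?b)) \<and> (\<forall>x. (f has_real_derivative g x) (at x))"
      using bump_sum_deriv by simp
  qed
  then obtain D where D: "\<And>n. n = 0 \<longrightarrow> D n = ?b" "\<And>n x. (D n has_real_derivative D (Suc n) x) (at x)"
    by blast
  then have D0: "D 0 = ?b" by blast
  show ?thesis
    by (rule that[of D]) (auto simp: derivative_chain_def D D0 flat_exp_def)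
qed

text \<open>The smooth step is the normalised antiderivative of a bump function.\<close>

lemma smooth_step:
  obtains D where "derivative_chain D" "\<And>x. x \<le> 0 \<Longrightarrow> D 0 x = 0" "\<And>x. 1 \<le> x \<Longrightarrow> D 0 x = 1"
    "\<And>x. 0 \<le> D 0 x \<and> D 0 x \<le> 1"
proof -
  obtain D where D: "derivative_chain D" "\<And>x. 0 \<le> D 0 x" "\<And>x. x \<notin> {0<..<1} \<Longrightarrow> D 0 x = 0"
    "\<And>x. x \<in> {0<..<1} \<Longrightarrow> 0 < D 0 x"
    using smooth_bump by blast
  \<comment> \<open>Starting the integral at -1 makes every point of \<open>{0..}\<close> an
    interior point of the interval on which it is differentiated, including 0.\<close>
  define \<Phi> where "\<Phi> x = integral {-1..x} (D 0)" for x
  have low: "\<Phi> x = 0" if "x \<le> 0" for x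
    unfolding \<Phi>_def using that D(3)
    by (intro integral_unique has_integral_is_0) auto
  have deriv: "(\<Phi> has_real_derivative D 0 x) (at x)" for x
  proof (cases "x < 0")
    case True
    have "\<forall>\<^sub>F y in nhds x. \<Phi> y = 0"
      using eventually_nhds_in_open[of "{..<0}" x] True by (auto elim!: eventually_mono simp: low)
    then show ?thesis
      by (subst DERIV_cong_ev[OF refl _ refl, where g = "\<lambda>_. 0"]) (use True D(3) in auto)
  next
    case False
    have "(\<Phi> has_real_derivative D 0 x) (at x within {-1..x + 1})"
      unfolding \<Phi>_def[abs_def]
      by (rule integral_has_real_derivative[OF derivative_chain_continuous[OF D(1)]]) (use False in auto)
    then show ?thesis using False by (subst (asm) at_within_Icc_at) auto
  qed
  have mono: "\<Phi> x \<le> \<Phi> y" if "x \<le> y" for x y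
    by (rule DERIV_nonneg_imp_nondecreasing[OF that]) (use deriv D(2) in blast)
  have \<Phi>_cont: "continuous_on A \<Phi>" for A
    by (meson DERIV_isCont continuous_at_imp_continuous_on deriv)
  have high: "\<Phi> x = \<Phi> 1" if "1 \<le> x" for x
  proof (cases "x = 1")
    case False
    then show ?thesis
      using that D(3) deriv
      by (intro DERIV_isconst2[of 1 x \<Phi>] \<Phi>_cont) (auto, metis greaterThanLessThan_iff less_asym)
  qed simp
  have "\<Phi> 0 < \<Phi> 1"
    by (rule DERIV_pos_imp_increasing_open[OF zero_less_one _ \<Phi>_cont]) (use deriv D(4) in auto)
  then have pos: "0 < \<Phi> 1" by (simp add: low)
  define E where "E n x = (case n of 0 \<Rightarrow> \<Phi> x | Suc m \<Rightarrow> D m x) / \<Phi> 1" for n x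
  show ?thesis
  proof (rule that[of E])
    show "derivative_chain E"
      unfolding derivative_chain_def
    proof (intro allI)
      fix n x
      show "(E n has_real_derivative E (Suc n) x) (at x)"
      proof (cases n)
        case 0
        show ?thesis
          unfolding 0 by (simp only: E_def[abs_def] nat.case) (rule DERIV_cdivide[OF deriv])
      next
        case (Suc m)
        show ?thesis
          unfolding Suc by (simp only: E_def[abs_def] nat.case)
            (rule DERIV_cdivide[OF derivative_chainD[OF D(1)]])
      qed
    qed
    show "E 0 x = 0" if "x \<le> 0" for x using that by (simp add: E_def low)
    show "E 0 x = 1" if "1 \<le> x" for x using high[OF that] pos by (simp add: E_def)
    show "0 \<le> E 0 x \<and> E 0 x \<le> 1" for x
    proof -
      have "0 \<le> \<Phi> x" using mono[of 0 x] low[of x] low[of 0] by (cases "x \<le> 0") auto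
      moreover have "\<Phi> x \<le> \<Phi> 1" using mono[of x 1] high[of x] by (cases "x \<le> 1") auto
      ultimately show ?thesis using pos by (simp add: E_def)
    qed
  qed
qed

lemma test_functionE:
  assumes "\<phi> \<in> test_functions"
  obtains D A B where "derivative_chain D" "D 0 = \<phi>" "A \<le> B" "\<And>n. (deriv ^^ n) \<phi> = D n"
    "\<And>n x. x \<notin> {A..B} \<Longrightarrow> D n x = 0"
proof -
  define D where "D n = (deriv ^^ n) \<phi>" for n
  have D: "derivative_chain D"
    using assms unfolding derivative_chain_def D_def test_functions_def
    by (auto simp: field_differentiable_derivI)
  have "bounded {x. \<phi> x \<noteq> 0}"
    using assms by (auto simp: test_functions_def intro: bounded_subset[OF compact_imp_bounded closure_subset])
  then obtain a where a: "\<And>x. \<phi> x \<noteq> 0 \<Longrightarrow> \<bar>x\<bar> \<le> a" by (auto simp: bounded_iff)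
  \<comment> \<open>The absolute value keeps the interval nonempty even when \<open>\<phi>\<close>
    vanishes identically and \<open>a\<close> may be negative.\<close>
  have zero: "D 0 x = 0" if "x \<notin> {- \<bar>a\<bar>..\<bar>a\<bar>}" for x
  proof (rule ccontr)
    assume "D 0 x \<noteq> 0"
    then have "\<bar>x\<bar> \<le> a" using a by (simp add: D_def)
    then have "- \<bar>a\<bar> \<le> x \<and> x \<le> \<bar>a\<bar>" by linarith
    with that show False by simp
  qed
  show ?thesis
    by (rule that[OF D _ _ _ derivative_chain_zero[OF D zero]]) (auto simp: D_def)
qed

section \<open>Increments of the first derivative as integrals of the weak second derivative\<close>

lemma integral_by_parts_compact_support:
  fixes F G f g :: "real \<Rightarrow> real"
  assumes F: "\<And>x. (F has_real_derivative f x) (at x)" "continuous_on UNIV f"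
    and G: "\<And>x. (G has_real_derivative g x) (at x)" "continuous_on UNIV g"
    and zero: "\<And>x. x \<notin> {A..B} \<Longrightarrow> G x = 0 \<and> g x = 0" and AB: "A \<le> B"
  shows "(LINT x|lebesgue. F x * g x) = - (LINT x|lebesgue. f x * G x)"
proof -
  have cont: "continuous_on UNIV F" "continuous_on UNIV G"
    using F(1) G(1) by (meson DERIV_isCont continuous_at_imp_continuous_on)+
  note meas = borel_measurable_continuous_onI[OF continuous_on_mult[OF cont(1) G(2)]]
    borel_measurable_continuous_onI[OF continuous_on_mult[OF F(2) cont(2)]]
  \<comment> \<open>One unit is added on each side because \<open>G\<close> is given to vanish
    outside \<open>{A..B}\<close>, not at the endpoints.\<close>
  have ind: "(\<lambda>x. F x * g x * indicator {A - 1..B + 1} x) = (\<lambda>x. F x * g x)"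
    "(\<lambda>x. f x * G x * indicator {A - 1..B + 1} x) = (\<lambda>x. f x * G x)"
    using zero by (auto simp: fun_eq_iff split: split_indicator)
  have "(LINT x|lborel. F x * g x * indicator {A - 1..B + 1} x) =
      F (B + 1) * G (B + 1) - F (A - 1) * G (A - 1) - (LINT x|lborel. f x * G x * indicator {A - 1..B + 1} x)"
    by (rule integral_by_parts) (use AB F G in \<open>auto simp: continuous_on_eq_continuous_at\<close>)
  moreover have "G (B + 1) = 0" "G (A - 1) = 0" using zero[of "B + 1"] zero[of "A - 1"] AB by auto
  ultimately show ?thesis
    using meas unfolding ind by (simp add: integral_completion)
qed

text \<open>For a smooth step \<open>D 0\<close> and \<open>m > 0\<close>, the member of order 0
  rises after \<open>u\<close> and falls after \<open>v\<close>, each within a distance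
  \<open>1 / m\<close>; every derivative brings a factor \<open>m\<close>.\<close>

lemma derivative_chain_affine_diff:
  assumes D: "derivative_chain D"
  shows "derivative_chain (\<lambda>n x. m ^ n * (D n (m * (x - u)) - D n (m * (x - v))))"
  unfolding derivative_chain_def
  by (auto intro!: derivative_eq_intros DERIV_chain2[OF derivative_chainD[OF D]] simp: algebra_simps)

lemma smooth_step_derivative_zero:
  assumes D: "derivative_chain D" "\<And>x. x \<le> 0 \<Longrightarrow> D 0 x = 0" "\<And>x. 1 \<le> x \<Longrightarrow> D 0 x = 1"
    and x: "x \<notin> {0..1}"
  shows "D 1 x = 0"
proof -
  have "\<forall>\<^sub>F y in nhds x. D 0 y = D 0 x"
  proof (cases "x < 0")
    case True
    then show ?thesis
      using eventually_nhds_in_open[of "{..<0}" x] D(2) by (auto elim!: eventually_mono)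
  next
    case False
    then show ?thesis
      using eventually_nhds_in_open[of "{1<..}" x] D(3) x by (auto elim!: eventually_mono)
  qed
  then have "(D 0 has_real_derivative 0) (at x)"
    by (subst DERIV_cong_ev[OF refl _ refl, where g = "\<lambda>_. D 0 x"]) auto
  then show ?thesis using derivative_chainD[OF D(1), of 0 x] DERIV_unique by simp
qed

text \<open>The kernel is the derivative of the rescaled step: it vanishes outside
  \<open>{u..u + 1 / real (Suc k)}\<close> and has total mass
  \<open>D 0 1 - D 0 0 = 1\<close>.\<close>

lemma approximate_identity:
  assumes D: "derivative_chain D" "\<And>x. x \<le> 0 \<Longrightarrow> D 0 x = 0" "\<And>x. 1 \<le> x \<Longrightarrow> D 0 x = 1"
    and d: "continuous_on UNIV d"
  shows "(\<lambda>k. LINT z|lborel. d z * (real (Suc k) * D 1 (real (Suc k) * (z - u)))) \<longlonglongrightarrow> d u"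
proof -
  have D1: "D 1 x = 0" if "x \<notin> {0..1}" for x
    using smooth_step_derivative_zero[of D x] D that by blast
  have [measurable]: "d \<in> borel_measurable borel" "D 1 \<in> borel_measurable borel"
    by (intro borel_measurable_continuous_onI d derivative_chain_continuous[OF D(1)])+
  have "(LINT x|lborel. D 1 x * indicator {0..1} x) = D 0 1 - D 0 0"
    using derivative_chainD[OF D(1), of 0] derivative_chain_continuous[OF D(1), of UNIV 1]
    by (intro integral_FTC_Icc_real) (auto simp: continuous_on_eq_continuous_at)
  moreover have "(\<lambda>x. D 1 x * indicator {0..1} x) = D 1"
    using D1 by (auto simp: fun_eq_iff split: split_indicator)
  ultimately have mass: "(LINT x|lborel. D 1 x) = 1" using D by simp
  have int1: "integrable lborel (\<lambda>x. indicator {0..1} x *\<^sub>R \<bar>D 1 x\<bar>)"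
    by (intro borel_integrable_compact continuous_on_rabs derivative_chain_continuous[OF D(1)]) auto
  have "compact {u..u + 1}" by simp
  then have "bounded (d ` {u..u + 1})"
    by (intro compact_imp_bounded compact_continuous_image continuous_on_subset[OF d]) auto
  then obtain C where C: "\<And>z. z \<in> {u..u + 1} \<Longrightarrow> \<bar>d z\<bar> \<le> C"
    unfolding bounded_iff by (metis imageI real_norm_def)
  have subst: "(LINT z|lborel. d z * (real (Suc k) * D 1 (real (Suc k) * (z - u)))) =
      (LINT x|lborel. d (u + x / real (Suc k)) * D 1 x)" for k
    using lborel_integral_real_affine[of "1 / real (Suc k)" "\<lambda>z. d z * (real (Suc k) * D 1 (real (Suc k) * (z - u)))" u]
    by (simp add: integral_mult_right_zero[symmetric] mult.left_commute del: integral_mult_right_zero of_nat_Suc)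
  have "(\<lambda>k. LINT x|lborel. d (u + x / real (Suc k)) * D 1 x) \<longlonglongrightarrow> (LINT x|lborel. d u * D 1 x)"
  proof (rule integral_dominated_convergence[where w = "\<lambda>x. C * (indicator {0..1} x *\<^sub>R \<bar>D 1 x\<bar>)"])
    show "AE x in lborel. (\<lambda>k. d (u + x / real (Suc k)) * D 1 x) \<longlonglongrightarrow> d u * D 1 x"
    proof (intro AE_I2 tendsto_intros)
      fix x
      have "(\<lambda>k. u + x * inverse (real (Suc k))) \<longlonglongrightarrow> u + x * 0"
        by (intro tendsto_intros LIMSEQ_inverse_real_of_nat)
      then have "(\<lambda>k. u + x / real (Suc k)) \<longlonglongrightarrow> u" by (simp add: divide_inverse)
      moreover have "isCont d u" using d by (simp add: continuous_on_eq_continuous_at)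
      ultimately show "(\<lambda>k. d (u + x / real (Suc k))) \<longlonglongrightarrow> d u" by (rule isCont_tendsto_compose[rotated])
    qed
    show "AE x in lborel. norm (d (u + x / real (Suc k)) * D 1 x) \<le> C * (indicator {0..1} x *\<^sub>R \<bar>D 1 x\<bar>)" for k
    proof (rule AE_I2)
      fix x
      show "norm (d (u + x / real (Suc k)) * D 1 x) \<le> C * (indicator {0..1} x *\<^sub>R \<bar>D 1 x\<bar>)"
      proof (cases "x \<in> {0..1}")
        case True
        then have "x / real (Suc k) \<le> 1" "0 \<le> x / real (Suc k)" by (auto simp: divide_le_eq)
        then have "\<bar>d (u + x / real (Suc k))\<bar> \<le> C" by (intro C) auto
        then show ?thesis using True by (simp add: abs_mult mult_right_mono)
      next
        case False
        then show ?thesis using D1[OF False] by simp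
      qed
    qed
    show "(\<lambda>x. d u * D 1 x) \<in> borel_measurable lborel"
      "(\<lambda>x. d (u + x / real (Suc k)) * D 1 x) \<in> borel_measurable lborel" for k by measurable
  qed (use int1 in simp)
  moreover have "(LINT x|lborel. d u * D 1 x) = d u" using mass by simp
  ultimately show ?thesis unfolding subst by (simp only:)
qed

text \<open>The test functions \<open>E k 0\<close> are smooth approximations of the indicator function of \<open>{u<..v}\<close>.\<close>

lemma weak_second_derivative_increment:
  assumes f: "\<And>x. (f has_real_derivative d x) (at x)" "continuous_on UNIV d"
    and g: "has_weak_deriv 2 f g" and uv: "u \<le> v"
  shows "d v - d u = integral {u..v} g"
proof -
  obtain D where D: "derivative_chain D" "\<And>x. x \<le> 0 \<Longrightarrow> D 0 x = 0" "\<And>x. 1 \<le> x \<Longrightarrow> D 0 x = 1"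
    "\<And>x. 0 \<le> D 0 x \<and> D 0 x \<le> 1" using smooth_step by blast
  define E where "E k n x = real (Suc k) ^ n * (D n (real (Suc k) * (x - u)) - D n (real (Suc k) * (x - v)))" for k n x
  have E: "derivative_chain (E k)" for k
    unfolding E_def by (rule derivative_chain_affine_diff[OF D(1)])
  have E0: "E k 0 x = 0" if "x \<notin> {u..v + 1}" for k x
  proof (cases "x < u")
    case True
    then have "real (Suc k) * (x - u) \<le> 0" "real (Suc k) * (x - v) \<le> 0"
      using uv by (auto intro: mult_nonneg_nonpos)
    then show ?thesis by (simp add: E_def D(2))
  next
    case False
    then have "1 * 1 \<le> real (Suc k) * (x - u)" "1 * 1 \<le> real (Suc k) * (x - v)"
      using that uv by (intro mult_mono; auto)+
    then show ?thesis by (simp add: E_def D(3))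
  qed
  have Ez: "E k n x = 0" if "x \<notin> {u..v + 1}" for k n x by (rule derivative_chain_zero[OF E E0 that])
  have test: "E k 0 \<in> test_functions" for k by (rule derivative_chain_test_function[OF E E0])
  \<comment> \<open>The weak derivative puts both derivatives on the test function; taking one of
    them back to \<open>f\<close> leaves \<open>d\<close> against the difference of approximate
    identities at \<open>u\<close> and \<open>v\<close>.\<close>
  have gE: "(LINT x|lebesgue. g x * E k 0 x) = - (LINT x|lebesgue. d x * E k 1 x)" for k
  proof -
    have "(LINT x|lebesgue. f x * E k 2 x) = (LINT x|lebesgue. g x * E k 0 x)"
      using g test[of k] unfolding has_weak_deriv_def derivative_chain_deriv[OF E, of 2 k, symmetric] by simp
    moreover have "(LINT x|lebesgue. f x * E k 2 x) = - (LINT x|lebesgue. d x * E k 1 x)"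
      using derivative_chainD[OF E, of k 1] derivative_chain_continuous[OF E] Ez uv
      by (intro integral_by_parts_compact_support[OF f, of _ _ u "v + 1"]) (auto simp: numeral_2_eq_2)
    ultimately show ?thesis by simp
  qed
  have dE: "(LINT x|lebesgue. d x * E k 1 x) =
      (LINT z|lborel. d z * (real (Suc k) * D 1 (real (Suc k) * (z - u)))) -
      (LINT z|lborel. d z * (real (Suc k) * D 1 (real (Suc k) * (z - v))))" for k
  proof -
    have int: "integrable lborel (\<lambda>z. d z * (real (Suc k) * D 1 (real (Suc k) * (z - w))))" for w
    proof -
      have "integrable lborel (\<lambda>z. indicator {w..w + 1} z *\<^sub>R (d z * (real (Suc k) * D 1 (real (Suc k) * (z - w)))))"
        by (intro borel_integrable_compact compact_Icc continuous_intros continuous_on_subset[OF f(2)]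
            continuous_on_compose2[OF derivative_chain_continuous[OF D(1), of UNIV]]) auto
      also have "(\<lambda>z. indicator {w..w + 1} z *\<^sub>R (d z * (real (Suc k) * D 1 (real (Suc k) * (z - w))))) =
          (\<lambda>z. d z * (real (Suc k) * D 1 (real (Suc k) * (z - w))))"
      proof
        fix z
        have "D 1 (real (Suc k) * (z - w)) = 0" if "z \<notin> {w..w + 1}"
        proof (rule smooth_step_derivative_zero[OF D(1-3)])
          have "1 * 1 < real (Suc k) * (z - w)" if "1 < z - w"
            using that by (intro mult_le_less_imp_less) auto
          moreover have "real (Suc k) * (z - w) < 0" if "z - w < 0"
            using that by (intro mult_pos_neg) auto
          ultimately show "real (Suc k) * (z - w) \<notin> {0..1}" using that by fastforce
        qed
        then show "indicator {w..w + 1} z *\<^sub>R (d z * (real (Suc k) * D 1 (real (Suc k) * (z - w)))) =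
            d z * (real (Suc k) * D 1 (real (Suc k) * (z - w)))"
          by (cases "z \<in> {w..w + 1}") simp_all
      qed
      finally show ?thesis .
    qed
    have "(\<lambda>x. d x * E k 1 x) \<in> borel_measurable lborel"
      using continuous_on_mult[OF f(2) derivative_chain_continuous[OF E, of UNIV k 1]]
      by (simp add: borel_measurable_continuous_onI)
    then have "(LINT x|lebesgue. d x * E k 1 x) = (LINT x|lborel. d x * E k 1 x)"
      by (rule integral_completion)
    also have "\<dots> = (LINT z|lborel. d z * (real (Suc k) * D 1 (real (Suc k) * (z - u))) -
        d z * (real (Suc k) * D 1 (real (Suc k) * (z - v))))"
      by (simp add: E_def right_diff_distrib)
    finally show ?thesis using int by simp
  qed
  have lim1: "(\<lambda>k. LINT x|lebesgue. g x * E k 0 x) \<longlonglongrightarrow> d v - d u"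
    unfolding gE dE minus_diff_eq
    by (intro tendsto_diff approximate_identity D f(2))
  have g_int: "set_integrable lebesgue {u..v + 1} g" "set_integrable lebesgue {u..v} g"
    using g by (auto simp: has_weak_deriv_def locally_integrable_def)
  define G where "G x = indicator {u..v + 1} x * g x" for x
  have G: "integrable lebesgue G" using g_int(1) by (simp add: set_integrable_def G_def[abs_def])
  have [measurable]: "G \<in> borel_measurable lebesgue" using G by auto
  have gG: "g x * E k 0 x = E k 0 x * G x" for k x using E0[of x k] by (simp add: G_def split: split_indicator)
  have far: "\<exists>N. \<forall>k\<ge>N. 1 \<le> real (Suc k) * y" if "0 < y" for y :: real
  proof -
    obtain N where "1 / y < real N" using reals_Archimedean2 by blast
    then have "1 < real N * y" using that by (simp add: field_simps)
    moreover have "real N * y \<le> real (Suc k) * y" if "N \<le> k" for k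
      using that \<open>0 < y\<close> by (intro mult_right_mono) auto
    ultimately show ?thesis by (meson less_imp_le order_trans)
  qed
  have near: "real (Suc k) * y \<le> 0" if "y \<le> 0" for k y using that by (intro mult_nonneg_nonpos) auto
  \<comment> \<open>At \<open>x = u\<close> both steps are still 0; at \<open>x = v\<close>, if
    \<open>u < v\<close>, the first is eventually 1 while the second is 0. Hence the interval is
    open on the left and closed on the right.\<close>
  have pt: "(\<lambda>k. E k 0 x) \<longlonglongrightarrow> indicator {u<..v} x" for x
  proof -
    have "\<forall>\<^sub>F k in sequentially. indicator {u<..v} x = E k 0 x"
    proof (cases "x \<le> u")
      case True
      then show ?thesis using uv by (intro always_eventually allI) (simp add: E_def D(2) near del: of_nat_Suc)
    next
      case False
      then obtain N where N: "\<And>k. N \<le> k \<Longrightarrow> 1 \<le> real (Suc k) * (x - u)" using far[of "x - u"] by auto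
      show ?thesis
      proof (cases "x \<le> v")
        case True
        then show ?thesis
          using N False by (intro eventually_sequentiallyI[of N]) (simp add: E_def D near del: of_nat_Suc)
      next
        case xv: False
        then obtain N' where N': "\<And>k. N' \<le> k \<Longrightarrow> 1 \<le> real (Suc k) * (x - v)" using far[of "x - v"] by auto
        show ?thesis
          using N N' False xv by (intro eventually_sequentiallyI[of "max N N'"]) (simp add: E_def D del: of_nat_Suc)
      qed
    qed
    then show ?thesis by (rule Lim_transform_eventually[OF tendsto_const])
  qed
  have lim2: "(\<lambda>k. LINT x|lebesgue. E k 0 x * G x) \<longlonglongrightarrow> (LINT x|lebesgue. indicator {u<..v} x * G x)"
  proof (rule integral_dominated_convergence[where w = "\<lambda>x. \<bar>G x\<bar>"])
    show "AE x in lebesgue. (\<lambda>k. E k 0 x * G x) \<longlonglongrightarrow> indicator {u<..v} x * G x"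
      by (intro AE_I2 tendsto_intros pt)
    have "\<bar>E k 0 x\<bar> \<le> 1" for k x
      using D(4)[of "real (Suc k) * (x - u)"] D(4)[of "real (Suc k) * (x - v)"]
      by (simp add: E_def abs_le_iff)
    then show "AE x in lebesgue. norm (E k 0 x * G x) \<le> \<bar>G x\<bar>" for k
      by (intro AE_I2) (simp add: abs_mult mult_left_le_one_le)
    have "E k 0 \<in> borel_measurable lebesgue" for k
      by (rule measurable_completion) (simp add: borel_measurable_continuous_onI derivative_chain_continuous[OF E])
    then show "(\<lambda>x. E k 0 x * G x) \<in> borel_measurable lebesgue" for k by measurable
  qed (use G in \<open>auto intro!: borel_measurable_times borel_measurable_indicator\<close>)
  have "(LINT x|lebesgue. indicator {u<..v} x * G x) = integral {u..v} g"
  proof -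
    have "(LINT x|lebesgue. indicator {u<..v} x * G x) = (LINT x|lebesgue. indicator {u..v} x * G x)"
    proof (rule integral_cong_AE)
      have "AE x in lebesgue. x \<noteq> u" by (rule AE_completion[OF AE_lborel_singleton])
      then show "AE x in lebesgue. indicator {u<..v} x * G x = indicator {u..v} x * G x"
        by eventually_elim (auto split: split_indicator)
    qed (intro borel_measurable_times borel_measurable_indicator; simp)+
    also have "\<dots> = (LINT x:{u..v}|lebesgue. g x)"
      by (auto simp: set_lebesgue_integral_def G_def intro!: Bochner_Integration.integral_cong split: split_indicator)
    also have "\<dots> = integral {u..v} g" by (rule set_lebesgue_integral_eq_integral(2)[OF g_int(2)])
    finally show ?thesis .
  qed
  with LIMSEQ_unique[OF lim1[unfolded gG] lim2] show ?thesis by simp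
qed

section \<open>Functions with Lipschitz derivative\<close>

text \<open>Dividing the approximation by the increment gives the derivative. Adding it at
  \<open>x\<close> and at \<open>y\<close> cancels the values of \<open>u\<close> and leaves
  \<open>(d x - d y) * (x - y)\<close>, bounded by twice
  \<open>K / 2 * (x - y)\<^sup>2\<close>.\<close>

lemma quadratic_approx_derivative:
  assumes q: "quadratic_approx K u d"
  shows "(u has_real_derivative d x) (at x)" "\<bar>d x - d y\<bar> \<le> K * \<bar>x - y\<bar>" "continuous_on UNIV d"
proof -
  have K: "0 \<le> K" by (rule quadratic_approx_nonneg[OF q])
  have q': "\<bar>u y - u x - d x * (y - x)\<bar> \<le> K / 2 * (y - x)\<^sup>2" for x y
    using q by (simp add: quadratic_approx_def)
  have "((\<lambda>h. (u (x + h) - u x) / h - d x) \<longlongrightarrow> 0) (at 0)"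
  proof (rule Lim_null_comparison)
    show "\<forall>\<^sub>F h in at 0. norm ((u (x + h) - u x) / h - d x) \<le> K / 2 * \<bar>h\<bar>"
    proof (rule eventually_at_filter[THEN iffD2], intro always_eventually allI impI)
      fix h :: real assume "h \<noteq> 0"
      have "(u (x + h) - u x) / h - d x = (u (x + h) - u x - d x * h) / h"
        using \<open>h \<noteq> 0\<close> by (simp add: field_simps)
      then have "norm ((u (x + h) - u x) / h - d x) = \<bar>u (x + h) - u x - d x * h\<bar> / \<bar>h\<bar>"
        by simp
      also have "\<dots> \<le> K / 2 * h\<^sup>2 / \<bar>h\<bar>"
        using q'[of "x + h" x] by (intro divide_right_mono) auto
      also have "\<dots> = K / 2 * \<bar>h\<bar>"
        using \<open>h \<noteq> 0\<close> by (simp add: power2_eq_square field_simps abs_if)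
      finally show "norm ((u (x + h) - u x) / h - d x) \<le> K / 2 * \<bar>h\<bar>" .
    qed
    have "((\<lambda>h. K / 2 * \<bar>h\<bar>) \<longlongrightarrow> K / 2 * \<bar>0\<bar>) (at 0)" by (intro tendsto_intros)
    then show "((\<lambda>h. K / 2 * \<bar>h\<bar>) \<longlongrightarrow> 0) (at 0)" by simp
  qed
  then show "(u has_real_derivative d x) (at x)" by (simp add: DERIV_def LIM_zero_iff)
  have lip: "\<bar>d x - d y\<bar> \<le> K * \<bar>x - y\<bar>" for x y
  proof (cases "x = y")
    case False
    have "(d x - d y) * (x - y) = (u y - u x - d x * (y - x)) + (u x - u y - d y * (x - y))"
      by (simp add: algebra_simps)
    then have "\<bar>(d x - d y) * (x - y)\<bar> \<le> K / 2 * (y - x)\<^sup>2 + K / 2 * (x - y)\<^sup>2"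
      using q'[of y x] q'[of x y] by linarith
    also have "\<dots> = K * \<bar>x - y\<bar> * \<bar>x - y\<bar>" by (simp add: power2_eq_square algebra_simps abs_if)
    finally show ?thesis using False by (simp add: abs_mult)
  qed simp
  then show "\<bar>d x - d y\<bar> \<le> K * \<bar>x - y\<bar>" .
  have "K-lipschitz_on UNIV d" using lip K by (intro lipschitz_onI) (auto simp: dist_real_def)
  then show "continuous_on UNIV d" by (rule lipschitz_on_continuous_on)
qed

text \<open>The mean value theorem evaluates \<open>d\<close> at an unknown intermediate point and
  so loses a factor 2 against integration of \<open>d\<close>. Any finite constant serves the
  purpose.\<close>

lemma quadratic_approx_of_lipschitz_derivative:
  assumes f: "\<And>x. (f has_real_derivative d x) (at x)" and lip: "\<And>x y. \<bar>d x - d y\<bar> \<le> K * \<bar>x - y\<bar>"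
  shows "quadratic_approx (2 * K) f d"
  unfolding quadratic_approx_def
proof (intro allI)
  fix x y
  have K: "0 \<le> K" using lip[of 0 1] by simp
  have "\<exists>z. \<bar>z - x\<bar> \<le> \<bar>y - x\<bar> \<and> f y - f x = d z * (y - x)"
  proof -
    consider "x < y" | "y < x" | "x = y" by linarith
    then show ?thesis
    proof cases
      case 1
      from MVT2[OF this f] obtain z where "x < z" "z < y" "f y - f x = (y - x) * d z" by blast
      then show ?thesis by (intro exI[of _ z]) (auto simp: mult.commute)
    next
      case 2
      from MVT2[OF this f] obtain z where "y < z" "z < x" "f x - f y = (x - y) * d z" by blast
      then show ?thesis by (intro exI[of _ z]) (auto simp: algebra_simps)
    qed auto
  qed
  then obtain z where z: "\<bar>z - x\<bar> \<le> \<bar>y - x\<bar>" "f y - f x = d z * (y - x)" by blast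
  have "f y - f x - d x * (y - x) = (d z - d x) * (y - x)" by (simp add: z algebra_simps)
  then have "\<bar>f y - f x - d x * (y - x)\<bar> = \<bar>d z - d x\<bar> * \<bar>y - x\<bar>" by (simp add: abs_mult)
  also have "\<dots> \<le> (K * \<bar>y - x\<bar>) * \<bar>y - x\<bar>"
    using lip[of z x] z(1) K by (intro mult_right_mono) (auto intro: order_trans mult_left_mono)
  also have "\<dots> = 2 * K / 2 * (y - x)\<^sup>2" by (simp add: power2_eq_square abs_if algebra_simps)
  finally show "\<bar>f y - f x - d x * (y - x)\<bar> \<le> 2 * K / 2 * (y - x)\<^sup>2" .
qed

lemma continuous_AE_bounded:
  fixes f :: "real \<Rightarrow> real"
  assumes f: "continuous_on UNIV f" and AE: "AE x in lebesgue. \<bar>f x\<bar> \<le> C"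
  shows "\<bar>f x\<bar> \<le> C"
proof (rule ccontr)
  assume "\<not> \<bar>f x\<bar> \<le> C"
  have "open {y. C < \<bar>f y\<bar>}"
    using open_Collect_less[OF continuous_on_const continuous_on_rabs[OF f]] by simp
  moreover have "x \<in> {y. C < \<bar>f y\<bar>}" using \<open>\<not> \<bar>f x\<bar> \<le> C\<close> by simp
  ultimately obtain e where e: "0 < e" "ball x e \<subseteq> {y. C < \<bar>f y\<bar>}" using open_contains_ball by blast
  have "AE y in lebesgue. y \<notin> {x<..<x + e}"
    using AE
  proof eventually_elim
    case (elim y)
    then have "y \<notin> ball x e" using e(2) by auto
    then show ?case by (auto simp: dist_real_def)
  qed
  then have "{x<..<x + e} \<in> null_sets lebesgue"
    by (subst AE_iff_null_sets) auto
  then have "emeasure lebesgue {x<..<x + e} = 0" by auto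
  then show False using e(1) by simp
qed

text \<open>Almost everywhere information becomes pointwise: \<open>f\<close> is continuous, and the
  increments of its derivative are integrals of an essentially bounded function.\<close>

lemma W2_infinity_regularity:
  assumes "f \<in> W2_infinity"
  obtains B L K d where "bounded_lipschitz B L f" "quadratic_approx K f d"
proof -
  obtain d where d: "\<And>x. (f has_real_derivative d x) (at x)" "continuous_on UNIV d"
    using assms by (auto simp: W2_infinity_def C1_differentiable_on_def has_real_derivative_iff_has_vector_derivative)
  obtain g C where g: "has_weak_deriv 2 f g" and C: "AE x in lebesgue. \<bar>g x\<bar> \<le> C"
    using assms by (auto simp: W2_infinity_def L_infinity_def)
  have f_cont: "continuous_on UNIV f" using d(1) by (meson DERIV_isCont continuous_at_imp_continuous_on)
  obtain B where B: "AE x in lebesgue. \<bar>f x\<bar> \<le> B"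
    using assms by (auto simp: W2_infinity_def L_infinity_def)
  note B = continuous_AE_bounded[OF f_cont B]
  have inc: "\<bar>d v - d u\<bar> \<le> \<bar>C\<bar> * \<bar>v - u\<bar>" if "u \<le> v" for u v
  proof -
    have int: "set_integrable lebesgue {u..v} g"
      using g by (auto simp: has_weak_deriv_def locally_integrable_def)
    have "\<bar>d v - d u\<bar> = \<bar>LINT x:{u..v}|lebesgue. g x\<bar>"
      using weak_second_derivative_increment[OF d g that] set_lebesgue_integral_eq_integral(2)[OF int] by simp
    also have "\<dots> \<le> (LINT x|lebesgue. \<bar>indicator {u..v} x *\<^sub>R g x\<bar>)"
      unfolding set_lebesgue_integral_def by (rule integral_abs_bound)
    also have "\<dots> \<le> (LINT x|lebesgue. \<bar>C\<bar> * indicator {u..v} x)"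
    proof (rule integral_mono_AE)
      show "integrable lebesgue (\<lambda>x. \<bar>indicator {u..v} x *\<^sub>R g x\<bar>)"
        using int by (auto simp: set_integrable_def)
      show "integrable lebesgue (\<lambda>x. \<bar>C\<bar> * indicator {u..v} x)"
        using that by (intro integrable_mult_right integrable_real_indicator) auto
      show "AE x in lebesgue. \<bar>indicator {u..v} x *\<^sub>R g x\<bar> \<le> \<bar>C\<bar> * indicator {u..v} x"
        using C by eventually_elim (auto split: split_indicator)
    qed
    also have "\<dots> = \<bar>C\<bar> * \<bar>v - u\<bar>" using that by simp
    finally show ?thesis .
  qed
  have lip: "\<bar>d x - d y\<bar> \<le> \<bar>C\<bar> * \<bar>x - y\<bar>" for x y
    using inc[of x y] inc[of y x] by (cases "x \<le> y") (auto simp: abs_minus_commute)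
  have q: "quadratic_approx (2 * \<bar>C\<bar>) f d"
    by (rule quadratic_approx_of_lipschitz_derivative[OF d(1) lip])
  \<comment> \<open>A bounded function with bounded second derivative has bounded slope: the
    expansion over a unit increment gives
    \<open>\<bar>d x\<bar> \<le> 2 * B + \<bar>C\<bar>\<close>.\<close>
  define L where "L = 2 * B + \<bar>C\<bar>"
  have dL: "\<bar>d x\<bar> \<le> L" for x
    using q[unfolded quadratic_approx_def, rule_format, of "x + 1" x] B[of x] B[of "x + 1"]
    by (simp add: L_def)
  have "\<bar>f x - f y\<bar> \<le> L * \<bar>x - y\<bar>" for x y
    using field_differentiable_bound[of UNIV f d L y x] d(1) dL
    by (auto simp: has_field_derivative_at_within abs_minus_commute)
  then have "bounded_lipschitz B L f" using B by (simp add: bounded_lipschitz_def)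
  then show ?thesis using q that by blast
qed

text \<open>The nondecreasing functions \<open>(k x + d x) / (2 k)\<close> and \<open>(k x - d x) / (2 k)\<close> add up to the identity,
  so their Stieltjes measures add up to Lebesgue measure and have densities with values in \<open>[0, 1]\<close>.\<close>

lemma lipschitz_derivative_density:
  fixes d :: "real \<Rightarrow> real"
  assumes lip: "\<And>x y. \<bar>d x - d y\<bar> \<le> K * \<bar>x - y\<bar>"
  obtains g where "g \<in> borel_measurable borel" "\<And>x. \<bar>g x\<bar> \<le> K + 1"
    "\<And>u v. u \<le> v \<Longrightarrow> d v - d u = (LINT x:{u..v}|lborel. g x)"
proof -
  have K: "0 \<le> K" using lip[of 0 1] by simp
  define k where "k = K + 1"
  have k: "0 < k" using K by (simp add: k_def)
  have lipk: "\<bar>d x - d y\<bar> \<le> k * \<bar>x - y\<bar>" for x y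
    using lip[of x y] mult_right_mono[of K k "\<bar>x - y\<bar>"] by (simp add: k_def)
  define F where "F s x = (k * x + s * d x) / (2 * k)" for s x :: real
  have mono: "F s x \<le> F s y" if "x \<le> y" "s \<in> {-1, 1}" for s x y
  proof -
    have "k * x + s * d x \<le> k * y + s * d y"
      using lipk[of x y] that by (auto simp: abs_le_iff algebra_simps)
    then show ?thesis using k by (simp add: F_def divide_right_mono)
  qed
  have "k-lipschitz_on UNIV d" using lipk k by (intro lipschitz_onI) (auto simp: dist_real_def)
  then have d_cont: "continuous_on UNIV d" by (rule lipschitz_on_continuous_on)
  have cont: "continuous_on UNIV (F s)" for s
    unfolding F_def using k by (intro continuous_intros d_cont) auto
  have sum: "F 1 x + F (-1) x = x" for x using k by (simp add: F_def field_simps)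
  define \<mu> where "\<mu> s = interval_measure (F s)" for s
  have [simp]: "sets (\<mu> s) = sets borel" "space (\<mu> s) = UNIV" for s
    by (simp_all add: \<mu>_def)
  have Icc: "emeasure (\<mu> s) {u..v} = ennreal (F s v - F s u)" if "u \<le> v" "s \<in> {-1, 1}" for s u v
    unfolding \<mu>_def using that by (intro emeasure_interval_measure_Icc mono cont)
  \<comment> \<open>The sum of the two Stieltjes measures agrees with Lebesgue measure on intervals
    because \<open>F 1 x + F (-1) x = x\<close>. Each summand is thus dominated by
    \<open>lborel\<close>, which gives the absolute continuity behind the density.\<close>
  define \<nu> where "\<nu> = measure_of UNIV (sets borel) (\<lambda>A. emeasure (\<mu> 1) A + emeasure (\<mu> (-1)) A)"
  have [simp]: "sets \<nu> = sets borel" unfolding \<nu>_def using sets.sigma_sets_eq[of borel] by simp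
  have \<nu>: "emeasure \<nu> A = emeasure (\<mu> 1) A + emeasure (\<mu> (-1)) A" if "A \<in> sets borel" for A
    unfolding \<nu>_def
  proof (rule emeasure_measure_of_sigma)
    show "sigma_algebra UNIV (sets (borel :: real measure))" using sets.sigma_algebra_axioms[of borel] by simp
    show "positive (sets borel) (\<lambda>A. emeasure (\<mu> 1) A + emeasure (\<mu> (-1)) A)" by (simp add: positive_def)
    show "countably_additive (sets borel) (\<lambda>A. emeasure (\<mu> 1) A + emeasure (\<mu> (-1)) A)"
    proof (rule countably_additiveI)
      fix A :: "nat \<Rightarrow> real set" assume A: "range A \<subseteq> sets borel" "disjoint_family A"
      have "(\<Sum>i. emeasure (\<mu> s) (A i)) = emeasure (\<mu> s) (\<Union>i. A i)" for s
        by (rule suminf_emeasure) (use A in auto)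
      then show "(\<Sum>i. emeasure (\<mu> 1) (A i) + emeasure (\<mu> (-1)) (A i)) =
          emeasure (\<mu> 1) (\<Union>i. A i) + emeasure (\<mu> (-1)) (\<Union>i. A i)"
        by (subst suminf_add[symmetric]) auto
    qed
  qed (rule that)
  have Icc_\<nu>: "emeasure \<nu> {u..v} = ennreal (v - u)" if "u \<le> v" for u v
    using mono[OF that, of 1] mono[OF that, of "-1"] sum[of u] sum[of v]
    by (simp add: \<nu> Icc that ennreal_plus[symmetric] del: ennreal_plus)
  have \<nu>_eq: "lborel = \<nu>"
  proof (rule lborel_eqI)
    fix l u :: real assume le: "\<And>b. b \<in> Basis \<Longrightarrow> l \<bullet> b \<le> u \<bullet> b"
    then have lu: "l \<le> u" by simp
    have "{x} \<in> null_sets \<nu>" for x using Icc_\<nu>[of x x] by (intro null_setsI) auto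
    then have "{l} \<union> {u} \<in> null_sets \<nu>" by (intro null_sets.Un)
    then have "emeasure \<nu> (box l u \<union> ({l} \<union> {u})) = emeasure \<nu> (box l u)"
      by (intro emeasure_Un_null_set) auto
    moreover have "box l u \<union> ({l} \<union> {u}) = {l..u}" using lu by auto
    ultimately show "emeasure \<nu> (box l u) = (\<Prod>b\<in>Basis. (u - l) \<bullet> b)"
      using Icc_\<nu>[OF lu] by simp
  qed simp
  have split: "emeasure lborel A = emeasure (\<mu> 1) A + emeasure (\<mu> (-1)) A" if "A \<in> sets borel" for A
    unfolding \<nu>_eq by (rule \<nu>[OF that])
  have "\<exists>h\<in>borel_measurable lborel. density lborel h = \<mu> s" if "s \<in> {-1, 1}" for s
  proof (rule sigma_finite_measure.Radon_Nikodym[OF lborel.sigma_finite_measure_axioms])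
    show "absolutely_continuous lborel (\<mu> s)"
      unfolding absolutely_continuous_def
      using split that by (auto simp: null_sets_def)
  qed simp
  then obtain p n where p: "p \<in> borel_measurable lborel" "density lborel p = \<mu> 1"
    and n: "n \<in> borel_measurable lborel" "density lborel n = \<mu> (-1)" by blast
  have [measurable]: "p \<in> borel_measurable borel" "n \<in> borel_measurable borel" using p n by auto
  have "density lborel (\<lambda>x. p x + n x) = density lborel (\<lambda>_. 1)"
  proof (rule measure_eqI)
    fix A :: "real set" assume "A \<in> sets (density lborel (\<lambda>x. p x + n x))"
    then have A[measurable]: "A \<in> sets borel" by simp
    have "emeasure (density lborel (\<lambda>x. p x + n x)) A = emeasure (density lborel p) A + emeasure (density lborel n) A"
      by (simp add: emeasure_density distrib_right nn_integral_add)
    also have "\<dots> = emeasure lborel A" using split[OF A] by (simp add: p n)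
    finally show "emeasure (density lborel (\<lambda>x. p x + n x)) A = emeasure (density lborel (\<lambda>_. 1)) A"
      by (simp add: emeasure_density)
  qed simp
  then have "AE x in lborel. p x + n x = 1"
    by (subst (asm) sigma_finite_measure.density_unique_iff[OF lborel.sigma_finite_measure_axioms]) auto
  then have p1: "AE x in lborel. p x \<le> 1"
    by eventually_elim (metis add_increasing2 order_refl zero_le)
  \<comment> \<open>Truncation changes the density on a null set only and makes the bound hold
    everywhere.\<close>
  define q where "q x = enn2real (min (p x) 1)" for x
  have q: "0 \<le> q x" "q x \<le> 1" for x
    by (auto simp: q_def intro!: enn2real_leI)
  have [measurable]: "q \<in> borel_measurable borel" unfolding q_def by measurable
  \<comment> \<open>From \<open>d x = k * (2 * F 1 x - x)\<close>, with \<open>q\<close> in the role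
    of the derivative of \<open>F 1\<close>.\<close>
  define g where "g x = k * (2 * q x - 1)" for x
  show ?thesis
  proof (rule that[of g])
    show "g \<in> borel_measurable borel" unfolding g_def by measurable
    show "\<bar>g x\<bar> \<le> K + 1" for x
    proof -
      have "\<bar>2 * q x - 1\<bar> \<le> 1" using q[of x] by simp
      then have "k * \<bar>2 * q x - 1\<bar> \<le> k * 1" using k by (intro mult_left_mono) auto
      then show ?thesis using k by (simp add: g_def abs_mult k_def)
    qed
    fix u v :: real assume uv: "u \<le> v"
    have "ennreal (F 1 v - F 1 u) = (\<integral>\<^sup>+x. p x * indicator {u..v} x \<partial>lborel)"
      using Icc[OF uv, of 1] by (simp add: p(2)[symmetric] emeasure_density)
    also have "\<dots> = (\<integral>\<^sup>+x. ennreal (q x * indicator {u..v} x) \<partial>lborel)"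
    proof (rule nn_integral_cong_AE)
      show "AE x in lborel. p x * indicator {u..v} x = ennreal (q x * indicator {u..v} x)"
        using p1
      proof eventually_elim
        case (elim x)
        then have "ennreal (q x) = p x"
          unfolding q_def by (subst ennreal_enn2real) (auto simp: min_absorb1 top.not_eq_extremum intro: le_less_trans)
        then show ?case by (simp split: split_indicator)
      qed
    qed
    finally have nn: "(\<integral>\<^sup>+x. ennreal (q x * indicator {u..v} x) \<partial>lborel) = ennreal (F 1 v - F 1 u)" by simp
    have hb: "has_bochner_integral lborel (\<lambda>x. q x * indicator {u..v} x) (F 1 v - F 1 u)"
      by (rule has_bochner_integral_nn_integral) (use nn q mono[OF uv, of 1] in auto)
    have one: "has_bochner_integral lborel (indicator {u..v} :: real \<Rightarrow> real) (v - u)"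
      using uv by (auto simp: has_bochner_integral_iff)
    have "has_bochner_integral lborel (\<lambda>x. 2 * k * (q x * indicator {u..v} x) - k * indicator {u..v} x)
        (2 * k * (F 1 v - F 1 u) - k * (v - u))"
      by (intro has_bochner_integral_diff has_bochner_integral_mult_right hb one)
    moreover have "2 * k * (F 1 v - F 1 u) - k * (v - u) = d v - d u"
      using k by (simp add: F_def field_simps)
    moreover have "(\<lambda>x. 2 * k * (q x * indicator {u..v} x) - k * indicator {u..v} x) =
        (\<lambda>x. indicator {u..v} x *\<^sub>R g x)"
      by (auto simp: g_def fun_eq_iff algebra_simps)
    ultimately show "d v - d u = (LINT x:{u..v}|lborel. g x)"
      unfolding set_lebesgue_integral_def by (simp add: has_bochner_integral_iff)
  qed
qed

section \<open>From quadratic approximation back to the Sobolev space\<close>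

lemma continuous_locally_integrable:
  assumes "continuous_on UNIV f"
  shows "locally_integrable f"
  unfolding locally_integrable_def set_integrable_def
proof (intro allI impI)
  fix S :: "real set" assume "compact S"
  then have "integrable lborel (\<lambda>x. indicator S x *\<^sub>R f x)"
    by (rule borel_integrable_compact) (rule continuous_on_subset[OF assms subset_UNIV])
  then show "integrable lebesgue (\<lambda>x. indicator S x *\<^sub>R f x)"
    by (subst integrable_completion) auto
qed

lemma bounded_borel_L_infinity:
  assumes "g \<in> borel_measurable borel" "\<And>x. \<bar>g x\<bar> \<le> C"
  shows "g \<in> L_infinity" "locally_integrable g"
proof -
  have "g \<in> borel_measurable lborel" using assms(1) by simp
  then have m: "g \<in> borel_measurable lebesgue" by (rule measurable_completion)
  then show "g \<in> L_infinity" using assms(2) by (auto simp: L_infinity_def)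
  show "locally_integrable g"
    unfolding locally_integrable_def
  proof (intro allI impI)
    fix S :: "real set" assume "compact S"
    then have S: "S \<in> lmeasurable" by (rule lmeasurable_compact)
    then have "set_integrable lebesgue S (\<lambda>_. C)"
      unfolding set_integrable_def by (auto simp: fmeasurable_def)
    then show "set_integrable lebesgue S g"
    proof (rule set_integrable_bound)
      show "set_borel_measurable lebesgue S g"
        using m S by (auto simp: set_borel_measurable_def fmeasurableD)
      show "AE x in lebesgue. x \<in> S \<longrightarrow> norm (g x) \<le> norm C"
      proof (intro AE_I2 impI)
        show "norm (g x) \<le> norm C" for x using assms(2)[of x] by simp
      qed
    qed
  qed
qed

text \<open>Integration by parts for a function that is only absolutely continuous, by Fubini on the
  triangle \<open>w \<le> z\<close>.\<close>

lemma integral_by_parts_density: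
  fixes g d \<phi> \<phi>' :: "real \<Rightarrow> real"
  assumes g: "g \<in> borel_measurable borel" "\<And>x. \<bar>g x\<bar> \<le> C"
    and d: "\<And>u v. u \<le> v \<Longrightarrow> d v - d u = (LINT x:{u..v}|lborel. g x)" "continuous_on UNIV d"
    and \<phi>: "\<And>x. (\<phi> has_real_derivative \<phi>' x) (at x)" "continuous_on UNIV \<phi>'"
    and zero: "\<And>x. x \<notin> {A..B} \<Longrightarrow> \<phi> x = 0 \<and> \<phi>' x = 0" and AB: "A \<le> B"
  shows "(LINT x|lborel. d x * \<phi>' x) = - (LINT x|lborel. g x * \<phi> x)"
proof -
  define S where "S = {A - 1..B + 1}"
  have [measurable]: "g \<in> borel_measurable borel" "\<phi>' \<in> borel_measurable borel" "d \<in> borel_measurable borel"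
    using g \<phi>(2) d(2) by (auto intro: borel_measurable_continuous_onI)
  have FTC: "(LINT z|lborel. \<phi>' z * indicator {u..B + 1} z) = - \<phi> u" if "u \<le> B + 1" for u
  proof -
    have "(LINT z|lborel. \<phi>' z * indicator {u..B + 1} z) = \<phi> (B + 1) - \<phi> u"
      by (rule integral_FTC_Icc_real[OF that \<phi>(1)]) (use \<phi>(2) in \<open>auto simp: continuous_on_eq_continuous_at\<close>)
    then show ?thesis using zero[of "B + 1"] by simp
  qed
  have "compact S" by (simp add: S_def)
  then have "bounded (\<phi>' ` S)"
    by (intro compact_imp_bounded compact_continuous_image continuous_on_subset[OF \<phi>(2)]) auto
  then obtain C' where C': "\<And>z. z \<in> S \<Longrightarrow> \<bar>\<phi>' z\<bar> \<le> C'"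
    unfolding bounded_iff by (metis imageI real_norm_def)
  have \<phi>'S: "\<phi>' z * indicator S z = \<phi>' z" for z
    using zero[of z] by (auto simp: S_def split: split_indicator)
  \<comment> \<open>Integrating over \<open>z\<close> first produces
    \<open>- (g w * \<phi> w)\<close>, over \<open>w\<close> first
    \<open>(d z - d (A - 1)) * \<phi>' z\<close>. Fubini applies since \<open>H\<close> is bounded
    with bounded support.\<close>
  define H where "H z w = indicator S z * indicator S w * (if w \<le> z then g w * \<phi>' z else 0)" for z w
  have S[measurable]: "S \<in> sets borel" by (simp add: S_def)
  have C0: "0 \<le> C" using g(2)[of 0] by simp
  have "integrable (lborel \<Otimes>\<^sub>M lborel) (\<lambda>p. (C * C') * indicator (S \<times> S) p)"
  proof (intro integrable_mult_right integrable_real_indicator)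
    show "emeasure (lborel \<Otimes>\<^sub>M lborel) (S \<times> S) < \<infinity>"
      using AB by (subst lborel.emeasure_pair_measure_Times) (auto simp: S_def ennreal_mult_less_top)
  qed simp
  then have "integrable (lborel \<Otimes>\<^sub>M lborel) (\<lambda>(z, w). H z w)"
  proof (rule Bochner_Integration.integrable_bound)
    show "(\<lambda>(z, w). H z w) \<in> borel_measurable (lborel \<Otimes>\<^sub>M lborel)" unfolding H_def by measurable
    show "AE p in lborel \<Otimes>\<^sub>M lborel. norm (case p of (z, w) \<Rightarrow> H z w) \<le> norm ((C * C') * indicator (S \<times> S) p)"
    proof (intro AE_I2, clarify)
      fix z w
      show "norm (H z w) \<le> norm ((C * C') * indicator (S \<times> S) (z, w))"
      proof (cases "z \<in> S \<and> w \<in> S")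
        case True
        then have "0 \<le> C'" using C'[of z] by auto
        have "\<bar>g w * \<phi>' z\<bar> \<le> C * C'"
          unfolding abs_mult using g(2) C' True C0 by (intro mult_mono) auto
        then show ?thesis using True C0 \<open>0 \<le> C'\<close> by (auto simp: H_def abs_mult)
      qed (auto simp: H_def)
    qed
  qed
  from lborel_pair.Fubini_integral[OF this]
  have fubini: "(LINT w|lborel. LINT z|lborel. H z w) = (LINT z|lborel. LINT w|lborel. H z w)" .
  have inner1: "(LINT z|lborel. H z w) = - (g w * \<phi> w)" for w
  proof (cases "w \<in> S")
    case True
    have "(LINT z|lborel. H z w) = (LINT z|lborel. g w * (\<phi>' z * indicator {w..B + 1} z))"
      using True by (intro Bochner_Integration.integral_cong) (auto simp: H_def S_def split: split_indicator)
    also have "\<dots> = g w * - \<phi> w" using FTC[of w] True by (simp add: S_def)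
    finally show ?thesis by simp
  next
    case False
    then show ?thesis using zero[of w] by (auto simp: H_def S_def)
  qed
  have inner2: "(LINT w|lborel. H z w) = (d z - d (A - 1)) * \<phi>' z" for z
  proof (cases "z \<in> S")
    case True
    have "(LINT w|lborel. H z w) = (LINT w|lborel. (indicator {A - 1..z} w *\<^sub>R g w) * \<phi>' z)"
      using True by (intro Bochner_Integration.integral_cong) (auto simp: H_def S_def split: split_indicator)
    also have "\<dots> = (d z - d (A - 1)) * \<phi>' z"
      using d(1)[of "A - 1" z] True by (simp add: set_lebesgue_integral_def S_def)
    finally show ?thesis .
  next
    case False
    then show ?thesis using zero[of z] by (auto simp: H_def S_def)
  qed
  have int: "integrable lborel (\<lambda>z. h z * \<phi>' z)" if "continuous_on UNIV h" for h
  proof -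
    have "integrable lborel (\<lambda>z. indicator S z *\<^sub>R (h z * \<phi>' z))"
      by (intro borel_integrable_compact \<open>compact S\<close> continuous_on_mult continuous_on_subset[OF that]
          continuous_on_subset[OF \<phi>(2)]) auto
    also have "(\<lambda>z. indicator S z *\<^sub>R (h z * \<phi>' z)) = (\<lambda>z. h z * \<phi>' z)"
      using \<phi>'S by (auto simp: fun_eq_iff split: split_indicator)
    finally show ?thesis .
  qed
  \<comment> \<open>This removes the constant \<open>d (A - 1)\<close>.\<close>
  have "(LINT z|lborel. \<phi>' z) = 0"
    using FTC[of "A - 1"] zero[of "A - 1"] AB \<phi>'S unfolding S_def by simp
  then have "(LINT z|lborel. d z * \<phi>' z) = (LINT z|lborel. d z * \<phi>' z) - (LINT z|lborel. d (A - 1) * \<phi>' z)"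
    by simp
  also have "\<dots> = (LINT z|lborel. (d z - d (A - 1)) * \<phi>' z)"
    using int[OF d(2)] int[OF continuous_on_const] by (simp add: left_diff_distrib)
  also have "\<dots> = - (LINT w|lborel. g w * \<phi> w)"
    using fubini unfolding inner1 inner2 by simp
  finally show ?thesis .
qed

text \<open>The first integration by parts is classical, since \<open>d\<close> is continuous. The
  second uses a bounded density of the Lipschitz function \<open>d\<close>, which becomes the weak
  second derivative.\<close>

lemma W2_infinityI:
  assumes bl: "bounded_lipschitz B L u" and q: "quadratic_approx K u d"
  shows "u \<in> W2_infinity"
proof -
  note d = quadratic_approx_derivative[OF q]
  have u_cont: "continuous_on UNIV u" by (rule bounded_lipschitz_continuous[OF bl])
  have u_inf: "u \<in> L_infinity"
    using bounded_borel_L_infinity(1)[OF bounded_lipschitz_measurable[OF bl] bounded_lipschitzD(1)[OF bl]] .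
  have "\<bar>d x\<bar> \<le> 2 * B + K / 2" for x
  proof -
    have "\<bar>u (x + 1) - u x - d x * (x + 1 - x)\<bar> \<le> K / 2 * (x + 1 - x)\<^sup>2"
      using q unfolding quadratic_approx_def by blast
    then have "\<bar>u (x + 1) - u x - d x\<bar> \<le> K / 2" by simp
    then show ?thesis
      using bounded_lipschitzD(1)[OF bl, of x] bounded_lipschitzD(1)[OF bl, of "x + 1"] by linarith
  qed
  then have d_inf: "d \<in> L_infinity"
    by (rule bounded_borel_L_infinity(1)[OF borel_measurable_continuous_onI[OF d(3)]])
  obtain g where g: "g \<in> borel_measurable borel" "\<And>x. \<bar>g x\<bar> \<le> K + 1"
    and gd: "\<And>u v. u \<le> v \<Longrightarrow> d v - d u = (LINT x:{u..v}|lborel. g x)"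
    using lipschitz_derivative_density[OF d(2)] by blast
  have C1: "u C1_differentiable_on UNIV"
    unfolding C1_differentiable_on_def
    using d(1,3) by (auto simp: has_real_derivative_iff_has_vector_derivative)
  have weak: "(LINT x|lebesgue. u x * (deriv ^^ 1) \<phi> x) = - (LINT x|lebesgue. d x * \<phi> x) \<and>
      (LINT x|lebesgue. u x * (deriv ^^ 2) \<phi> x) = (LINT x|lebesgue. g x * \<phi> x)"
    if \<phi>: "\<phi> \<in> test_functions" for \<phi>
  proof -
    obtain D A B' where D: "derivative_chain D" "D 0 = \<phi>" "A \<le> B'" "\<And>n. (deriv ^^ n) \<phi> = D n"
      "\<And>n x. x \<notin> {A..B'} \<Longrightarrow> D n x = 0"
      using test_functionE[OF \<phi>] by blast
    note D' = derivative_chainD[OF D(1)] and cont = derivative_chain_continuous[OF D(1)]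
    have one: "(LINT x|lebesgue. u x * D 1 x) = - (LINT x|lebesgue. d x * D 0 x)"
      using D'[of 0] D(5) by (intro integral_by_parts_compact_support[OF d(1,3) _ cont _ D(3)]) auto
    have "(LINT x|lebesgue. u x * D 2 x) = - (LINT x|lebesgue. d x * D 1 x)"
      using D'[of 1] D(5) by (intro integral_by_parts_compact_support[OF d(1,3) _ cont _ D(3)]) (auto simp: numeral_2_eq_2)
    also have "\<dots> = - (LINT x|lborel. d x * D 1 x)"
      using borel_measurable_continuous_onI[OF continuous_on_mult[OF d(3) cont[of UNIV 1]]]
      by (simp add: integral_completion)
    also have "\<dots> = (LINT x|lborel. g x * D 0 x)"
      using integral_by_parts_density[OF g gd d(3) _ cont _ D(3), of "D 0" 1] D'[of 0] D(5) by simp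
    also have "\<dots> = (LINT x|lebesgue. g x * D 0 x)"
      using g(1) borel_measurable_continuous_onI[OF cont[of UNIV 0]] by (simp add: integral_completion)
    finally show ?thesis using one unfolding D(4) unfolding D(2)[symmetric] by simp
  qed
  have "has_weak_deriv 1 u d" "has_weak_deriv 2 u g"
    using weak continuous_locally_integrable[OF u_cont] continuous_locally_integrable[OF d(3)]
      bounded_borel_L_infinity(2)[OF g]
    by (auto simp: has_weak_deriv_def)
  then show ?thesis
    using u_inf C1 d_inf bounded_borel_L_infinity(1)[OF g] by (auto simp: W2_infinity_def)
qed

section \<open>Second order expansion and the generator\<close>

lemma weak_second_derivative_AE:
  assumes f: "\<And>x. (f has_real_derivative d x) (at x)" "continuous_on UNIV d"
    and g: "has_weak_deriv 2 f g"
  shows "AE x in lebesgue. \<forall>e>0. \<exists>r>0. \<forall>y. \<bar>y - x\<bar> < r \<longrightarrow> \<bar>d y - d x - g x * (y - x)\<bar> \<le> e * \<bar>y - x\<bar>"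
proof -
  have "g integrable_on {u..v}" for u v
    using g set_lebesgue_integral_eq_integral(1)[of "{u..v}" g]
    by (auto simp: has_weak_deriv_def locally_integrable_def)
  from lebesgue_differentiation[OF this] show ?thesis
  proof eventually_elim
    case (elim x)
    show ?case
    proof (intro allI impI)
      fix e :: real assume "0 < e"
      with elim obtain r where r: "0 < r" "\<forall>u v. x - r < u \<and> u \<le> x \<and> x \<le> v \<and> v < x + r \<longrightarrow>
          \<bar>integral {u..v} g - g x * (v - u)\<bar> \<le> e * (v - u)" by meson
      have "\<bar>d y - d x - g x * (y - x)\<bar> \<le> e * \<bar>y - x\<bar>" if "\<bar>y - x\<bar> < r" for y
      proof (cases "x \<le> y")
        case True
        then show ?thesis
          using r(2)[rule_format, of x y] r(1) that weak_second_derivative_increment[OF f g True] by simp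
      next
        case False
        then have yx: "y \<le> x" by simp
        have "\<bar>d x - d y - g x * (x - y)\<bar> \<le> e * (x - y)"
          using r(2)[rule_format, of y x] r(1) that yx weak_second_derivative_increment[OF f g yx] by simp
        moreover have "d y - d x - g x * (y - x) = - (d x - d y - g x * (x - y))" by (simp add: algebra_simps)
        moreover have "\<bar>y - x\<bar> = x - y" using yx by simp
        ultimately show ?thesis by (simp only: abs_minus_cancel)
      qed
      then show "\<exists>r>0. \<forall>y. \<bar>y - x\<bar> < r \<longrightarrow> \<bar>d y - d x - g x * (y - x)\<bar> \<le> e * \<bar>y - x\<bar>"
        using r(1) by blast
    qed
  qed
qed

text \<open>Within distance \<open>r\<close> of \<open>x\<close> the slope of the remainder is
  small, and the mean value inequality gives the first term. Farther away only quadratic growth is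
  known; it becomes quartic through the factor \<open>(y - x)\<^sup>2 / r\<^sup>2\<close>, which is
  at least 1 there.\<close>

lemma second_order_expansion:
  assumes q: "quadratic_approx K f d" and "0 < e"
    and diff: "\<forall>e>0. \<exists>r>0. \<forall>y. \<bar>y - x\<bar> < r \<longrightarrow> \<bar>d y - d x - p * (y - x)\<bar> \<le> e * \<bar>y - x\<bar>"
  obtains D where "0 \<le> D"
    "\<And>y. \<bar>f y - f x - d x * (y - x) - p / 2 * (y - x)\<^sup>2\<bar> \<le> e * (y - x)\<^sup>2 + D * (y - x) ^ 4"
proof -
  note d = quadratic_approx_derivative[OF q]
  have K: "0 \<le> K" by (rule quadratic_approx_nonneg[OF q])
  obtain r where r: "0 < r" "\<And>y. \<bar>y - x\<bar> < r \<Longrightarrow> \<bar>d y - d x - p * (y - x)\<bar> \<le> e * \<bar>y - x\<bar>"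
    using diff \<open>0 < e\<close> by meson
  define R where "R y = f y - f x - d x * (y - x) - p / 2 * (y - x)\<^sup>2" for y
  have R: "(R has_real_derivative d y - d x - p * (y - x)) (at y)" for y
    unfolding R_def by (auto intro!: derivative_eq_intros d(1) simp: power2_eq_square)
  define D where "D = (K + \<bar>p\<bar>) / r\<^sup>2"
  have "0 \<le> D" using K r by (simp add: D_def)
  have "\<bar>R y\<bar> \<le> e * (y - x)\<^sup>2 + D * (y - x) ^ 4" for y
  proof (cases "\<bar>y - x\<bar> < r")
    case True
    have "norm (R y - R x) \<le> (e * \<bar>y - x\<bar>) * norm (y - x)"
    proof (rule field_differentiable_bound[of "closed_segment x y" R "\<lambda>y. d y - d x - p * (y - x)"])
      fix z assume "z \<in> closed_segment x y"
      then have zx: "\<bar>z - x\<bar> \<le> \<bar>y - x\<bar>" by (auto simp: closed_segment_eq_real_ivl split: if_splits)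
      then have "\<bar>d z - d x - p * (z - x)\<bar> \<le> e * \<bar>z - x\<bar>" using r(2)[of z] True by simp
      also have "\<dots> \<le> e * \<bar>y - x\<bar>" using zx \<open>0 < e\<close> by simp
      finally show "norm (d z - d x - p * (z - x)) \<le> e * \<bar>y - x\<bar>" by simp
    qed (use R in \<open>auto intro: has_field_derivative_at_within\<close>)
    then have "\<bar>R y\<bar> \<le> e * (y - x)\<^sup>2" by (simp add: R_def power2_eq_square abs_mult_self_eq mult.assoc)
    moreover have "0 \<le> D * (y - x) ^ 4" using \<open>0 \<le> D\<close> by simp
    ultimately show ?thesis by linarith
  next
    case False
    have "\<bar>R y\<bar> \<le> \<bar>f y - f x - d x * (y - x)\<bar> + \<bar>p / 2 * (y - x)\<^sup>2\<bar>" unfolding R_def by linarith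
    also have "\<dots> \<le> K / 2 * (y - x)\<^sup>2 + \<bar>p\<bar> / 2 * (y - x)\<^sup>2"
      using q[unfolded quadratic_approx_def, rule_format, of y x] by (simp add: abs_mult)
    also have "\<dots> = (K + \<bar>p\<bar>) / 2 * (y - x)\<^sup>2" by (simp add: algebra_simps)
    also have "\<dots> \<le> (K + \<bar>p\<bar>) * (y - x)\<^sup>2" using K by (intro mult_right_mono) auto
    also have "\<dots> = D * (r\<^sup>2 * (y - x)\<^sup>2)" using r by (simp add: D_def)
    also have "\<dots> \<le> D * ((y - x)\<^sup>2 * (y - x)\<^sup>2)"
    proof -
      have "r\<^sup>2 \<le> \<bar>y - x\<bar>\<^sup>2" using False r by (intro power_mono) auto
      then show ?thesis using \<open>0 \<le> D\<close> by (intro mult_left_mono mult_right_mono) auto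
    qed
    also have "\<dots> = D * (y - x) ^ 4" by (simp add: power2_eq_square power4_eq_xxxx)
    also have "\<dots> \<le> e * (y - x)\<^sup>2 + D * (y - x) ^ 4" using \<open>0 < e\<close> by simp
    finally show ?thesis .
  qed
  then show ?thesis using that \<open>0 \<le> D\<close> unfolding R_def by blast
qed

text \<open>From above, the barrier of curvature parameter \<open>p / 2 + e\<close> covers all
  volatilities at once; from below, one constant volatility suffices, namely an endpoint that
  attains the maximum. The errors are \<open>e * b\<^sup>2\<close> and a multiple of
  \<open>h\<close>, each kept within half of the tolerance.\<close>

lemma (in volatility_band) nisio_generator:
  assumes bl: "bounded_lipschitz B L f" and q: "quadratic_approx K f d"
    and diff: "\<forall>e>0. \<exists>r>0. \<forall>y. \<bar>y - x\<bar> < r \<longrightarrow> \<bar>d y - d x - p * (y - x)\<bar> \<le> e * \<bar>y - x\<bar>"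
  shows "((\<lambda>h. (nisio h f x - f x) / h) \<longlongrightarrow> 1 / 2 * max (a\<^sup>2 * p) (b\<^sup>2 * p)) (at_right 0)"
proof (rule tendstoI)
  fix \<epsilon> :: real assume "0 < \<epsilon>"
  let ?G = "1 / 2 * max (a\<^sup>2 * p) (b\<^sup>2 * p)"
  define e where "e = \<epsilon> / (2 * (b\<^sup>2 + 1))"
  have b2: "0 < b\<^sup>2 + 1" by (simp add: add_nonneg_pos)
  have "0 < e" using \<open>0 < \<epsilon>\<close> b2 by (simp add: e_def)
  have "e * b\<^sup>2 \<le> e * (b\<^sup>2 + 1)" using \<open>0 < e\<close> by simp
  also have "\<dots> = \<epsilon> / 2" using b2 by (simp add: e_def field_simps)
  finally have eb: "e * b\<^sup>2 \<le> \<epsilon> / 2" .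
  have ab2: "a\<^sup>2 \<le> b\<^sup>2" using a_nonneg a_le_b by (intro power_mono) auto
  obtain D where D: "0 \<le> D"
    "\<And>y. \<bar>f y - f x - d x * (y - x) - p / 2 * (y - x)\<^sup>2\<bar> \<le> e * (y - x)\<^sup>2 + D * (y - x) ^ 4"
    using second_order_expansion[OF q \<open>0 < e\<close> diff] by blast
  have up: "f y \<le> f x + d x * (y - x) + (p / 2 + e) * (y - x)\<^sup>2 + D * (y - x) ^ 4" for y
    using D(2)[of y] by (simp add: abs_le_iff algebra_simps)
  have low: "f y \<ge> f x + d x * (y - x) + (p / 2 - e) * (y - x)\<^sup>2 - D * (y - x) ^ 4" for y
    using D(2)[of y] by (simp add: abs_le_iff algebra_simps)
  have bound: "\<bar>(nisio h f x - f x) / h - ?G\<bar> \<le> \<epsilon> / 2 + 3 * D * b ^ 4 * h" if h: "0 < h" for h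
  proof -
    have "nisio h f x \<le> f x + (?G + e * b\<^sup>2) * h + 3 * D * b ^ 4 * h\<^sup>2"
    proof (rule nisio_le_quartic[OF bl D(1) _ up])
      have "e * a\<^sup>2 \<le> e * b\<^sup>2" using ab2 \<open>0 < e\<close> by simp
      then show "(p / 2 + e) * a\<^sup>2 \<le> ?G + e * b\<^sup>2" by (simp add: algebra_simps max_def)
      show "(p / 2 + e) * b\<^sup>2 \<le> ?G + e * b\<^sup>2" by (simp add: algebra_simps max_def)
    qed (use h in simp)
    also have "\<dots> = f x + (?G + e * b\<^sup>2 + 3 * D * b ^ 4 * h) * h"
      by (simp add: power2_eq_square algebra_simps)
    finally have U: "(nisio h f x - f x) / h \<le> ?G + e * b\<^sup>2 + 3 * D * b ^ 4 * h"
      using h by (simp add: pos_divide_le_eq)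
    obtain c where c: "c \<in> {a, b}" "?G = c\<^sup>2 * p / 2"
    proof (cases "a\<^sup>2 * p \<le> b\<^sup>2 * p")
      case True
      then show ?thesis using that[of b] by simp
    next
      case False
      then show ?thesis using that[of a] by simp
    qed
    then have cab: "c \<in> {a..b}" using a_le_b by auto
    have c2: "c\<^sup>2 \<le> b\<^sup>2" using cab a_nonneg by (intro power_mono) auto
    have c4: "c ^ 4 \<le> b ^ 4" using cab a_nonneg by (intro power_mono) auto
    have s: "(c * sqrt h)\<^sup>2 = c\<^sup>2 * h" "(c * sqrt h) ^ 4 = c ^ 4 * h\<^sup>2"
      using h by (auto simp: power_mult_distrib) (metis less_imp_le numeral_Bit0 power_add power2_eq_square real_sqrt_pow2)
    have "f x + (p / 2 - e) * (c\<^sup>2 * h) - 3 * D * (c ^ 4 * h\<^sup>2) \<le> heat (c * sqrt h) f x"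
      using heat_ge_quartic[OF bl low, of "c * sqrt h"] unfolding s .
    also have "\<dots> \<le> nisio h f x" by (rule heat_le_nisio[OF bl _ cab]) (use h in simp)
    finally have "f x + (p / 2 - e) * (c\<^sup>2 * h) - 3 * D * (c ^ 4 * h\<^sup>2) \<le> nisio h f x" .
    moreover have "e * c\<^sup>2 * h \<le> e * b\<^sup>2 * h" using c2 \<open>0 < e\<close> h by simp
    moreover have "3 * D * c ^ 4 * h\<^sup>2 \<le> 3 * D * b ^ 4 * h\<^sup>2"
      using c4 D(1) by (intro mult_right_mono mult_left_mono) auto
    ultimately have "f x + (?G - e * b\<^sup>2 - 3 * D * b ^ 4 * h) * h \<le> nisio h f x"
      unfolding c(2) by (simp add: power2_eq_square[of h] algebra_simps)
    then have "(?G - e * b\<^sup>2 - 3 * D * b ^ 4 * h) * h \<le> nisio h f x - f x" by linarith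
    then have Lo: "?G - e * b\<^sup>2 - 3 * D * b ^ 4 * h \<le> (nisio h f x - f x) / h"
      by (rule pos_le_divide_eq[THEN iffD2, OF h])
    show ?thesis using U Lo eb by (simp only: abs_le_iff) linarith
  qed
  define \<delta> where "\<delta> = \<epsilon> / (2 * (3 * D * b ^ 4 + 1))"
  have pos: "0 < 3 * D * b ^ 4 + 1" using D(1) by (simp add: add_nonneg_pos)
  have "0 < \<delta>" using \<open>0 < \<epsilon>\<close> pos by (simp add: \<delta>_def)
  have "\<forall>\<^sub>F h in at_right 0. h \<in> {0<..<\<delta>}"
    using \<open>0 < \<delta>\<close> by (rule eventually_at_right_real)
  then show "\<forall>\<^sub>F h in at_right 0. dist ((nisio h f x - f x) / h) ?G < \<epsilon>"
  proof eventually_elim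
    case (elim h)
    have "3 * D * b ^ 4 * h \<le> (3 * D * b ^ 4 + 1) * h" using elim by simp
    also have "\<dots> < (3 * D * b ^ 4 + 1) * \<delta>" using elim pos by simp
    also have "\<dots> = \<epsilon> / 2" using pos by (simp add: \<delta>_def field_simps)
    finally show ?case using bound[of h] elim by (simp add: dist_real_def)
  qed
qed

section \<open>The Ito isometry\<close>

context brownian_motion
begin

lemma F_measurable:
  assumes "0 \<le> s" "X \<in> measurable (F s) N"
  shows "X \<in> measurable M N"
  using assms(2) by (rule measurable_from_subalg[OF subalgebra_F[OF assms(1)]])

lemma F_measurable_mono:
  assumes "0 \<le> s" "s \<le> t" "X \<in> measurable (F s) N"
  shows "X \<in> measurable (F t) N"
proof -
  have "subalgebra (F t) (F s)"
    using subalgebra_F[of s] subalgebra_F[of t] F_mono[of s t] assms by (auto simp: subalgebra_def)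
  then show ?thesis by (rule measurable_from_subalg) fact
qed

lemma space_F: "0 \<le> s \<Longrightarrow> space (F s) = space M"
  using subalgebra_F by (auto simp: subalgebra_def)

lemma W_measurable: "0 \<le> s \<Longrightarrow> W s \<in> borel_measurable M"
  by (rule F_measurable[OF _ adapted])

text \<open>In \<^const>\<open>prob_space.indep_var\<close> both variables have the same type, hence the map \<open>\<phi>\<close>.\<close>

lemma increment_indep_var:
  assumes "0 \<le> s" "s < t" and X: "X \<in> measurable (F s) N" and \<phi>: "\<phi> \<in> measurable borel N'"
  shows "indep_var N X N' (\<lambda>\<omega>. \<phi> (W t \<omega> - W s \<omega>))"
  unfolding indep_var_eq
proof (intro conjI)
  let ?D = "\<lambda>\<omega>. W t \<omega> - W s \<omega>"
  show "random_variable N X" by (rule F_measurable[OF assms(1) X])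
  have D: "?D \<in> borel_measurable M"
    using assms by (intro borel_measurable_diff W_measurable) auto
  then show "random_variable N' (\<lambda>\<omega>. \<phi> (?D \<omega>))" using \<phi> by (rule measurable_compose)
  have "sigma_sets (space M) {X -` A \<inter> space M |A. A \<in> sets N} \<subseteq> sets (F s)"
    unfolding space_F[OF assms(1), symmetric]
    by (rule sets.sigma_sets_subset) (auto intro: measurable_sets[OF X])
  moreover have "sigma_sets (space M) {(\<lambda>\<omega>. \<phi> (?D \<omega>)) -` A \<inter> space M |A. A \<in> sets N'} \<subseteq>
      sigma_sets (space M) {?D -` A \<inter> space M |A. A \<in> sets borel}"
  proof (rule sigma_sets_mono, safe)
    fix A assume "A \<in> sets N'"
    then have "\<phi> -` A \<in> sets borel" using measurable_sets[OF \<phi>] by simp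
    moreover have "(\<lambda>\<omega>. \<phi> (?D \<omega>)) -` A \<inter> space M = ?D -` (\<phi> -` A) \<inter> space M" by auto
    ultimately show "(\<lambda>\<omega>. \<phi> (?D \<omega>)) -` A \<inter> space M \<in>
        sigma_sets (space M) {?D -` A \<inter> space M |A. A \<in> sets borel}"
      by blast
  qed
  ultimately show "indep_set (sigma_sets (space M) {X -` A \<inter> space M |A. A \<in> sets N})
      (sigma_sets (space M) {(\<lambda>\<omega>. \<phi> (?D \<omega>)) -` A \<inter> space M |A. A \<in> sets N'})"
    using indep_increments[OF assms(1,2)] unfolding indep_set_def sets_vimage_algebra
    by (elim indep_sets_mono_sets) (auto split: bool.split)
qed

text \<open>Expressed through scaling of \<open>gauss\<close> in order to include
  \<open>s = t\<close>, where the increment has no density.\<close>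

lemma distr_increment:
  assumes "0 \<le> s" "s \<le> t"
  shows "distr M borel (\<lambda>\<omega>. W t \<omega> - W s \<omega>) = distr gauss borel (\<lambda>z. sqrt (t - s) * z)"
proof (cases "s = t")
  case True
  have "distr M borel (\<lambda>\<omega>. 0 :: real) = return borel 0" "distr gauss borel (\<lambda>\<omega>. 0 :: real) = return borel 0"
    by (rule measure_eqI; auto simp: emeasure_distr emeasure_space_1 gauss.emeasure_space_1[simplified]
        split: split_indicator)+
  then show ?thesis using True by simp
next
  case False
  then have st: "s < t" using assms by simp
  have "distributed gauss lborel (\<lambda>z. 0 + sqrt (t - s) * z)
      (normal_density (0 + sqrt (t - s) * 0) (\<bar>sqrt (t - s)\<bar> * 1))"
    by (rule gauss.normal_density_affine) (use st in \<open>auto simp: distributed_def distr_id2\<close>)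
  then have "distr gauss borel (\<lambda>z. sqrt (t - s) * z) = density lborel (normal_density 0 (sqrt (t - s)))"
    using st by (simp add: distributed_def cong: distr_cong)
  moreover have "distr M borel (\<lambda>\<omega>. W t \<omega> - W s \<omega>) = density lborel (normal_density 0 (sqrt (t - s)))"
    using normal_increments[OF assms(1) st] by (simp add: distributed_def cong: distr_cong)
  ultimately show ?thesis by simp
qed

lemma
  assumes "0 \<le> s" "s \<le> t"
  shows integrable_increment: "integrable M (\<lambda>\<omega>. W t \<omega> - W s \<omega>)"
    and integrable_increment_square: "integrable M (\<lambda>\<omega>. (W t \<omega> - W s \<omega>)\<^sup>2)"
    and expectation_increment: "expectation (\<lambda>\<omega>. W t \<omega> - W s \<omega>) = 0"
    and expectation_increment_square: "expectation (\<lambda>\<omega>. (W t \<omega> - W s \<omega>)\<^sup>2) = t - s"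
proof -
  have D: "(\<lambda>\<omega>. W t \<omega> - W s \<omega>) \<in> borel_measurable M"
    using assms by (intro borel_measurable_diff W_measurable) auto
  note int = integrable_distr_eq[OF D, symmetric] and integ = integral_distr[OF D, symmetric]
  have g: "(\<lambda>z. sqrt (t - s) * z) \<in> borel_measurable gauss" by simp
  show "integrable M (\<lambda>\<omega>. W t \<omega> - W s \<omega>)"
    by (subst int[of "\<lambda>d. d"]) (simp_all add: distr_increment[OF assms] integrable_distr_eq)
  show "integrable M (\<lambda>\<omega>. (W t \<omega> - W s \<omega>)\<^sup>2)"
    by (subst int[of "\<lambda>d. d\<^sup>2"])
      (simp_all add: distr_increment[OF assms] integrable_distr_eq power_mult_distrib)
  show "expectation (\<lambda>\<omega>. W t \<omega> - W s \<omega>) = 0"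
    by (subst integ[of "\<lambda>d. d"]) (simp_all add: distr_increment[OF assms] integral_distr[OF g])
  show "expectation (\<lambda>\<omega>. (W t \<omega> - W s \<omega>)\<^sup>2) = t - s"
    by (subst integ[of "\<lambda>d. d\<^sup>2"])
      (use assms in \<open>simp_all add: distr_increment[OF assms] integral_distr[OF g] power_mult_distrib\<close>)
qed

text \<open>The increment is normal and independent of the past at time \<open>s\<close>, so
  \<open>X\<close> and \<open>\<xi>\<close> can be frozen by Fubini for the product of the two
  laws.\<close>

lemma expectation_step:
  assumes bl: "bounded_lipschitz B L g" and st: "0 \<le> s" "s \<le> t"
    and X: "X \<in> borel_measurable (F s)" and \<xi>: "\<xi> \<in> borel_measurable (F s)"
  shows "expectation (\<lambda>\<omega>. g (X \<omega> + \<xi> \<omega> * (W t \<omega> - W s \<omega>))) =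
    expectation (\<lambda>\<omega>. heat (\<xi> \<omega> * sqrt (t - s)) g (X \<omega>))"
proof (cases "s = t")
  case False
  then have "s < t" using st by simp
  define D where "D \<omega> = W t \<omega> - W s \<omega>" for \<omega>
  note [measurable] = bounded_lipschitz_measurable[OF bl] F_measurable[OF st(1) X] F_measurable[OF st(1) \<xi>]
  have [measurable]: "D \<in> borel_measurable M"
    unfolding D_def using st by (intro borel_measurable_diff W_measurable) auto
  let ?Z = "\<lambda>\<omega>. (X \<omega>, \<xi> \<omega>)"
  \<comment> \<open>The increment is paired with a dummy 0 so that both variables have the same
    type.\<close>
  let ?PZ = "distr M (borel \<Otimes>\<^sub>M borel) ?Z" and ?PD = "distr M (borel \<Otimes>\<^sub>M borel) (\<lambda>\<omega>. (D \<omega>, 0 :: real))"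
  have "?Z \<in> measurable (F s) (borel \<Otimes>\<^sub>M borel)" using X \<xi> by simp
  from increment_indep_var[OF st(1) \<open>s < t\<close> this, of "\<lambda>d. (d, 0 :: real)" "borel \<Otimes>\<^sub>M borel"]
  have ind: "indep_var (borel \<Otimes>\<^sub>M borel) ?Z (borel \<Otimes>\<^sub>M borel) (\<lambda>\<omega>. (D \<omega>, 0))"
    by (simp add: D_def[abs_def])
  interpret PZ: prob_space ?PZ by (rule prob_space_distr) simp
  interpret PD: prob_space ?PD by (rule prob_space_distr) simp
  interpret P: pair_prob_space ?PZ ?PD ..
  let ?k = "\<lambda>(z, d). g (fst z + snd z * fst d)"
  have "expectation (\<lambda>\<omega>. g (X \<omega> + \<xi> \<omega> * D \<omega>)) =
      integral\<^sup>L (distr M ((borel \<Otimes>\<^sub>M borel) \<Otimes>\<^sub>M (borel \<Otimes>\<^sub>M borel)) (\<lambda>\<omega>. (?Z \<omega>, (D \<omega>, 0 :: real)))) ?k"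
    by (subst integral_distr) auto
  also have "\<dots> = (LINT q|(?PZ \<Otimes>\<^sub>M ?PD). ?k q)"
    using ind unfolding indep_var_distribution_eq by simp
  also have "\<dots> = (LINT z|?PZ. LINT d|?PD. ?k (z, d))"
  proof (rule P.integral_fst'[symmetric])
    show "integrable (?PZ \<Otimes>\<^sub>M ?PD) ?k"
      using bounded_lipschitz_integrable[OF bl P.prob_space_axioms, of "\<lambda>q. fst (fst q) + snd (fst q) * fst (snd q)"]
      by (simp add: split_beta')
  qed
  also have "\<dots> = (LINT z|?PZ. heat (snd z * sqrt (t - s)) g (fst z))"
  proof (intro Bochner_Integration.integral_cong refl)
    fix z :: "real \<times> real"
    have "(LINT d|?PD. ?k (z, d)) = (LINT y|(distr M borel D). g (fst z + snd z * y))"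
      by (subst (1 2) integral_distr) auto
    also have "\<dots> = (LINT y|gauss. g (fst z + snd z * (sqrt (t - s) * y)))"
      unfolding D_def[abs_def] distr_increment[OF st] by (subst integral_distr) auto
    finally have "(LINT d|?PD. ?k (z, d)) = (LINT y|gauss. g (fst z + snd z * (sqrt (t - s) * y)))" .
    then show "(LINT d|?PD. ?k (z, d)) = heat (snd z * sqrt (t - s)) g (fst z)"
      by (simp add: heat_def mult.assoc)
  qed
  also have "\<dots> = expectation (\<lambda>\<omega>. heat (\<xi> \<omega> * sqrt (t - s)) g (X \<omega>))"
    unfolding heat_def by (subst integral_distr) auto
  finally show ?thesis by (simp add: D_def)
qed simp

lemma
  assumes st: "0 \<le> s" "s \<le> t" and Y: "Y \<in> borel_measurable (F s)" "integrable M Y"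
  shows integrable_mult_increment: "integrable M (\<lambda>\<omega>. Y \<omega> * (W t \<omega> - W s \<omega>))"
    and expectation_mult_increment: "expectation (\<lambda>\<omega>. Y \<omega> * (W t \<omega> - W s \<omega>)) = 0"
    and integrable_mult_increment_square: "integrable M (\<lambda>\<omega>. Y \<omega> * (W t \<omega> - W s \<omega>)\<^sup>2)"
    and expectation_mult_increment_square:
      "expectation (\<lambda>\<omega>. Y \<omega> * (W t \<omega> - W s \<omega>)\<^sup>2) = expectation Y * (t - s)"
proof -
  have "integrable M (\<lambda>\<omega>. Y \<omega> * (W t \<omega> - W s \<omega>)) \<and> expectation (\<lambda>\<omega>. Y \<omega> * (W t \<omega> - W s \<omega>)) = 0 \<and>
    integrable M (\<lambda>\<omega>. Y \<omega> * (W t \<omega> - W s \<omega>)\<^sup>2) \<and>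
    expectation (\<lambda>\<omega>. Y \<omega> * (W t \<omega> - W s \<omega>)\<^sup>2) = expectation Y * (t - s)"
  proof (cases "s = t")
    case False
    then have "s < t" using st by simp
    have ind: "indep_var borel Y borel (\<lambda>\<omega>. W t \<omega> - W s \<omega>)"
      using increment_indep_var[OF st(1) \<open>s < t\<close> Y(1), of "\<lambda>d. d" borel] by simp
    have ind2: "indep_var borel Y borel (\<lambda>\<omega>. (W t \<omega> - W s \<omega>)\<^sup>2)"
      using increment_indep_var[OF st(1) \<open>s < t\<close> Y(1), of power2 borel] by simp
    show ?thesis
      using indep_var_integrable[OF ind Y(2) integrable_increment[OF st]]
        indep_var_lebesgue_integral[OF ind Y(2) integrable_increment[OF st]]
        indep_var_integrable[OF ind2 Y(2) integrable_increment_square[OF st]]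
        indep_var_lebesgue_integral[OF ind2 Y(2) integrable_increment_square[OF st]]
      by (simp add: expectation_increment[OF st] expectation_increment_square[OF st])
  qed simp
  then show "integrable M (\<lambda>\<omega>. Y \<omega> * (W t \<omega> - W s \<omega>))"
    "expectation (\<lambda>\<omega>. Y \<omega> * (W t \<omega> - W s \<omega>)) = 0"
    "integrable M (\<lambda>\<omega>. Y \<omega> * (W t \<omega> - W s \<omega>)\<^sup>2)"
    "expectation (\<lambda>\<omega>. Y \<omega> * (W t \<omega> - W s \<omega>)\<^sup>2) = expectation Y * (t - s)" by auto
qed

definition bounded_at :: "real \<Rightarrow> ('a \<Rightarrow> real) \<Rightarrow> bool" where
  "bounded_at s \<xi> \<longleftrightarrow> \<xi> \<in> borel_measurable (F s) \<and> bounded (\<xi> ` space M)"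

lemma bounded_atD:
  assumes "bounded_at s \<xi>" "0 \<le> s"
  shows "\<xi> \<in> borel_measurable (F s)" "\<xi> \<in> borel_measurable M" "integrable M \<xi>"
proof -
  show *: "\<xi> \<in> borel_measurable (F s)" using assms by (simp add: bounded_at_def)
  then show M: "\<xi> \<in> borel_measurable M" using F_measurable assms by blast
  obtain B where "\<And>\<omega>. \<omega> \<in> space M \<Longrightarrow> norm (\<xi> \<omega>) \<le> B"
    using assms by (auto simp: bounded_at_def bounded_iff)
  then show "integrable M \<xi>" by (intro integrable_const_bound[of _ B] M) auto
qed

lemma bounded_at_mult:
  assumes "bounded_at s \<xi>" "bounded_at r \<eta>" "0 \<le> s" "s \<le> r"
  shows "bounded_at r (\<lambda>\<omega>. \<xi> \<omega> * \<eta> \<omega>)"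
proof -
  obtain B C where B: "\<And>\<omega>. \<omega> \<in> space M \<Longrightarrow> norm (\<xi> \<omega>) \<le> B" "\<And>\<omega>. \<omega> \<in> space M \<Longrightarrow> norm (\<eta> \<omega>) \<le> C"
    using assms by (auto simp: bounded_at_def bounded_iff)
  have "norm (\<xi> \<omega> * \<eta> \<omega>) \<le> B * C" if "\<omega> \<in> space M" for \<omega>
    unfolding norm_mult using B[OF that] by (intro mult_mono) (auto intro: order_trans[OF norm_ge_zero])
  then have "bounded ((\<lambda>\<omega>. \<xi> \<omega> * \<eta> \<omega>) ` space M)" by (auto simp: bounded_iff)
  then show ?thesis
    using F_measurable_mono[OF assms(3,4) bounded_atD(1)[OF assms(1,3)]]
      bounded_atD(1)[OF assms(2) order_trans[OF assms(3,4)]]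
    unfolding bounded_at_def by (intro conjI borel_measurable_times)
qed

text \<open>Products of increments over disjoint intervals have mean zero, by conditioning at the
  start of the later one; only the overlap contributes, with its length. The order
  \<open>p \<le> q\<close> is no loss by symmetry.\<close>

lemma cross_aux:
  assumes p: "0 \<le> p" "p \<le> p'" and q: "q \<le> q'" and pq: "p \<le> q"
    and \<xi>: "bounded_at p \<xi>" and \<eta>: "bounded_at q \<eta>"
  shows "integrable M (\<lambda>\<omega>. \<xi> \<omega> * (W p' \<omega> - W p \<omega>) * (\<eta> \<omega> * (W q' \<omega> - W q \<omega>)))"
    and "expectation (\<lambda>\<omega>. \<xi> \<omega> * (W p' \<omega> - W p \<omega>) * (\<eta> \<omega> * (W q' \<omega> - W q \<omega>))) =
      expectation (\<lambda>\<omega>. \<xi> \<omega> * \<eta> \<omega>) * measure lborel ({p<..p'} \<inter> {q<..q'})"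
proof -
  let ?Y = "\<lambda>\<omega>. \<xi> \<omega> * \<eta> \<omega>"
  have q0: "0 \<le> q" using p pq by simp
  have Y: "bounded_at q ?Y" by (rule bounded_at_mult[OF \<xi> \<eta> p(1) pq])
  note Ym = bounded_atD[OF Y q0]
  have Yr: "?Y \<in> borel_measurable (F r)" if "q \<le> r" for r using F_measurable_mono[OF q0 that Ym(1)] .
  have Wm: "W s \<in> borel_measurable (F r)" if "0 \<le> s" "s \<le> r" for s r
    using F_measurable_mono[OF that adapted] that by simp
  have far: "integrable M (\<lambda>\<omega>. ?Y \<omega> * (W u \<omega> - W v \<omega>) * (W s \<omega> - W r \<omega>)) \<and>
      expectation (\<lambda>\<omega>. ?Y \<omega> * (W u \<omega> - W v \<omega>) * (W s \<omega> - W r \<omega>)) = 0"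
    if "q \<le> v" "v \<le> u" "u \<le> r" "r \<le> s" for u v r s
  proof -
    have int: "integrable M (\<lambda>\<omega>. ?Y \<omega> * (W u \<omega> - W v \<omega>))"
      using integrable_mult_increment[OF _ _ Yr[of v] Ym(3)] that q0 by simp
    have "(\<lambda>\<omega>. ?Y \<omega> * (W u \<omega> - W v \<omega>)) \<in> borel_measurable (F r)"
      using that q0 by (intro borel_measurable_times[of ?Y] borel_measurable_diff Yr Wm) auto
    from integrable_mult_increment[OF _ _ this int, of s] expectation_mult_increment[OF _ _ this int, of s]
    show ?thesis using that q0 by simp
  qed
  \<comment> \<open>\<open>\<eta>\<close> is known at time \<open>q\<close> but in general not at
    time \<open>p\<close>. Integrability therefore comes in two stages: first \<open>\<xi>\<close>
    times the increment from \<open>p\<close>, then multiplication by the bounded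
    \<open>\<eta>\<close>.\<close>
  have past: "integrable M (\<lambda>\<omega>. ?Y \<omega> * (W u \<omega> - W p \<omega>) * (W q' \<omega> - W q \<omega>)) \<and>
      expectation (\<lambda>\<omega>. ?Y \<omega> * (W u \<omega> - W p \<omega>) * (W q' \<omega> - W q \<omega>)) = 0"
    if "p \<le> u" "u \<le> q" for u
  proof -
    have \<eta>m: "\<eta> \<in> borel_measurable (F q)" by (rule bounded_atD(1)[OF \<eta> q0])
    have \<xi>int: "integrable M (\<lambda>\<omega>. \<xi> \<omega> * (W u \<omega> - W p \<omega>))"
      using integrable_mult_increment[OF p(1) that(1) bounded_atD(1,3)[OF \<xi> p(1)]] .
    have \<xi>m: "(\<lambda>\<omega>. \<xi> \<omega> * (W u \<omega> - W p \<omega>)) \<in> borel_measurable (F q)"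
      using that p pq by (intro borel_measurable_times borel_measurable_diff Wm
          F_measurable_mono[OF p(1) pq bounded_atD(1)[OF \<xi> p(1)]]) auto
    obtain C where C: "\<And>\<omega>. \<omega> \<in> space M \<Longrightarrow> \<bar>\<eta> \<omega>\<bar> \<le> C"
      using \<eta> by (auto simp: bounded_at_def bounded_iff)
    have int: "integrable M (\<lambda>\<omega>. \<eta> \<omega> * (\<xi> \<omega> * (W u \<omega> - W p \<omega>)))"
    proof (rule Bochner_Integration.integrable_bound[OF integrable_mult_right[OF \<xi>int, of C]])
      show "(\<lambda>\<omega>. \<eta> \<omega> * (\<xi> \<omega> * (W u \<omega> - W p \<omega>))) \<in> borel_measurable M"
        using F_measurable[OF q0 \<xi>m] F_measurable[OF q0 \<eta>m] by simp
      show "AE \<omega> in M. norm (\<eta> \<omega> * (\<xi> \<omega> * (W u \<omega> - W p \<omega>))) \<le> norm (C * (\<xi> \<omega> * (W u \<omega> - W p \<omega>)))"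
      proof (rule AE_I2)
        fix \<omega> assume "\<omega> \<in> space M"
        from C[OF this] have "\<bar>\<eta> \<omega>\<bar> \<le> \<bar>C\<bar>" by linarith
        then show "norm (\<eta> \<omega> * (\<xi> \<omega> * (W u \<omega> - W p \<omega>))) \<le> norm (C * (\<xi> \<omega> * (W u \<omega> - W p \<omega>)))"
          unfolding real_norm_def abs_mult by (intro mult_right_mono) auto
      qed
    qed
    have "(\<lambda>\<omega>. \<eta> \<omega> * (\<xi> \<omega> * (W u \<omega> - W p \<omega>))) \<in> borel_measurable (F q)"
      using \<xi>m \<eta>m by simp
    from integrable_mult_increment[OF q0 q this int] expectation_mult_increment[OF q0 q this int]
    show ?thesis by (simp add: ac_simps)
  qed
  have sq: "integrable M (\<lambda>\<omega>. ?Y \<omega> * (W r \<omega> - W q \<omega>)\<^sup>2) \<and>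
      expectation (\<lambda>\<omega>. ?Y \<omega> * (W r \<omega> - W q \<omega>)\<^sup>2) = expectation ?Y * (r - q)" if "q \<le> r" for r
    using integrable_mult_increment_square[OF q0 that Ym(1,3)]
      expectation_mult_increment_square[OF q0 that Ym(1,3)] by simp
  have "integrable M (\<lambda>\<omega>. \<xi> \<omega> * (W p' \<omega> - W p \<omega>) * (\<eta> \<omega> * (W q' \<omega> - W q \<omega>))) \<and>
      expectation (\<lambda>\<omega>. \<xi> \<omega> * (W p' \<omega> - W p \<omega>) * (\<eta> \<omega> * (W q' \<omega> - W q \<omega>))) =
      expectation ?Y * measure lborel ({p<..p'} \<inter> {q<..q'})"
  proof (cases "p' \<le> q")
    case True
    then have "{p<..p'} \<inter> {q<..q'} = {}" by auto
    then show ?thesis using past[of p'] True p by (simp add: ac_simps)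
  next
    case False
    show ?thesis
    proof (cases "p' \<le> q'")
      case True
      have "{p<..p'} \<inter> {q<..q'} = {q<..p'}" using False True pq by auto
      then have m: "measure lborel ({p<..p'} \<inter> {q<..q'}) = p' - q" using False by simp
      have eq: "\<xi> \<omega> * (W p' \<omega> - W p \<omega>) * (\<eta> \<omega> * (W q' \<omega> - W q \<omega>)) =
          ?Y \<omega> * (W q \<omega> - W p \<omega>) * (W q' \<omega> - W q \<omega>) + ?Y \<omega> * (W p' \<omega> - W q \<omega>)\<^sup>2
          + ?Y \<omega> * (W p' \<omega> - W q \<omega>) * (W q' \<omega> - W p' \<omega>)" for \<omega>
        by (simp add: power2_eq_square algebra_simps)
      show ?thesis
        unfolding eq m using past[of q] sq[of p'] far[of q p' p' q'] pq False True by simp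
    next
      case f2: False
      have "{p<..p'} \<inter> {q<..q'} = {q<..q'}" using f2 pq by auto
      then have m: "measure lborel ({p<..p'} \<inter> {q<..q'}) = q' - q" using q by simp
      have eq: "\<xi> \<omega> * (W p' \<omega> - W p \<omega>) * (\<eta> \<omega> * (W q' \<omega> - W q \<omega>)) =
          ?Y \<omega> * (W q \<omega> - W p \<omega>) * (W q' \<omega> - W q \<omega>) + ?Y \<omega> * (W q' \<omega> - W q \<omega>)\<^sup>2
          + ?Y \<omega> * (W q' \<omega> - W q \<omega>) * (W p' \<omega> - W q' \<omega>)" for \<omega>
        by (simp add: power2_eq_square algebra_simps)
      show ?thesis
        unfolding eq m using past[of q] sq[of q'] far[of q q' q' p'] pq q f2 by simp
    qed
  qed
  then show "integrable M (\<lambda>\<omega>. \<xi> \<omega> * (W p' \<omega> - W p \<omega>) * (\<eta> \<omega> * (W q' \<omega> - W q \<omega>)))"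
    "expectation (\<lambda>\<omega>. \<xi> \<omega> * (W p' \<omega> - W p \<omega>) * (\<eta> \<omega> * (W q' \<omega> - W q \<omega>))) =
      expectation ?Y * measure lborel ({p<..p'} \<inter> {q<..q'})" by auto
qed

lemma cross:
  assumes p: "0 \<le> p" "p \<le> p'" and q: "0 \<le> q" "q \<le> q'"
    and \<xi>: "bounded_at p \<xi>" and \<eta>: "bounded_at q \<eta>"
  shows "integrable M (\<lambda>\<omega>. \<xi> \<omega> * (W p' \<omega> - W p \<omega>) * (\<eta> \<omega> * (W q' \<omega> - W q \<omega>)))"
    and "expectation (\<lambda>\<omega>. \<xi> \<omega> * (W p' \<omega> - W p \<omega>) * (\<eta> \<omega> * (W q' \<omega> - W q \<omega>))) =
      expectation (\<lambda>\<omega>. \<xi> \<omega> * \<eta> \<omega>) * measure lborel ({p<..p'} \<inter> {q<..q'})"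
    and "integrable M (\<lambda>\<omega>. \<xi> \<omega> * \<eta> \<omega>)"
proof -
  show "integrable M (\<lambda>\<omega>. \<xi> \<omega> * \<eta> \<omega>)"
  proof (cases "p \<le> q")
    case True
    then show ?thesis by (rule bounded_atD(3)[OF bounded_at_mult[OF \<xi> \<eta> p(1)] q(1)])
  next
    case False
    then show ?thesis
      using bounded_atD(3)[OF bounded_at_mult[OF \<eta> \<xi> q(1)] p(1)] by (simp add: mult.commute)
  qed
  show "integrable M (\<lambda>\<omega>. \<xi> \<omega> * (W p' \<omega> - W p \<omega>) * (\<eta> \<omega> * (W q' \<omega> - W q \<omega>)))"
    "expectation (\<lambda>\<omega>. \<xi> \<omega> * (W p' \<omega> - W p \<omega>) * (\<eta> \<omega> * (W q' \<omega> - W q \<omega>))) =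
      expectation (\<lambda>\<omega>. \<xi> \<omega> * \<eta> \<omega>) * measure lborel ({p<..p'} \<inter> {q<..q'})"
    using cross_aux[OF p q(2) _ \<xi> \<eta>] cross_aux[OF q p(2) _ \<eta> \<xi>]
    by (cases "p \<le> q"; simp add: ac_simps Int_commute)+
qed

text \<open>Both sides are the double sum of the means of
  \<open>\<xi> i \<omega> * \<xi> j \<omega>\<close>, weighted by the lengths of the overlaps. The
  intervals may overlap, so integrands on different grids can be compared without a common
  refinement.\<close>

lemma isometry_finite:
  assumes "finite A" and p: "\<And>i. i \<in> A \<Longrightarrow> 0 \<le> p i \<and> p i \<le> q i"
    and \<xi>: "\<And>i. i \<in> A \<Longrightarrow> bounded_at (p i) (\<xi> i)"
  shows "(\<integral>\<^sup>+\<omega>. ennreal ((\<Sum>i\<in>A. \<xi> i \<omega> * (W (q i) \<omega> - W (p i) \<omega>))\<^sup>2) \<partial>M) =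
    (\<integral>\<^sup>+\<omega>. (\<integral>\<^sup>+s. ennreal ((\<Sum>i\<in>A. \<xi> i \<omega> * indicator {p i<..q i} s)\<^sup>2) \<partial>lborel) \<partial>M)"
proof -
  let ?m = "\<lambda>i j. measure lborel ({p i<..q i} \<inter> {p j<..q j})"
  have m: "emeasure lborel ({p i<..q i} \<inter> {p j<..q j}) < \<infinity>" if "i \<in> A" for i j
  proof -
    have "emeasure lborel ({p i<..q i} \<inter> {p j<..q j}) \<le> emeasure lborel {p i<..q i}"
      by (rule emeasure_mono) auto
    also have "\<dots> < \<infinity>" using p[OF that] by simp
    finally show ?thesis .
  qed
  note cr = cross[of "p i" "q i" "p j" "q j" "\<xi> i" "\<xi> j" for i j]
  have sq: "(\<Sum>i\<in>A. x i)\<^sup>2 = (\<Sum>i\<in>A. \<Sum>j\<in>A. x i * x j)" for x :: "'b \<Rightarrow> real"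
    by (simp add: power2_eq_square sum_product)
  have inner: "(\<integral>\<^sup>+s. ennreal ((\<Sum>i\<in>A. \<xi> i \<omega> * indicator {p i<..q i} s)\<^sup>2) \<partial>lborel) =
      ennreal (\<Sum>i\<in>A. \<Sum>j\<in>A. \<xi> i \<omega> * \<xi> j \<omega> * ?m i j) \<and>
      0 \<le> (\<Sum>i\<in>A. \<Sum>j\<in>A. \<xi> i \<omega> * \<xi> j \<omega> * ?m i j)" for \<omega>
  proof -
    have eq: "(\<Sum>i\<in>A. \<xi> i \<omega> * indicator {p i<..q i} s)\<^sup>2 =
        (\<Sum>i\<in>A. \<Sum>j\<in>A. \<xi> i \<omega> * \<xi> j \<omega> * indicator ({p i<..q i} \<inter> {p j<..q j}) s)" for s
      unfolding sq by (intro sum.cong refl) (simp add: indicator_def)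
    have int: "integrable lborel (\<lambda>s. (\<Sum>i\<in>A. \<xi> i \<omega> * indicator {p i<..q i} s)\<^sup>2)"
      unfolding eq using m by (intro Bochner_Integration.integrable_sum integrable_mult_right) auto
    have val: "(LINT s|lborel. (\<Sum>i\<in>A. \<xi> i \<omega> * indicator {p i<..q i} s)\<^sup>2) =
        (\<Sum>i\<in>A. \<Sum>j\<in>A. \<xi> i \<omega> * \<xi> j \<omega> * ?m i j)"
      unfolding eq using m
      by (simp add: Bochner_Integration.integral_sum Bochner_Integration.integrable_sum)
    have "0 \<le> (LINT s|lborel. (\<Sum>i\<in>A. \<xi> i \<omega> * indicator {p i<..q i} s)\<^sup>2)"
      by (rule Bochner_Integration.integral_nonneg) simp
    moreover have "(\<integral>\<^sup>+s. ennreal ((\<Sum>i\<in>A. \<xi> i \<omega> * indicator {p i<..q i} s)\<^sup>2) \<partial>lborel) =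
        ennreal (LINT s|lborel. (\<Sum>i\<in>A. \<xi> i \<omega> * indicator {p i<..q i} s)\<^sup>2)"
      by (rule nn_integral_eq_integral[OF int]) simp
    ultimately show ?thesis unfolding val by simp
  qed
  let ?\<Delta> = "\<lambda>i \<omega>. \<xi> i \<omega> * (W (q i) \<omega> - W (p i) \<omega>)"
  have int: "integrable M (\<lambda>\<omega>. (\<Sum>i\<in>A. ?\<Delta> i \<omega>)\<^sup>2)"
    unfolding sq by (intro Bochner_Integration.integrable_sum cr(1)) (use p \<xi> in auto)
  have "(\<integral>\<^sup>+\<omega>. ennreal ((\<Sum>i\<in>A. ?\<Delta> i \<omega>)\<^sup>2) \<partial>M) = ennreal (expectation (\<lambda>\<omega>. (\<Sum>i\<in>A. ?\<Delta> i \<omega>)\<^sup>2))"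
    by (rule nn_integral_eq_integral[OF int]) simp
  also have "expectation (\<lambda>\<omega>. (\<Sum>i\<in>A. ?\<Delta> i \<omega>)\<^sup>2) =
      (\<Sum>i\<in>A. \<Sum>j\<in>A. expectation (\<lambda>\<omega>. ?\<Delta> i \<omega> * ?\<Delta> j \<omega>))"
    unfolding sq
    by (subst Bochner_Integration.integral_sum Bochner_Integration.integrable_sum;
        (intro Bochner_Integration.integrable_sum cr(1) sum.cong refl
          Bochner_Integration.integral_sum)?) (use p \<xi> in auto)
  also have "\<dots> = (\<Sum>i\<in>A. \<Sum>j\<in>A. expectation (\<lambda>\<omega>. \<xi> i \<omega> * \<xi> j \<omega> * ?m i j))"
    using cr(2) p \<xi> by (intro sum.cong refl) simp
  also have "\<dots> = expectation (\<lambda>\<omega>. \<Sum>i\<in>A. \<Sum>j\<in>A. \<xi> i \<omega> * \<xi> j \<omega> * ?m i j)"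
    by (subst Bochner_Integration.integral_sum Bochner_Integration.integrable_sum;
        (intro Bochner_Integration.integrable_sum cr(3) sum.cong refl integrable_mult_left
          Bochner_Integration.integral_sum[symmetric])?) (use p \<xi> in auto)
  also have "ennreal \<dots> = (\<integral>\<^sup>+\<omega>. ennreal (\<Sum>i\<in>A. \<Sum>j\<in>A. \<xi> i \<omega> * \<xi> j \<omega> * ?m i j) \<partial>M)"
  proof (rule nn_integral_eq_integral[symmetric])
    show "integrable M (\<lambda>\<omega>. \<Sum>i\<in>A. \<Sum>j\<in>A. \<xi> i \<omega> * \<xi> j \<omega> * ?m i j)"
      by (intro Bochner_Integration.integrable_sum integrable_mult_left cr(3)) (use p \<xi> in auto)
    show "AE \<omega> in M. 0 \<le> (\<Sum>i\<in>A. \<Sum>j\<in>A. \<xi> i \<omega> * \<xi> j \<omega> * ?m i j)"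
      using inner by simp
  qed
  finally show ?thesis using inner by simp
qed

end

section \<open>Square distance and completeness\<close>

definition sqdist :: "'b measure \<Rightarrow> ('b \<Rightarrow> real) \<Rightarrow> ('b \<Rightarrow> real) \<Rightarrow> ennreal" where
  "sqdist N f g = (\<integral>\<^sup>+x. ennreal ((f x - g x)\<^sup>2) \<partial>N)"

lemma sqdist_commute: "sqdist N f g = sqdist N g f"
  by (simp add: sqdist_def power2_commute)

text \<open>The factor 2 comes from bounding \<open>(x + y)\<^sup>2\<close> by
  \<open>2 * (x\<^sup>2 + y\<^sup>2)\<close>. It is the price of working with squares in the
  extended reals, where no integrability has to be carried along.\<close>

lemma sqdist_triangle:
  assumes [measurable]: "f \<in> borel_measurable N" "g \<in> borel_measurable N" "h \<in> borel_measurable N"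
  shows "sqdist N f h \<le> 2 * (sqdist N f g + sqdist N g h)"
proof -
  have "ennreal ((f x - h x)\<^sup>2) \<le> 2 * (ennreal ((f x - g x)\<^sup>2) + ennreal ((g x - h x)\<^sup>2))" for x
  proof -
    have "0 \<le> ((f x - g x) - (g x - h x))\<^sup>2" by simp
    then have "(f x - h x)\<^sup>2 \<le> 2 * ((f x - g x)\<^sup>2 + (g x - h x)\<^sup>2)"
      by (simp add: power2_eq_square algebra_simps)
    then have "ennreal ((f x - h x)\<^sup>2) \<le> ennreal (2 * ((f x - g x)\<^sup>2 + (g x - h x)\<^sup>2))"
      by (rule ennreal_leI)
    also have "\<dots> = 2 * (ennreal ((f x - g x)\<^sup>2) + ennreal ((g x - h x)\<^sup>2))"
      by (subst ennreal_mult, simp, simp, subst ennreal_plus) auto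
    finally show ?thesis .
  qed
  then have "sqdist N f h \<le> (\<integral>\<^sup>+x. 2 * (ennreal ((f x - g x)\<^sup>2) + ennreal ((g x - h x)\<^sup>2)) \<partial>N)"
    unfolding sqdist_def by (intro nn_integral_mono) auto
  also have "\<dots> = 2 * (sqdist N f g + sqdist N g h)"
    unfolding sqdist_def by (subst nn_integral_cmult) (auto simp: nn_integral_add)
  finally show ?thesis .
qed

lemma sqdist_eq_0:
  assumes [measurable]: "f \<in> borel_measurable N" "g \<in> borel_measurable N"
    and "sqdist N f g = 0"
  shows "AE x in N. f x = g x"
  using assms(3) unfolding sqdist_def by (subst (asm) nn_integral_0_iff_AE) auto

lemma ennreal_tendsto_add_0:
  fixes f g :: "nat \<Rightarrow> ennreal"
  assumes "f \<longlonglongrightarrow> 0" "g \<longlonglongrightarrow> 0"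
  shows "(\<lambda>k. 2 * (f k + g k)) \<longlonglongrightarrow> 0"
proof -
  have "(\<lambda>k. 2 * (f k + g k)) \<longlonglongrightarrow> 2 * (0 + 0)"
    by (intro tendsto_add ennreal_tendsto_cmult assms) auto
  then show ?thesis by simp
qed

context prob_space
begin

text \<open>Young's inequality \<open>\<bar>x\<bar> \<le> x\<^sup>2 / e + e / 4\<close> turns the
  bound on squares into \<open>e / 2 + e / 4 < e\<close>.\<close>

lemma expectation_abs_le_sqdist:
  assumes [measurable]: "X \<in> borel_measurable M" "Y \<in> borel_measurable M"
    and "0 < e" "sqdist M X Y \<le> ennreal (e\<^sup>2 / 2)"
  shows "integrable M (\<lambda>\<omega>. X \<omega> - Y \<omega>)" "expectation (\<lambda>\<omega>. \<bar>X \<omega> - Y \<omega>\<bar>) < e"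
proof -
  have pt: "\<bar>x\<bar> \<le> 1 / e * x\<^sup>2 + e / 4" for x :: real
  proof -
    have "0 \<le> (\<bar>x\<bar> - e / 2)\<^sup>2" by simp
    then have "e * \<bar>x\<bar> \<le> x\<^sup>2 + e\<^sup>2 / 4" by (simp add: power2_eq_square algebra_simps)
    then show ?thesis using \<open>0 < e\<close> by (simp add: field_simps power2_eq_square)
  qed
  have "(\<integral>\<^sup>+\<omega>. ennreal \<bar>X \<omega> - Y \<omega>\<bar> \<partial>M) \<le>
      (\<integral>\<^sup>+\<omega>. ennreal (1 / e) * ennreal ((X \<omega> - Y \<omega>)\<^sup>2) + ennreal (e / 4) \<partial>M)"
    using \<open>0 < e\<close> pt
    by (intro nn_integral_mono)
      (simp add: ennreal_mult[symmetric] ennreal_plus[symmetric] ennreal_leI del: ennreal_plus)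
  also have "\<dots> = ennreal (1 / e) * sqdist M X Y + ennreal (e / 4)"
    unfolding sqdist_def by (subst nn_integral_add) (auto simp: nn_integral_cmult emeasure_space_1)
  also have "\<dots> \<le> ennreal (1 / e) * ennreal (e\<^sup>2 / 2) + ennreal (e / 4)"
    using assms(4) by (intro add_right_mono mult_left_mono) auto
  also have "\<dots> = ennreal (3 / 4 * e)"
    using \<open>0 < e\<close>
    by (simp add: ennreal_mult[symmetric] ennreal_plus[symmetric] power2_eq_square del: ennreal_plus)
  finally have le: "(\<integral>\<^sup>+\<omega>. ennreal \<bar>X \<omega> - Y \<omega>\<bar> \<partial>M) \<le> ennreal (3 / 4 * e)" .
  show int: "integrable M (\<lambda>\<omega>. X \<omega> - Y \<omega>)"
  proof (rule integrableI_bounded)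
    show "(\<integral>\<^sup>+\<omega>. ennreal (norm (X \<omega> - Y \<omega>)) \<partial>M) < \<infinity>"
      using le by (simp add: le_less_trans)
  qed simp
  have "ennreal (expectation (\<lambda>\<omega>. \<bar>X \<omega> - Y \<omega>\<bar>)) \<le> ennreal (3 / 4 * e)"
    using le nn_integral_eq_integral[of M "\<lambda>\<omega>. \<bar>X \<omega> - Y \<omega>\<bar>"] int by simp
  then have "expectation (\<lambda>\<omega>. \<bar>X \<omega> - Y \<omega>\<bar>) \<le> 3 / 4 * e"
    using \<open>0 < e\<close> by (simp add: ennreal_le_iff)
  then show "expectation (\<lambda>\<omega>. \<bar>X \<omega> - Y \<omega>\<bar>) < e" using \<open>0 < e\<close> by simp
qed

text \<open>Smallness in mean square gives a Cauchy sequence in mean, hence an almost surely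
  convergent subsequence; Fatou's lemma transfers the square estimate to its limit. The shape of the
  bound is what the triangle inequality through a common target yields.\<close>

lemma L2_complete:
  fixes X :: "nat \<Rightarrow> 'a \<Rightarrow> real"
  assumes X: "\<And>k. integrable M (X k)"
    and \<delta>: "\<delta> \<longlonglongrightarrow> 0" "\<And>i j. sqdist M (X i) (X j) \<le> 2 * (\<delta> i + \<delta> j)"
  obtains I where "I \<in> borel_measurable M" "(\<lambda>k. sqdist M (X k) I) \<longlonglongrightarrow> 0"
proof -
  have [measurable]: "X k \<in> borel_measurable M" for k using X by auto
  have "\<exists>N. \<forall>i\<ge>N. \<forall>j\<ge>N. (LINT \<omega>|M. norm (X i \<omega> - X j \<omega>)) < e" if "0 < e" for e
  proof -
    have "0 < ennreal (e\<^sup>2 / 8)" using that by simp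
    with \<delta>(1) have "\<forall>\<^sub>F k in sequentially. \<delta> k < ennreal (e\<^sup>2 / 8)" by (rule order_tendstoD(2))
    then obtain N where N: "\<And>k. k \<ge> N \<Longrightarrow> \<delta> k < ennreal (e\<^sup>2 / 8)"
      by (auto simp: eventually_sequentially)
    have "(LINT \<omega>|M. norm (X i \<omega> - X j \<omega>)) < e" if ij: "i \<ge> N" "j \<ge> N" for i j
    proof -
      have "sqdist M (X i) (X j) \<le> 2 * (ennreal (e\<^sup>2 / 8) + ennreal (e\<^sup>2 / 8))"
        using N[OF ij(1)] N[OF ij(2)] by (intro order_trans[OF \<delta>(2)] mult_left_mono add_mono) auto
      also have "\<dots> = ennreal 2 * ennreal (e\<^sup>2 / 8 + e\<^sup>2 / 8)" by (subst ennreal_plus) auto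
      also have "\<dots> = ennreal (e\<^sup>2 / 2)" by (subst ennreal_mult[symmetric]) auto
      finally show ?thesis using expectation_abs_le_sqdist(2)[of "X i" "X j" e] \<open>0 < e\<close> by simp
    qed
    then show ?thesis by blast
  qed
  from cauchy_L1_AE_cauchy_subseq[OF X this]
  obtain r where r: "strict_mono r" "AE \<omega> in M. Cauchy (\<lambda>i. X (r i) \<omega>)" by blast
  define I where "I \<omega> = lim (\<lambda>i. X (r i) \<omega>)" for \<omega>
  have I[measurable]: "I \<in> borel_measurable M" unfolding I_def by measurable
  have lim: "AE \<omega> in M. (\<lambda>i. X (r i) \<omega>) \<longlonglongrightarrow> I \<omega>"
    using r(2) by eventually_elim (simp add: I_def Cauchy_convergent_iff convergent_LIMSEQ_iff)
  have "sqdist M (X k) I \<le> 2 * (\<delta> k + 0)" for k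
  proof -
    have "sqdist M (X k) I = (\<integral>\<^sup>+\<omega>. liminf (\<lambda>i. ennreal ((X k \<omega> - X (r i) \<omega>)\<^sup>2)) \<partial>M)"
      unfolding sqdist_def
    proof (rule nn_integral_cong_AE)
      show "AE \<omega> in M. ennreal ((X k \<omega> - I \<omega>)\<^sup>2) = liminf (\<lambda>i. ennreal ((X k \<omega> - X (r i) \<omega>)\<^sup>2))"
        using lim
      proof eventually_elim
        case (elim \<omega>)
        then have "(\<lambda>i. ennreal ((X k \<omega> - X (r i) \<omega>)\<^sup>2)) \<longlonglongrightarrow> ennreal ((X k \<omega> - I \<omega>)\<^sup>2)"
          by (intro tendsto_intros)
        then show ?case by (rule lim_imp_Liminf[OF sequentially_bot, symmetric])
      qed
    qed
    also have "\<dots> \<le> liminf (\<lambda>i. sqdist M (X k) (X (r i)))"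
      unfolding sqdist_def by (rule nn_integral_liminf) auto
    also have "\<dots> \<le> liminf (\<lambda>i. 2 * (\<delta> k + \<delta> (r i)))"
      by (intro Liminf_mono always_eventually allI \<delta>(2))
    also have "\<dots> = 2 * (\<delta> k + 0)"
    proof (rule lim_imp_Liminf)
      have "(\<lambda>i. \<delta> (r i)) \<longlonglongrightarrow> 0"
        using LIMSEQ_subseq_LIMSEQ[OF \<delta>(1) r(1)] by (simp add: comp_def)
      then show "(\<lambda>i. 2 * (\<delta> k + \<delta> (r i))) \<longlonglongrightarrow> 2 * (\<delta> k + 0)"
        by (intro ennreal_tendsto_cmult tendsto_add tendsto_const) auto
    qed simp
    finally show ?thesis .
  qed
  then have "(\<lambda>k. sqdist M (X k) I) \<longlonglongrightarrow> 0"
    by (intro tendsto_sandwich[OF _ _ tendsto_const ennreal_tendsto_add_0[OF \<delta>(1) tendsto_const]]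
        always_eventually allI zero_le)
  then show ?thesis by (rule that[OF I])
qed

end

section \<open>Existence and uniqueness of the Ito integral\<close>

context brownian_motion
begin

text \<open>The integrand as a function on the product space, cut off outside \<open>{0..t}\<close>.
  With it the double integral in \<open>is_ito_integral\<close> becomes a square distance over
  \<open>M \<Otimes>\<^sub>M lborel\<close>.\<close>

definition restricted :: "real \<Rightarrow> (real \<Rightarrow> 'a \<Rightarrow> real) \<Rightarrow> 'a \<times> real \<Rightarrow> real" where
  "restricted t \<phi> = (\<lambda>(\<omega>, s). indicator {0..t} s * \<phi> s \<omega>)"

lemma sqdist_restricted:
  assumes [measurable]: "restricted t \<phi> \<in> borel_measurable (M \<Otimes>\<^sub>M lborel)"
    "restricted t \<psi> \<in> borel_measurable (M \<Otimes>\<^sub>M lborel)"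
  shows "(\<integral>\<^sup>+\<omega>. (\<integral>\<^sup>+s\<in>{0..t}. ennreal ((\<phi> s \<omega> - \<psi> s \<omega>)\<^sup>2) \<partial>lborel) \<partial>M) =
    sqdist (M \<Otimes>\<^sub>M lborel) (restricted t \<phi>) (restricted t \<psi>)"
proof -
  have "ennreal ((\<phi> s \<omega> - \<psi> s \<omega>)\<^sup>2) * indicator {0..t} s =
      ennreal ((restricted t \<phi> (\<omega>, s) - restricted t \<psi> (\<omega>, s))\<^sup>2)" for s \<omega>
    by (simp add: restricted_def split: split_indicator)
  then show ?thesis
    unfolding sqdist_def
    by (subst lborel.nn_integral_fst[symmetric]) auto
qed

lemma simple_integrandD:
  assumes "simple_integrand M F t n p \<xi>"
  shows "i \<le> j \<Longrightarrow> j \<le> n \<Longrightarrow> p i \<le> p j" "i \<le> n \<Longrightarrow> 0 \<le> p i" "i \<le> n \<Longrightarrow> p i \<le> t"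
    "i < n \<Longrightarrow> bounded_at (p i) (\<xi> i)"
proof -
  have mono: "p i \<le> p j" if "i \<le> j" "j \<le> n" for i j
    using that
  proof (induction j rule: dec_induct)
    case (step m)
    then have "p m \<le> p (Suc m)" using assms by (auto simp: simple_integrand_def)
    then show ?case using step by simp
  qed simp
  show "i \<le> j \<Longrightarrow> j \<le> n \<Longrightarrow> p i \<le> p j" by (rule mono)
  show "i \<le> n \<Longrightarrow> 0 \<le> p i" "i \<le> n \<Longrightarrow> p i \<le> t"
    using mono[of 0 i] mono[of i n] assms by (auto simp: simple_integrand_def)
  show "i < n \<Longrightarrow> bounded_at (p i) (\<xi> i)"
    using assms by (auto simp: simple_integrand_def bounded_at_def)
qed

lemma simple_measurable:
  assumes "simple_integrand M F t n p \<xi>"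
  shows "restricted t (simple_process n p \<xi>) \<in> borel_measurable (M \<Otimes>\<^sub>M lborel)"
    "simple_integral W n p \<xi> \<in> borel_measurable M" "integrable M (simple_integral W n p \<xi>)"
proof -
  note D = simple_integrandD[OF assms]
  have \<xi>[measurable]: "\<xi> i \<in> borel_measurable M" if "i < n" for i
    using bounded_atD(2)[OF D(4,2)] that by simp
  show "restricted t (simple_process n p \<xi>) \<in> borel_measurable (M \<Otimes>\<^sub>M lborel)"
    unfolding restricted_def simple_process_def split_beta'
    by (intro borel_measurable_times borel_measurable_sum) (auto intro!: measurable_compose[OF measurable_fst \<xi>])
  show "integrable M (simple_integral W n p \<xi>)"
    unfolding simple_integral_def[abs_def]
    by (intro Bochner_Integration.integrable_sum integrable_mult_increment)
      (use D bounded_atD[OF D(4,2)] in auto)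
  then show "simple_integral W n p \<xi> \<in> borel_measurable M" by auto
qed

text \<open>The difference of two simple integrals is a single sum over the disjoint union of the
  index sets, with the second family of weights negated.\<close>

lemma simple_isometry:
  assumes \<xi>: "simple_integrand M F t n p \<xi>" and \<eta>: "simple_integrand M F t m q \<eta>"
  shows "sqdist M (simple_integral W n p \<xi>) (simple_integral W m q \<eta>) =
    sqdist (M \<Otimes>\<^sub>M lborel) (restricted t (simple_process n p \<xi>)) (restricted t (simple_process m q \<eta>))"
proof -
  note D = simple_integrandD[OF \<xi>] and E = simple_integrandD[OF \<eta>]
  let ?A = "{..<n} <+> {..<m}"
  let ?p = "case_sum p q" and ?q = "case_sum (\<lambda>i. p (Suc i)) (\<lambda>i. q (Suc i))"
    and ?\<xi> = "case_sum \<xi> (\<lambda>i \<omega>. - \<eta> i \<omega>)"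
  have neg: "bounded_at s (\<lambda>\<omega>. - \<zeta> \<omega>)" if "bounded_at s \<zeta>" for s \<zeta>
    using that by (auto simp: bounded_at_def bounded_iff)
  have "sqdist M (simple_integral W n p \<xi>) (simple_integral W m q \<eta>) =
      (\<integral>\<^sup>+\<omega>. ennreal ((\<Sum>i\<in>?A. ?\<xi> i \<omega> * (W (?q i) \<omega> - W (?p i) \<omega>))\<^sup>2) \<partial>M)"
    unfolding sqdist_def simple_integral_def by (simp add: sum.Plus sum_negf)
  also have "\<dots> = (\<integral>\<^sup>+\<omega>. (\<integral>\<^sup>+s. ennreal ((\<Sum>i\<in>?A. ?\<xi> i \<omega> * indicator {?p i<..?q i} s)\<^sup>2) \<partial>lborel) \<partial>M)"
  proof (rule isometry_finite)
    show "0 \<le> ?p i \<and> ?p i \<le> ?q i" "bounded_at (?p i) (?\<xi> i)" if "i \<in> ?A" for i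
      using that D E by (auto intro!: neg[OF E(4)] D E)
  qed simp
  also have "\<dots> = (\<integral>\<^sup>+\<omega>. (\<integral>\<^sup>+s\<in>{0..t}. ennreal ((simple_process n p \<xi> s \<omega> - simple_process m q \<eta> s \<omega>)\<^sup>2) \<partial>lborel) \<partial>M)"
  proof (intro nn_integral_cong)
    fix s \<omega>
    have "simple_process n p \<xi> s \<omega> = 0 \<and> simple_process m q \<eta> s \<omega> = 0" if "s \<notin> {0..t}"
    proof -
      have "indicator {p i<..p (Suc i)} s = (0 :: real)" if "i < n" for i
        using D(2)[of i] D(3)[of "Suc i"] that \<open>s \<notin> {0..t}\<close> by (auto simp: indicator_def)
      moreover have "indicator {q i<..q (Suc i)} s = (0 :: real)" if "i < m" for i
        using E(2)[of i] E(3)[of "Suc i"] that \<open>s \<notin> {0..t}\<close> by (auto simp: indicator_def)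
      ultimately show ?thesis by (simp add: simple_process_def)
    qed
    moreover have "(\<Sum>i\<in>?A. ?\<xi> i \<omega> * indicator {?p i<..?q i} s) =
        simple_process n p \<xi> s \<omega> - simple_process m q \<eta> s \<omega>"
      unfolding simple_process_def by (subst sum.Plus) (simp_all add: sum_negf)
    ultimately show "ennreal ((\<Sum>i\<in>?A. ?\<xi> i \<omega> * indicator {?p i<..?q i} s)\<^sup>2) =
        ennreal ((simple_process n p \<xi> s \<omega> - simple_process m q \<eta> s \<omega>)\<^sup>2) * indicator {0..t} s"
      by (auto split: split_indicator)
  qed
  also have "\<dots> = sqdist (M \<Otimes>\<^sub>M lborel) (restricted t (simple_process n p \<xi>)) (restricted t (simple_process m q \<eta>))"
    by (rule sqdist_restricted; rule simple_measurable) fact+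
  finally show ?thesis .
qed

lemma is_ito_integral_iff:
  assumes \<sigma>: "restricted t \<sigma> \<in> borel_measurable (M \<Otimes>\<^sub>M lborel)"
  shows "is_ito_integral M F W t \<sigma> I \<longleftrightarrow> I \<in> borel_measurable M \<and>
    (\<exists>n p \<xi>. (\<forall>k. simple_integrand M F t (n k) (p k) (\<xi> k)) \<and>
      (\<lambda>k. sqdist (M \<Otimes>\<^sub>M lborel) (restricted t (simple_process (n k) (p k) (\<xi> k))) (restricted t \<sigma>)) \<longlonglongrightarrow> 0 \<and>
      (\<lambda>k. sqdist M (simple_integral W (n k) (p k) (\<xi> k)) I) \<longlonglongrightarrow> 0)"
proof -
  have eq: "(\<integral>\<^sup>+\<omega>. (\<integral>\<^sup>+s\<in>{0..t}. ennreal ((simple_process n p \<xi> s \<omega> - \<sigma> s \<omega>)\<^sup>2) \<partial>lborel) \<partial>M) =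
      sqdist (M \<Otimes>\<^sub>M lborel) (restricted t (simple_process n p \<xi>)) (restricted t \<sigma>)"
    if "simple_integrand M F t n p \<xi>" for n p \<xi>
    by (rule sqdist_restricted[OF simple_measurable(1)[OF that] \<sigma>])
  show ?thesis
    unfolding is_ito_integral_def sqdist_def[of M, symmetric]
    by (intro conj_cong ex_cong1 refl) (simp add: eq)
qed

lemma ito_integral_unique:
  assumes \<sigma>: "restricted t \<sigma> \<in> borel_measurable (M \<Otimes>\<^sub>M lborel)"
    and "is_ito_integral M F W t \<sigma> I" "is_ito_integral M F W t \<sigma> J"
  shows "AE \<omega> in M. I \<omega> = J \<omega>"
proof -
  let ?N = "M \<Otimes>\<^sub>M lborel"
  obtain n p \<xi> where I: "I \<in> borel_measurable M" and \<xi>: "\<And>k. simple_integrand M F t (n k) (p k) (\<xi> k)"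
    and \<xi>1: "(\<lambda>k. sqdist ?N (restricted t (simple_process (n k) (p k) (\<xi> k))) (restricted t \<sigma>)) \<longlonglongrightarrow> 0"
    and \<xi>2: "(\<lambda>k. sqdist M (simple_integral W (n k) (p k) (\<xi> k)) I) \<longlonglongrightarrow> 0"
    using assms(2) unfolding is_ito_integral_iff[OF \<sigma>] by blast
  obtain m q \<eta> where J: "J \<in> borel_measurable M" and \<eta>: "\<And>k. simple_integrand M F t (m k) (q k) (\<eta> k)"
    and \<eta>1: "(\<lambda>k. sqdist ?N (restricted t (simple_process (m k) (q k) (\<eta> k))) (restricted t \<sigma>)) \<longlonglongrightarrow> 0"
    and \<eta>2: "(\<lambda>k. sqdist M (simple_integral W (m k) (q k) (\<eta> k)) J) \<longlonglongrightarrow> 0"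
    using assms(3) unfolding is_ito_integral_iff[OF \<sigma>] by blast
  let ?X = "\<lambda>k. simple_integral W (n k) (p k) (\<xi> k)" and ?Y = "\<lambda>k. simple_integral W (m k) (q k) (\<eta> k)"
  note m\<xi> = simple_measurable[OF \<xi>] and m\<eta> = simple_measurable[OF \<eta>]
  have XY: "(\<lambda>k. sqdist M (?X k) (?Y k)) \<longlonglongrightarrow> 0"
  proof (rule tendsto_sandwich[OF _ _ tendsto_const ennreal_tendsto_add_0[OF \<xi>1 \<eta>1]])
    show "\<forall>\<^sub>F k in sequentially. sqdist M (?X k) (?Y k) \<le>
        2 * (sqdist ?N (restricted t (simple_process (n k) (p k) (\<xi> k))) (restricted t \<sigma>) +
          sqdist ?N (restricted t (simple_process (m k) (q k) (\<eta> k))) (restricted t \<sigma>))"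
      unfolding simple_isometry[OF \<xi> \<eta>]
        sqdist_commute[of _ "restricted t (simple_process (m _) (q _) (\<eta> _))"]
      by (intro always_eventually allI sqdist_triangle m\<xi> m\<eta> \<sigma>)
  qed simp
  have XJ: "(\<lambda>k. sqdist M (?X k) J) \<longlonglongrightarrow> 0"
    by (rule tendsto_sandwich[OF _ _ tendsto_const ennreal_tendsto_add_0[OF XY \<eta>2]])
      (intro always_eventually allI zero_le sqdist_triangle m\<xi> m\<eta> J)+
  have "(\<lambda>k. sqdist M I J) \<longlonglongrightarrow> 0"
    by (rule tendsto_sandwich[OF _ _ tendsto_const ennreal_tendsto_add_0[OF \<xi>2[unfolded sqdist_commute[of _ _ I]] XJ]])
      (intro always_eventually allI zero_le sqdist_triangle m\<xi> I J)+
  then have "sqdist M I J = 0" by (simp add: LIMSEQ_const_iff)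
  then show ?thesis by (rule sqdist_eq_0[OF I J])
qed

text \<open>The isometry turns an approximating sequence of integrands into a Cauchy sequence of
  integrals. The version selected by \<open>ito_integral\<close> may stem from another sequence, but
  by uniqueness it is almost surely the same limit.\<close>

lemma is_ito_integral_exists:
  assumes \<sigma>: "restricted t \<sigma> \<in> borel_measurable (M \<Otimes>\<^sub>M lborel)"
    and \<xi>: "\<And>k. simple_integrand M F t (n k) (p k) (\<xi> k)"
    and lim: "(\<lambda>k. sqdist (M \<Otimes>\<^sub>M lborel) (restricted t (simple_process (n k) (p k) (\<xi> k))) (restricted t \<sigma>)) \<longlonglongrightarrow> 0"
  shows "is_ito_integral M F W t \<sigma> (ito_integral M F W t \<sigma>)"
    and "(\<lambda>k. sqdist M (simple_integral W (n k) (p k) (\<xi> k)) (ito_integral M F W t \<sigma>)) \<longlonglongrightarrow> 0"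
proof -
  note m\<xi> = simple_measurable[OF \<xi>]
  let ?\<delta> = "\<lambda>k. sqdist (M \<Otimes>\<^sub>M lborel) (restricted t (simple_process (n k) (p k) (\<xi> k))) (restricted t \<sigma>)"
  have "sqdist M (simple_integral W (n i) (p i) (\<xi> i)) (simple_integral W (n j) (p j) (\<xi> j)) \<le> 2 * (?\<delta> i + ?\<delta> j)" for i j
    unfolding simple_isometry[OF \<xi> \<xi>]
      sqdist_commute[of _ "restricted t (simple_process (n j) (p j) (\<xi> j))" "restricted t \<sigma>"]
    by (intro sqdist_triangle m\<xi> \<sigma>)
  from L2_complete[OF m\<xi>(3) lim this] obtain I where I: "I \<in> borel_measurable M"
    "(\<lambda>k. sqdist M (simple_integral W (n k) (p k) (\<xi> k)) I) \<longlonglongrightarrow> 0" .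
  have isI: "is_ito_integral M F W t \<sigma> I"
    unfolding is_ito_integral_iff[OF \<sigma>] using I \<xi> lim by blast
  then show ito: "is_ito_integral M F W t \<sigma> (ito_integral M F W t \<sigma>)"
    unfolding ito_integral_def by (rule someI[of "is_ito_integral M F W t \<sigma>"])
  have "AE \<omega> in M. I \<omega> = ito_integral M F W t \<sigma> \<omega>" by (rule ito_integral_unique[OF \<sigma> isI ito])
  then have "sqdist M X I = sqdist M X (ito_integral M F W t \<sigma>)" for X
    unfolding sqdist_def by (intro nn_integral_cong_AE) auto
  then show "(\<lambda>k. sqdist M (simple_integral W (n k) (p k) (\<xi> k)) (ito_integral M F W t \<sigma>)) \<longlonglongrightarrow> 0"
    using I(2) by simp
qed

end

section \<open>Piecewise constant controls\<close>

text \<open>A nearly optimal volatility is chosen at the points of a grid of width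
  \<open>\<eta>\<close> and kept on each cell, so the selector takes countably many values and is
  measurable. Moving to the grid point changes the supremum and the average by at most
  \<open>L * \<eta>\<close> each, together at most half of \<open>\<epsilon>\<close>.\<close>

lemma (in volatility_band) bellman_selector:
  assumes bl: "bounded_lipschitz B L g" and "0 < \<epsilon>"
  obtains c where "c \<in> borel_measurable borel" "\<And>y. c y \<in> {a..b}"
    "\<And>y. bellman a b h g y - \<epsilon> \<le> heat (c y * sqrt h) g y"
proof -
  have L: "0 \<le> L" by (rule bounded_lipschitzD(3)[OF bl])
  define \<eta> where "\<eta> = \<epsilon> / (4 * (L + 1))"
  have \<eta>: "0 < \<eta>" using \<open>0 < \<epsilon>\<close> L by (simp add: \<eta>_def)
  have "4 * (L * \<eta>) \<le> 4 * ((L + 1) * \<eta>)" using \<eta> by simp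
  also have "\<dots> = \<epsilon>" using L by (simp add: \<eta>_def field_simps)
  finally have L\<eta>: "4 * (L * \<eta>) \<le> \<epsilon>" .
  have "\<exists>c. c \<in> {a..b} \<and> bellman a b h g y - \<epsilon> / 2 < heat (c * sqrt h) g y" for y
    using bellman_approx[of "\<epsilon> / 2" h g y] \<open>0 < \<epsilon>\<close> by auto
  then obtain C where C: "\<And>y. C y \<in> {a..b}" "\<And>y. bellman a b h g y - \<epsilon> / 2 < heat (C y * sqrt h) g y"
    by metis
  define grid where "grid y = \<eta> * \<lfloor>y / \<eta>\<rfloor>" for y
  have grid: "\<bar>y - grid y\<bar> \<le> \<eta>" for y
  proof -
    have "0 \<le> y / \<eta> - \<lfloor>y / \<eta>\<rfloor>" "y / \<eta> - \<lfloor>y / \<eta>\<rfloor> \<le> 1" by linarith+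
    then have "0 \<le> \<eta> * (y / \<eta> - \<lfloor>y / \<eta>\<rfloor>)" "\<eta> * (y / \<eta> - \<lfloor>y / \<eta>\<rfloor>) \<le> \<eta> * 1"
      using \<eta> by (auto intro!: mult_left_mono simp del: mult_1_right)
    then show ?thesis using \<eta> by (simp add: grid_def algebra_simps)
  qed
  show ?thesis
  proof (rule that[of "\<lambda>y. C (grid y)"])
    have "(\<lambda>m :: int. C (\<eta> * m)) \<in> measurable (count_space UNIV) borel" by simp
    moreover have "(\<lambda>y. \<lfloor>y / \<eta>\<rfloor>) \<in> measurable borel (count_space UNIV)" by measurable
    ultimately show "(\<lambda>y. C (grid y)) \<in> borel_measurable borel"
      unfolding grid_def by (rule measurable_compose[rotated])
    show "C (grid y) \<in> {a..b}" for y by (rule C)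
    fix y
    have "L * \<bar>y - grid y\<bar> \<le> L * \<eta>" using grid L by (rule mult_left_mono)
    then show "bellman a b h g y - \<epsilon> \<le> heat (C (grid y) * sqrt h) g y"
      using C(2)[of "grid y"] heat_lipschitz[OF bl, of "C (grid y) * sqrt h" y "grid y"]
        bounded_lipschitzD(2)[OF bounded_lipschitz_bellman[OF bl], of h y "grid y"] L\<eta>
      by linarith
  qed
qed

lemma grid_interval_unique:
  fixes h s :: real
  assumes "0 \<le> h" "s \<in> {real i * h<..real (Suc i) * h}" "s \<in> {real j * h<..real (Suc j) * h}"
  shows "i = j"
proof -
  have less: "i < Suc j" if "s \<in> {real i * h<..real (Suc i) * h}" "s \<in> {real j * h<..real (Suc j) * h}" for i j :: nat
  proof (rule ccontr)
    assume "\<not> i < Suc j"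
    then have "real (Suc j) * h \<le> real i * h" using assms(1) by (intro mult_right_mono) auto
    then show False using that by auto
  qed
  from less[OF assms(2,3)] less[OF assms(3,2)] show ?thesis by simp
qed

lemma grid_sum_single:
  fixes h s :: real
  assumes "0 \<le> h" "j < n" "s \<in> {real j * h<..real (Suc j) * h}"
  shows "(\<Sum>i<n. c i * indicator {real i * h<..real (Suc i) * h} s) = (c j :: real)"
proof -
  have "(\<Sum>i<n. c i * indicator {real i * h<..real (Suc i) * h} s) = (\<Sum>i<n. if i = j then c j else 0)"
  proof (rule sum.cong)
    fix i
    show "c i * indicator {real i * h<..real (Suc i) * h} s = (if i = j then c j else 0)"
    proof (cases "i = j")
      case True
      then show ?thesis using assms(3) by (simp del: of_nat_Suc)
    next
      case False
      then have "s \<notin> {real i * h<..real (Suc i) * h}" using grid_interval_unique[OF assms(1) _ assms(3)] by blast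
      then show ?thesis using False by (simp del: of_nat_Suc)
    qed
  qed simp
  then show ?thesis using assms(2) by simp
qed

lemma grid_index:
  fixes h s :: real
  assumes "0 < h" "0 < s" "s \<le> real n * h"
  obtains m where "m < n" "s \<in> {real m * h<..real (Suc m) * h}"
proof -
  \<comment> \<open>The intervals are open on the left, hence the ceiling minus one rather than the
    floor.\<close>
  define m where "m = nat (\<lceil>s / h\<rceil> - 1)"
  have "0 < s / h" using assms by simp
  then have "1 \<le> \<lceil>s / h\<rceil>" by linarith
  then have m: "real m = \<lceil>s / h\<rceil> - 1" by (simp add: m_def)
  then have "m < s / h" "s / h \<le> Suc m" by linarith+
  then have s: "s \<in> {real m * h<..real (Suc m) * h}" using assms by (simp add: field_simps)
  have "real m * h < s" using s by simp
  then have "real m * h < real n * h" using assms(3) by linarith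
  then have "m < n" using assms(1) by simp
  with s show ?thesis by (rule that[rotated])
qed

locale controlled_brownian_motion = brownian_motion M F W + volatility_band a b
  for M :: "'a measure" and F W a b
begin

definition grid_weights :: "real \<Rightarrow> nat \<Rightarrow> (nat \<Rightarrow> 'a \<Rightarrow> real) \<Rightarrow> bool" where
  "grid_weights h n \<xi> \<longleftrightarrow>
    (\<forall>i<n. \<xi> i \<in> borel_measurable (F (real i * h)) \<and> (\<forall>\<omega>\<in>space M. \<xi> i \<omega> \<in> {a..b}))"

lemma grid_weights_Suc: "grid_weights h (Suc n) \<xi> \<Longrightarrow> grid_weights h n \<xi>"
  by (simp add: grid_weights_def)

lemma grid_weights_simple:
  assumes "grid_weights h n \<xi>" "0 \<le> h" "real n * h \<le> t"
  shows "simple_integrand M F t n (\<lambda>i. real i * h) \<xi>"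
  unfolding simple_integrand_def
proof (intro conjI allI impI)
  fix i assume i: "i < n"
  show "\<xi> i \<in> borel_measurable (F (real i * h))" using assms i by (simp add: grid_weights_def)
  have "\<bar>\<xi> i \<omega>\<bar> \<le> b" if "\<omega> \<in> space M" for \<omega>
    using assms(1) i that a_nonneg by (fastforce simp: grid_weights_def)
  then show "bounded (\<xi> i ` space M)" by (auto simp: bounded_iff)
qed (use assms in \<open>auto intro: mult_right_mono\<close>)

abbreviation grid_integral :: "real \<Rightarrow> nat \<Rightarrow> (nat \<Rightarrow> 'a \<Rightarrow> real) \<Rightarrow> 'a \<Rightarrow> real" where
  "grid_integral h n \<xi> \<equiv> simple_integral W n (\<lambda>i. real i * h) \<xi>"

lemma grid_integral_Suc:
  "grid_integral h (Suc n) \<xi> \<omega> = grid_integral h n \<xi> \<omega> + \<xi> n \<omega> * (W (real n * h + h) \<omega> - W (real n * h) \<omega>)"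
  by (simp add: simple_integral_def algebra_simps)

lemma grid_integral_measurable:
  assumes "grid_weights h n \<xi>" "0 \<le> h"
  shows "grid_integral h n \<xi> \<in> borel_measurable (F (real n * h))"
  unfolding simple_integral_def[abs_def]
proof (intro borel_measurable_sum borel_measurable_times borel_measurable_diff)
  fix i assume "i \<in> {..<n}"
  then have i: "i < n" by simp
  have "real (Suc i) * h \<le> real n * h" using i assms by (intro mult_right_mono) auto
  then show "W (real (Suc i) * h) \<in> borel_measurable (F (real n * h))"
    using assms by (intro F_measurable_mono[OF _ _ adapted]) auto
  have le: "real i * h \<le> real n * h" using i assms by (intro mult_right_mono) auto
  then show "W (real i * h) \<in> borel_measurable (F (real n * h))"
    using assms by (intro F_measurable_mono[OF _ _ adapted]) auto
  have "\<xi> i \<in> borel_measurable (F (real i * h))" using assms i by (simp add: grid_weights_def)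
  from F_measurable_mono[OF _ le this] show "\<xi> i \<in> borel_measurable (F (real n * h))" using assms by simp
qed

lemma grid_step:
  assumes "grid_weights h (Suc n) \<xi>" "0 \<le> h" and bl: "bounded_lipschitz B L g"
  shows "expectation (\<lambda>\<omega>. g (x + grid_integral h (Suc n) \<xi> \<omega>)) =
    expectation (\<lambda>\<omega>. heat (\<xi> n \<omega> * sqrt h) g (x + grid_integral h n \<xi> \<omega>))"
    "integrable M (\<lambda>\<omega>. heat (\<xi> n \<omega> * sqrt h) g (x + grid_integral h n \<xi> \<omega>))"
proof -
  have X: "(\<lambda>\<omega>. x + grid_integral h n \<xi> \<omega>) \<in> borel_measurable (F (real n * h))"
    using grid_integral_measurable[OF grid_weights_Suc[OF assms(1)] assms(2)] by simp
  have \<xi>: "\<xi> n \<in> borel_measurable (F (real n * h))" using assms by (simp add: grid_weights_def)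
  show "expectation (\<lambda>\<omega>. g (x + grid_integral h (Suc n) \<xi> \<omega>)) =
    expectation (\<lambda>\<omega>. heat (\<xi> n \<omega> * sqrt h) g (x + grid_integral h n \<xi> \<omega>))"
    using expectation_step[OF bl _ _ X \<xi>, of "real n * h + h"] assms(2)
    unfolding grid_integral_Suc add.assoc[symmetric] by simp
  have nh: "0 \<le> real n * h" using assms by simp
  note [measurable] = bounded_lipschitz_measurable[OF bl] F_measurable[OF nh X] F_measurable[OF nh \<xi>]
  have "(\<lambda>\<omega>. heat (\<xi> n \<omega> * sqrt h) g (x + grid_integral h n \<xi> \<omega>)) \<in> borel_measurable M"
    unfolding heat_def by measurable
  then show "integrable M (\<lambda>\<omega>. heat (\<xi> n \<omega> * sqrt h) g (x + grid_integral h n \<xi> \<omega>))"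
    by (rule integrable_const_bound[of _ B, rotated]) (use heat_abs_le[OF bl] in auto)
qed

lemma grid_integrable:
  assumes "grid_weights h n \<xi>" "0 \<le> h" and bl: "bounded_lipschitz B L g"
  shows "integrable M (\<lambda>\<omega>. g (x + grid_integral h n \<xi> \<omega>))"
proof (rule bounded_lipschitz_integrable[OF bl prob_space_axioms])
  have "0 \<le> real n * h" using assms by simp
  from F_measurable[OF this grid_integral_measurable[OF assms(1,2)]]
  show "(\<lambda>\<omega>. x + grid_integral h n \<xi> \<omega>) \<in> borel_measurable M" by simp
qed

text \<open>The last increment is averaged out first, which replaces \<open>g\<close> by at most
  \<open>bellman a b h g\<close>; the induction therefore runs over all \<open>g\<close>.\<close>

lemma grid_integral_le:
  assumes "grid_weights h n \<xi>" "0 \<le> h" "bounded_lipschitz B L g"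
  shows "expectation (\<lambda>\<omega>. g (x + grid_integral h n \<xi> \<omega>)) \<le> (bellman a b h ^^ n) g x"
  using assms
proof (induction n arbitrary: g)
  case 0
  then show ?case by (simp add: simple_integral_def prob_space)
next
  case (Suc n)
  note bl = Suc.prems(3)
  have "expectation (\<lambda>\<omega>. g (x + grid_integral h (Suc n) \<xi> \<omega>)) \<le>
      expectation (\<lambda>\<omega>. bellman a b h g (x + grid_integral h n \<xi> \<omega>))"
    unfolding grid_step(1)[OF Suc.prems]
  proof (rule integral_mono)
    show "integrable M (\<lambda>\<omega>. bellman a b h g (x + grid_integral h n \<xi> \<omega>))"
      by (rule grid_integrable[OF grid_weights_Suc[OF Suc.prems(1)] Suc.prems(2) bounded_lipschitz_bellman[OF bl]])
    fix \<omega> assume "\<omega> \<in> space M"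
    then show "heat (\<xi> n \<omega> * sqrt h) g (x + grid_integral h n \<xi> \<omega>) \<le>
        bellman a b h g (x + grid_integral h n \<xi> \<omega>)"
      using Suc.prems(1) by (intro heat_le_bellman[OF bl]) (simp add: grid_weights_def)
  qed (rule grid_step(2)[OF Suc.prems])
  also have "\<dots> \<le> (bellman a b h ^^ n) (bellman a b h g) x"
    by (rule Suc.IH[OF grid_weights_Suc[OF Suc.prems(1)] Suc.prems(2) bounded_lipschitz_bellman[OF bl]])
  finally show ?case by (simp add: funpow_swap1)
qed

text \<open>The weights are feedback controls, chosen backwards in time.\<close>

lemma grid_integral_attains:
  assumes "0 \<le> h" "bounded_lipschitz B L g" "0 < \<epsilon>"
  shows "\<exists>\<xi>. grid_weights h n \<xi> \<and>
    (bellman a b h ^^ n) g x - real n * \<epsilon> \<le> expectation (\<lambda>\<omega>. g (x + grid_integral h n \<xi> \<omega>))"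
  using assms
proof (induction n arbitrary: g)
  case 0
  then show ?case by (simp add: simple_integral_def prob_space grid_weights_def)
next
  case (Suc n)
  note bl = Suc.prems(2)
  obtain c where c[measurable]: "c \<in> borel_measurable borel" and cab: "\<And>y. c y \<in> {a..b}"
    and le: "\<And>y. bellman a b h g y - \<epsilon> \<le> heat (c y * sqrt h) g y"
    using bellman_selector[OF bl Suc.prems(3)] by blast
  obtain \<xi> where \<xi>: "grid_weights h n \<xi>" "(bellman a b h ^^ n) (bellman a b h g) x - real n * \<epsilon> \<le>
      expectation (\<lambda>\<omega>. bellman a b h g (x + grid_integral h n \<xi> \<omega>))"
    using Suc.IH[OF Suc.prems(1) bounded_lipschitz_bellman[OF bl] Suc.prems(3)] by blast
  \<comment> \<open>The first \<open>n\<close> weights are nearly optimal for the payoff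
    \<open>bellman a b h g\<close>. The last one is the selector evaluated at the position reached,
    hence measurable at its own time.\<close>
  define \<zeta> where "\<zeta> = \<xi>(n := \<lambda>\<omega>. c (x + grid_integral h n \<xi> \<omega>))"
  have same: "grid_integral h n \<zeta> = grid_integral h n \<xi>"
    by (simp add: \<zeta>_def simple_integral_def fun_eq_iff)
  note [measurable] = grid_integral_measurable[OF \<xi>(1) Suc.prems(1)]
  have "\<zeta> n \<in> borel_measurable (F (real n * h))" by (simp add: \<zeta>_def)
  then have \<zeta>: "grid_weights h (Suc n) \<zeta>"
    using \<xi>(1) cab by (auto simp: grid_weights_def less_Suc_eq \<zeta>_def)
  have int: "integrable M (\<lambda>\<omega>. bellman a b h g (x + grid_integral h n \<xi> \<omega>))"
    by (rule grid_integrable[OF \<xi>(1) Suc.prems(1) bounded_lipschitz_bellman[OF bl]])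
  have "(bellman a b h ^^ Suc n) g x - Suc n * \<epsilon> \<le>
      expectation (\<lambda>\<omega>. bellman a b h g (x + grid_integral h n \<xi> \<omega>) - \<epsilon>)"
    using \<xi>(2) int by (simp add: funpow_swap1 prob_space algebra_simps)
  also have "\<dots> \<le> expectation (\<lambda>\<omega>. heat (\<zeta> n \<omega> * sqrt h) g (x + grid_integral h n \<zeta> \<omega>))"
  proof (rule integral_mono[OF _ grid_step(2)[OF \<zeta> Suc.prems(1) bl]])
    show "bellman a b h g (x + grid_integral h n \<xi> \<omega>) - \<epsilon> \<le>
        heat (\<zeta> n \<omega> * sqrt h) g (x + grid_integral h n \<zeta> \<omega>)" for \<omega>
      using le unfolding same by (simp add: \<zeta>_def)
  qed (use int in simp)
  also have "\<dots> = expectation (\<lambda>\<omega>. g (x + grid_integral h (Suc n) \<zeta> \<omega>))"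
    by (rule grid_step(1)[OF \<zeta> Suc.prems(1) bl, symmetric])
  finally show ?case using \<zeta> by blast
qed

text \<open>Clamping the time to \<open>{0..t}\<close> extends the process to the whole line without
  changing it on the interval, so the restricted time space can be replaced by
  \<open>borel\<close>.\<close>

lemma restricted_measurable:
  assumes "progressively_measurable F \<sigma>" "0 \<le> t"
  shows "(\<lambda>(\<omega>, s). \<sigma> (max 0 (min t s)) \<omega>) \<in> borel_measurable (F t \<Otimes>\<^sub>M borel)"
    and "restricted t \<sigma> \<in> borel_measurable (M \<Otimes>\<^sub>M lborel)"
proof -
  have \<sigma>: "(\<lambda>(s, \<omega>). \<sigma> s \<omega>) \<in> borel_measurable (restrict_space borel {0..t} \<Otimes>\<^sub>M F t)"
    using assms by (simp add: progressively_measurable_def)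
  have clamp: "(\<lambda>s. max 0 (min t s)) \<in> measurable borel (restrict_space borel {0..t})"
    using assms(2) by (intro measurable_restrict_space2) auto
  have "(\<lambda>p. (max 0 (min t (snd p)), fst p)) \<in> measurable (F t \<Otimes>\<^sub>M borel) (restrict_space borel {0..t} \<Otimes>\<^sub>M F t)"
    by (intro measurable_Pair measurable_compose[OF measurable_snd clamp] measurable_fst)
  from measurable_compose[OF this \<sigma>]
  show *: "(\<lambda>(\<omega>, s). \<sigma> (max 0 (min t s)) \<omega>) \<in> borel_measurable (F t \<Otimes>\<^sub>M borel)"
    by (simp add: split_beta')
  have idM: "(\<lambda>\<omega>. \<omega>) \<in> measurable M (F t)"
    using F_measurable[OF assms(2) measurable_ident] by (simp add: id_def)
  have "(\<lambda>p. (fst p, snd p)) \<in> measurable (M \<Otimes>\<^sub>M borel) (F t \<Otimes>\<^sub>M borel)"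
    by (intro measurable_Pair measurable_snd
        measurable_compose[OF measurable_fst idM])
  from measurable_compose[OF this *]
  have "(\<lambda>(\<omega>, s). \<sigma> (max 0 (min t s)) \<omega>) \<in> borel_measurable (M \<Otimes>\<^sub>M borel)" by simp
  then have "(\<lambda>p. indicator {0..t} (snd p) * (case p of (\<omega>, s) \<Rightarrow> \<sigma> (max 0 (min t s)) \<omega>))
      \<in> borel_measurable (M \<Otimes>\<^sub>M borel)" by simp
  also have "(\<lambda>p. indicator {0..t} (snd p) * (case p of (\<omega>, s) \<Rightarrow> \<sigma> (max 0 (min t s)) \<omega>)) = restricted t \<sigma>"
    by (auto simp: restricted_def fun_eq_iff split: split_indicator)
  finally show "restricted t \<sigma> \<in> borel_measurable (M \<Otimes>\<^sub>M lborel)" by (simp cong: measurable_cong_sets sets_pair_measure_cong)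
qed

text \<open>Outside the grid intervals, in particular at time 0, a simple process is 0 and may leave
  \<open>{a..b}\<close>. The default value \<open>a\<close> makes it an admissible control.\<close>

definition grid_process :: "real \<Rightarrow> nat \<Rightarrow> (nat \<Rightarrow> 'a \<Rightarrow> real) \<Rightarrow> real \<Rightarrow> 'a \<Rightarrow> real" where
  "grid_process h n \<xi> s \<omega> = a + (\<Sum>i<n. (\<xi> i \<omega> - a) * indicator {real i * h<..real (Suc i) * h} s)"

lemma grid_process_cases:
  assumes "0 \<le> h"
  shows "grid_process h n \<xi> s \<omega> = a \<or> (\<exists>j<n. grid_process h n \<xi> s \<omega> = \<xi> j \<omega>)"
proof (cases "\<exists>j<n. s \<in> {real j * h<..real (Suc j) * h}")
  case True
  then obtain j where j: "j < n" "s \<in> {real j * h<..real (Suc j) * h}" by blast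
  then show ?thesis
    using grid_sum_single[OF assms j, of "\<lambda>i. \<xi> i \<omega> - a"] by (auto simp: grid_process_def)
next
  case False
  then have "(\<Sum>i<n. (\<xi> i \<omega> - a) * indicator {real i * h<..real (Suc i) * h} s) = 0"
    by (intro sum.neutral ballI) (auto simp del: of_nat_Suc split: split_indicator)
  then show ?thesis by (simp add: grid_process_def)
qed

lemma grid_process_control:
  assumes \<xi>: "grid_weights h n \<xi>" and "0 \<le> h"
  shows "grid_process h n \<xi> \<in> controls M F a b"
proof -
  have "grid_process h n \<xi> s \<omega> \<in> {a..b}" if "\<omega> \<in> space M" for s \<omega>
    using grid_process_cases[OF assms(2), of n \<xi> s \<omega>] that \<xi> a_le_b by (auto simp: grid_weights_def)
  moreover have "(\<lambda>(s, \<omega>). grid_process h n \<xi> s \<omega>) \<in> borel_measurable (restrict_space borel {0..t} \<Otimes>\<^sub>M F t)"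
    if "0 \<le> t" for t
  proof -
    have summand: "(\<lambda>p. (\<xi> i (snd p) - a) * indicator {real i * h<..real (Suc i) * h} (fst p)) \<in>
        borel_measurable (restrict_space borel {0..t} \<Otimes>\<^sub>M F t)" if "i < n" for i
    proof (cases "real i * h \<le> t")
      case True
      have "\<xi> i \<in> borel_measurable (F t)"
        using \<xi> that assms(2) by (intro F_measurable_mono[OF _ True]) (auto simp: grid_weights_def)
      moreover have "(\<lambda>s :: real. s) \<in> borel_measurable (restrict_space borel {0..t})"
        by (rule measurable_restrict_space1) simp
      ultimately show ?thesis
        by (intro borel_measurable_times borel_measurable_diff borel_measurable_const
            measurable_compose[OF measurable_snd]
            measurable_compose[OF measurable_compose[OF measurable_fst] borel_measurable_indicator]) auto
    next
      case False
      \<comment> \<open>The weight of an interval that begins after \<open>t\<close> need not be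
        measurable at time \<open>t\<close>, but its summand vanishes on
        \<open>{0..t}\<close>.\<close>
      have "(\<lambda>p. (\<xi> i (snd p) - a) * indicator {real i * h<..real (Suc i) * h} (fst p)) \<in>
          borel_measurable (restrict_space borel {0..t} \<Otimes>\<^sub>M F t) \<longleftrightarrow>
          (\<lambda>p. 0 :: real) \<in> borel_measurable (restrict_space borel {0..t} \<Otimes>\<^sub>M F t)"
        using False by (intro measurable_cong) (auto simp: space_pair_measure space_restrict_space)
      then show ?thesis by simp
    qed
    show ?thesis
      unfolding split_beta' grid_process_def
      by (intro borel_measurable_add borel_measurable_sum borel_measurable_const summand) auto
  qed
  ultimately show ?thesis by (auto simp: controls_def progressively_measurable_def)
qed

text \<open>Up to time \<open>t\<close> the control and the simple process with the same weights
  differ at most at time 0, so a constant sequence is an approximating sequence.\<close>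

lemma ito_integral_grid_process:
  assumes \<xi>: "grid_weights h n \<xi>" and h: "0 \<le> h" and t: "t = real n * h"
  shows "AE \<omega> in M. ito_integral M F W t (grid_process h n \<xi>) \<omega> = grid_integral h n \<xi> \<omega>"
    and "ito_integral M F W t (grid_process h n \<xi>) \<in> borel_measurable M"
proof -
  let ?\<sigma> = "grid_process h n \<xi>" and ?N = "M \<Otimes>\<^sub>M lborel"
  have t0: "0 \<le> t" using t h by simp
  have \<sigma>: "restricted t ?\<sigma> \<in> borel_measurable ?N"
    using grid_process_control[OF \<xi> h] by (intro restricted_measurable t0) (simp add: controls_def)
  have s: "simple_integrand M F t n (\<lambda>i. real i * h) \<xi>"
    by (rule grid_weights_simple[OF \<xi> h]) (simp add: t)
  let ?\<phi> = "simple_process n (\<lambda>i. real i * h) \<xi>"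
  have eq: "?\<phi> r \<omega> = ?\<sigma> r \<omega>" if r: "r \<in> {0..t}" "r \<noteq> 0" for r \<omega>
  proof -
    have "0 < r" using r by auto
    then have "0 < t" using r by auto
    then have "0 < h" using t h by (auto simp: zero_less_mult_iff)
    with \<open>0 < r\<close> obtain m where "m < n" and rm: "r \<in> {real m * h<..real (Suc m) * h}"
      using grid_index[of h r n] r t by auto
    show ?thesis
      using grid_sum_single[OF h \<open>m < n\<close> rm, of "\<lambda>i. \<xi> i \<omega>"]
        grid_sum_single[OF h \<open>m < n\<close> rm, of "\<lambda>i. \<xi> i \<omega> - a"]
      by (simp add: simple_process_def grid_process_def)
  qed
  have "AE r in lborel. r \<noteq> (0 :: real)" by (rule AE_lborel_singleton)
  then have "(\<integral>\<^sup>+r\<in>{0..t}. ennreal ((?\<phi> r \<omega> - ?\<sigma> r \<omega>)\<^sup>2) \<partial>lborel) = (\<integral>\<^sup>+r. 0 \<partial>(lborel :: real measure))" for \<omega>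
    by (intro nn_integral_cong_AE) (auto elim!: eventually_mono simp: eq split: split_indicator)
  then have zero: "sqdist ?N (restricted t ?\<phi>) (restricted t ?\<sigma>) = 0"
    by (simp add: sqdist_restricted[OF simple_measurable(1)[OF s] \<sigma>, symmetric])
  note ito = is_ito_integral_exists[OF \<sigma>, of "\<lambda>_. n" "\<lambda>_ i. real i * h" "\<lambda>_. \<xi>"]
  have lim: "(\<lambda>k. sqdist M (grid_integral h n \<xi>) (ito_integral M F W t ?\<sigma>)) \<longlonglongrightarrow> 0"
    by (rule ito(2)[OF s]) (simp add: zero)
  have "is_ito_integral M F W t ?\<sigma> (ito_integral M F W t ?\<sigma>)"
    by (rule ito(1)[OF s]) (simp add: zero)
  then show I: "ito_integral M F W t ?\<sigma> \<in> borel_measurable M" by (simp add: is_ito_integral_def)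
  have "sqdist M (grid_integral h n \<xi>) (ito_integral M F W t ?\<sigma>) = 0"
    using lim by (simp add: LIMSEQ_const_iff)
  from sqdist_eq_0[OF simple_measurable(2)[OF s] I this]
  show "AE \<omega> in M. ito_integral M F W t ?\<sigma> \<omega> = grid_integral h n \<xi> \<omega>" by auto
qed

end

section \<open>The value function as a limit of iterates\<close>

lemma bounded_borel_integral:
  fixes g :: "real \<Rightarrow> real"
  assumes g: "g \<in> borel_measurable borel" and ab: "\<And>s. a \<le> g s \<and> g s \<le> b" and uv: "u \<le> v"
  shows "set_integrable lborel {u..v} g" "g integrable_on {u..v}"
    "(LINT s:{u..v}|lborel. g s) = integral {u..v} g"
    "a * (v - u) \<le> integral {u..v} g" "integral {u..v} g \<le> b * (v - u)"
proof -
  have const: "set_integrable lborel {u..v} (\<lambda>_. c :: real)" for c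
    using uv by (simp add: set_integrable_def)
  show si: "set_integrable lborel {u..v} g"
  proof (rule set_integrable_bound[OF const[of "\<bar>a\<bar> + \<bar>b\<bar>"]])
    show "set_borel_measurable lborel {u..v} g" using g by (simp add: set_borel_measurable_def)
    have "\<bar>g s\<bar> \<le> \<bar>a\<bar> + \<bar>b\<bar>" for s using ab[of s] by linarith
    then show "AE s in lborel. s \<in> {u..v} \<longrightarrow> norm (g s) \<le> norm (\<bar>a\<bar> + \<bar>b\<bar>)" by simp
  qed
  show io: "g integrable_on {u..v}" and "(LINT s:{u..v}|lborel. g s) = integral {u..v} g"
    using set_borel_integral_eq_integral[OF si] by auto
  show "a * (v - u) \<le> integral {u..v} g" "integral {u..v} g \<le> b * (v - u)"
    using integral_le[OF integrable_const_ivl[of a u v] io] integral_le[OF io integrable_const_ivl[of b u v]]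
      ab uv by (auto simp: mult.commute)
qed

text \<open>An interval to the left of \<open>s\<close> is the difference of two intervals ending in
  \<open>s\<close>; their errors add up, measured against the distance \<open>s - u\<close>.\<close>

lemma integral_near_point:
  fixes g :: "real \<Rightarrow> real"
  assumes g: "\<And>u v. g integrable_on {u..v}"
    and d: "\<forall>u v. s - d < u \<and> u \<le> s \<and> s \<le> v \<and> v < s + d \<longrightarrow> \<bar>integral {u..v} g - g s * (v - u)\<bar> \<le> e * (v - u)"
    and "0 < d" "0 < e" and u: "s - d < u" "u \<le> u'" "u' \<le> s"
  shows "\<bar>integral {u..u'} g - g s * (u' - u)\<bar> \<le> 2 * e * (s - u)"
proof -
  have "integral {u..u'} g + integral {u'..s} g = integral {u..s} g"
    by (rule Henstock_Kurzweil_Integration.integral_combine[OF u(2,3) g])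
  moreover have "\<bar>integral {u..s} g - g s * (s - u)\<bar> \<le> e * (s - u)"
    using d[rule_format, of u s] u \<open>0 < d\<close> by simp
  moreover have "\<bar>integral {u'..s} g - g s * (s - u')\<bar> \<le> e * (s - u')"
    using d[rule_format, of u' s] u \<open>0 < d\<close> by simp
  moreover have "g s * (u' - u) = g s * (s - u) - g s * (s - u')" by (simp add: algebra_simps)
  moreover have "e * (s - u') \<le> e * (s - u)" using u \<open>0 < e\<close> by (intro mult_left_mono) auto
  ultimately show ?thesis by linarith
qed

text \<open>The average is taken over the interval before the one containing \<open>s\<close>; it
  stays within two mesh sizes of \<open>s\<close>, so Lebesgue differentiation still applies. The
  weight of index 0 is arbitrary, because for fixed \<open>s > 0\<close> the first interval is
  eventually left behind.\<close>

lemma averages_converge: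
  fixes g :: "real \<Rightarrow> real"
  assumes g: "\<And>u v. g integrable_on {u..v}" and t: "0 < t"
    and w: "\<And>k i. 0 < i \<Longrightarrow> i < 2 ^ k \<Longrightarrow>
      w k i = integral {real (i - 1) * (t / 2 ^ k)..real i * (t / 2 ^ k)} g / (t / 2 ^ k)"
  shows "AE s in lborel. s \<in> {0<..t} \<longrightarrow> (\<lambda>k. \<Sum>i<2 ^ k. w k i *
    indicator {real i * (t / 2 ^ k)<..real (Suc i) * (t / 2 ^ k)} s) \<longlonglongrightarrow> g s"
proof -
  have "AE s in lborel. \<forall>e>0. \<exists>d>0. \<forall>u v. s - d < u \<and> u \<le> s \<and> s \<le> v \<and> v < s + d \<longrightarrow>
      \<bar>integral {u..v} g - g s * (v - u)\<bar> \<le> e * (v - u)"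
    using lebesgue_differentiation[OF g] unfolding AE_completion_iff .
  then show ?thesis
  proof (rule eventually_mono, intro impI)
    fix s assume s: "s \<in> {0<..t}" and
      diff: "\<forall>e>0. \<exists>d>0. \<forall>u v. s - d < u \<and> u \<le> s \<and> s \<le> v \<and> v < s + d \<longrightarrow>
        \<bar>integral {u..v} g - g s * (v - u)\<bar> \<le> e * (v - u)"
    let ?w = "\<lambda>k. \<Sum>i<2 ^ k. w k i * indicator {real i * (t / 2 ^ k)<..real (Suc i) * (t / 2 ^ k)} s"
    show "?w \<longlonglongrightarrow> g s"
    proof (rule LIMSEQ_I)
      fix r :: real assume "0 < r"
      \<comment> \<open>The final error is \<open>4 * e\<close>: a factor 2 for an interval off
        \<open>s\<close>, another for reaching back over two meshes.\<close>
      define e where "e = r / 5"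
      have "0 < e" using \<open>0 < r\<close> by (simp add: e_def)
      with diff obtain d where d0: "0 < d" and d: "\<forall>u v. s - d < u \<and> u \<le> s \<and> s \<le> v \<and> v < s + d \<longrightarrow>
          \<bar>integral {u..v} g - g s * (v - u)\<bar> \<le> e * (v - u)"
        by meson
      have "(\<lambda>k. t * (1 / 2) ^ k) \<longlonglongrightarrow> t * 0" by (intro tendsto_intros) auto
      \<comment> \<open>A mesh below \<open>d / 2\<close> keeps the preceding interval within
        distance \<open>d\<close> of \<open>s\<close>; a mesh below \<open>s\<close> excludes the
        index 0.\<close>
      moreover have "0 < min (d / 2) s" using d0 s by simp
      ultimately have "\<forall>\<^sub>F k in sequentially. t * (1 / 2) ^ k < min (d / 2) s"
        by (intro order_tendstoD(2)) auto
      then obtain N where N: "\<And>k. N \<le> k \<Longrightarrow> t / 2 ^ k < min (d / 2) s"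
        by (auto simp: eventually_sequentially power_divide)
      have "norm (?w k - g s) < r" if "N \<le> k" for k
      proof -
        define h where "h = t / 2 ^ k"
        have h: "0 < h" "2 * h < d" "h < s" using N[OF that] t by (auto simp: h_def mult.commute)
        have "s \<le> real (2 ^ k) * h" using s by (simp add: h_def)
        from grid_index[OF h(1) _ this] s obtain m where m: "m < 2 ^ k" "s \<in> {real m * h<..real (Suc m) * h}"
          by auto
        have "0 < m" using m(2) h by (cases m) auto
        have wk: "?w k = w k m"
          using grid_sum_single[OF less_imp_le[OF h(1)] m, of "w k"] unfolding h_def .
        define u where "u = real (m - 1) * h"
        have u': "real m * h = u + h" using \<open>0 < m\<close> by (simp add: u_def algebra_simps of_nat_diff)
        have su: "s - u \<le> 2 * h" "u + h \<le> s" using m(2) u' by (auto simp: algebra_simps)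
        have "\<bar>integral {u..u + h} g - g s * (u + h - u)\<bar> \<le> 2 * e * (s - u)"
          by (rule integral_near_point[OF g d d0 \<open>0 < e\<close>]) (use su h in auto)
        also have "\<dots> \<le> 2 * e * (2 * h)" using su \<open>0 < e\<close> by (intro mult_left_mono) auto
        finally have "\<bar>integral {u..u + h} g - g s * h\<bar> \<le> 4 * e * h" by simp
        moreover have "w k m * h = integral {u..u + h} g"
          using w[OF \<open>0 < m\<close> m(1)] h(1) u' unfolding h_def[symmetric] u_def by simp
        ultimately have "\<bar>w k m - g s\<bar> * h \<le> 4 * e * h"
          using h(1) by (simp add: abs_mult_pos left_diff_distrib)
        then have "\<bar>w k m - g s\<bar> \<le> 4 * e" using h(1) by simp
        then show ?thesis using \<open>0 < r\<close> unfolding wk e_def by simp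
      qed
      then show "\<exists>N. \<forall>k\<ge>N. norm (?w k - g s) < r" by blast
    qed
  qed
qed

context controlled_brownian_motion
begin

text \<open>The average is taken over the preceding interval, so that the weights are adapted.\<close>

definition averaged :: "real \<Rightarrow> (real \<Rightarrow> 'a \<Rightarrow> real) \<Rightarrow> nat \<Rightarrow> nat \<Rightarrow> 'a \<Rightarrow> real" where
  "averaged t \<sigma> k i \<omega> = (let h = t / 2 ^ k in if i = 0 \<or> t = 0 then a
    else (LINT s:{real (i - 1) * h..real i * h}|lborel. \<sigma> (max 0 (min (real i * h) s)) \<omega>) / h)"

lemma control_section:
  assumes "\<sigma> \<in> controls M F a b" "0 \<le> t" "\<omega> \<in> space M"
  shows "(\<lambda>s. \<sigma> (max 0 (min t s)) \<omega>) \<in> borel_measurable borel"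
    "a \<le> \<sigma> (max 0 (min t s)) \<omega> \<and> \<sigma> (max 0 (min t s)) \<omega> \<le> b"
proof -
  have "\<omega> \<in> space (F t)" using assms by (simp add: space_F)
  then have "(\<lambda>s. (\<omega>, s)) \<in> measurable borel (F t \<Otimes>\<^sub>M borel)" by simp
  from measurable_compose[OF this restricted_measurable(1)[OF _ assms(2)]]
  show "(\<lambda>s. \<sigma> (max 0 (min t s)) \<omega>) \<in> borel_measurable borel"
    using assms by (simp add: controls_def)
  show "a \<le> \<sigma> (max 0 (min t s)) \<omega> \<and> \<sigma> (max 0 (min t s)) \<omega> \<le> b"
    using assms by (auto simp: controls_def)
qed

text \<open>Clamping at the right end \<open>r\<close> of the averaging interval, rather than at
  \<open>t\<close>, shows that the average depends on the process up to time \<open>r\<close>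
  only.\<close>

lemma averaged_weights:
  assumes \<sigma>: "\<sigma> \<in> controls M F a b" and t: "0 \<le> t"
  shows "grid_weights (t / 2 ^ k) n (averaged t \<sigma> k)"
  unfolding grid_weights_def
proof (intro allI impI conjI ballI)
  fix i
  define h where "h = t / 2 ^ k"
  define r where "r = real i * h"
  have h: "0 \<le> h" and r: "0 \<le> r" using t by (simp_all add: h_def r_def)
  let ?g = "\<lambda>\<omega> s. \<sigma> (max 0 (min r s)) \<omega>"
  have avg: "averaged t \<sigma> k i = (if i = 0 \<or> t = 0 then (\<lambda>\<omega>. a)
      else (\<lambda>\<omega>. (LINT s|lborel. indicator {real (i - 1) * h..r} s * ?g \<omega> s) / h))"
    by (simp add: averaged_def Let_def h_def r_def fun_eq_iff set_lebesgue_integral_def)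
  have "(\<lambda>(\<omega>, s). ?g \<omega> s) \<in> borel_measurable (F r \<Otimes>\<^sub>M borel)"
    using restricted_measurable(1)[OF _ r] \<sigma> by (simp add: controls_def)
  then have [measurable]: "(\<lambda>(\<omega>, s). ?g \<omega> s) \<in> borel_measurable (F r \<Otimes>\<^sub>M lborel)"
    by (simp cong: measurable_cong_sets sets_pair_measure_cong)
  have "(\<lambda>\<omega>. LINT s|lborel. indicator {real (i - 1) * h..r} s * ?g \<omega> s) \<in> borel_measurable (F r)"
    by measurable
  then show "averaged t \<sigma> k i \<in> borel_measurable (F (real i * (t / 2 ^ k)))"
    unfolding avg r_def[symmetric] h_def[symmetric] by simp
  fix \<omega> assume \<omega>: "\<omega> \<in> space M"
  show "averaged t \<sigma> k i \<omega> \<in> {a..b}"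
  proof (cases "i = 0 \<or> t = 0")
    case True
    then show ?thesis using a_le_b by (auto simp: avg)
  next
    case False
    then have "0 < h" using t by (simp add: h_def)
    have len: "r - real (i - 1) * h = h" using False by (simp add: r_def of_nat_diff algebra_simps)
    then have le: "real (i - 1) * h \<le> r" using h by linarith
    note B = bounded_borel_integral[OF control_section[OF \<sigma> r \<omega>] le]
    have "averaged t \<sigma> k i \<omega> = integral {real (i - 1) * h..r} (?g \<omega>) / h"
      using False B(3) by (simp add: avg set_lebesgue_integral_def)
    then show ?thesis
      using B(4,5) \<open>0 < h\<close> unfolding len by (simp add: pos_le_divide_eq pos_divide_le_eq)
  qed
qed

lemma averaged_converge:
  assumes \<sigma>: "\<sigma> \<in> controls M F a b" and t: "0 < t" and \<omega>: "\<omega> \<in> space M"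
  shows "AE s in lborel. s \<in> {0<..t} \<longrightarrow>
    (\<lambda>k. simple_process (2 ^ k) (\<lambda>i. real i * (t / 2 ^ k)) (averaged t \<sigma> k) s \<omega>) \<longlonglongrightarrow> \<sigma> s \<omega>"
proof -
  let ?g = "\<lambda>s. \<sigma> (max 0 (min t s)) \<omega>"
  have g: "?g integrable_on {u..v}" for u v
    using bounded_borel_integral(2)[OF control_section[OF \<sigma> less_imp_le[OF t] \<omega>]]
    by (cases "u \<le> v") auto
  have w: "averaged t \<sigma> k i \<omega> =
      integral {real (i - 1) * (t / 2 ^ k)..real i * (t / 2 ^ k)} ?g / (t / 2 ^ k)"
    if i: "0 < i" "i < 2 ^ k" for k i
  proof -
    define h where "h = t / 2 ^ k"
    define r where "r = real i * h"
    have "0 < h" using t by (simp add: h_def)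
    have "real i < 2 ^ k" using i(2) by (metis of_nat_less_iff of_nat_numeral of_nat_power)
    then have "r \<le> t" using t by (simp add: r_def h_def field_simps)
    have r: "0 \<le> r" using \<open>0 < h\<close> by (simp add: r_def)
    have le: "real (i - 1) * h \<le> r" using \<open>0 < h\<close> by (simp add: r_def)
    have "averaged t \<sigma> k i \<omega> = (LINT s:{real (i - 1) * h..r}|lborel. \<sigma> (max 0 (min r s)) \<omega>) / h"
      using i t by (simp add: averaged_def Let_def h_def r_def)
    also have "\<dots> = integral {real (i - 1) * h..r} (\<lambda>s. \<sigma> (max 0 (min r s)) \<omega>) / h"
      by (subst bounded_borel_integral(3)[OF control_section[OF \<sigma> r \<omega>] le]) simp
    also have "integral {real (i - 1) * h..r} (\<lambda>s. \<sigma> (max 0 (min r s)) \<omega>) = integral {real (i - 1) * h..r} ?g"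
      using \<open>r \<le> t\<close> by (intro Henstock_Kurzweil_Integration.integral_cong) simp
    finally show ?thesis by (simp add: r_def h_def)
  qed
  have "AE s in lborel. s \<in> {0<..t} \<longrightarrow> (\<lambda>k. \<Sum>i<2 ^ k. averaged t \<sigma> k i \<omega> *
      indicator {real i * (t / 2 ^ k)<..real (Suc i) * (t / 2 ^ k)} s) \<longlonglongrightarrow> ?g s"
    by (rule averages_converge[OF g t]) (rule w)
  then show ?thesis
    unfolding simple_process_def
  proof (rule eventually_mono, intro impI)
    fix s assume s: "s \<in> {0<..t}" and "s \<in> {0<..t} \<longrightarrow>
      (\<lambda>k. \<Sum>i<2 ^ k. averaged t \<sigma> k i \<omega> *
        indicator {real i * (t / 2 ^ k)<..real (Suc i) * (t / 2 ^ k)} s) \<longlonglongrightarrow> ?g s"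
    moreover have "max 0 (min t s) = s" using s by simp
    ultimately show "(\<lambda>k. \<Sum>i<2 ^ k. averaged t \<sigma> k i \<omega> *
        indicator {real i * (t / 2 ^ k)<..real (Suc i) * (t / 2 ^ k)} s) \<longlonglongrightarrow> \<sigma> s \<omega>"
      by metis
  qed
qed

lemma simple_process_bound:
  assumes "grid_weights h n \<xi>" "0 \<le> h" "\<omega> \<in> space M"
  shows "\<bar>simple_process n (\<lambda>i. real i * h) \<xi> s \<omega>\<bar> \<le> b"
proof (cases "\<exists>j<n. s \<in> {real j * h<..real (Suc j) * h}")
  case True
  then obtain j where j: "j < n" "s \<in> {real j * h<..real (Suc j) * h}" by blast
  have "a \<le> \<xi> j \<omega> \<and> \<xi> j \<omega> \<le> b" using assms j by (auto simp: grid_weights_def)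
  then show ?thesis
    using grid_sum_single[OF assms(2) j, of "\<lambda>i. \<xi> i \<omega>"] a_nonneg by (simp add: simple_process_def)
next
  case False
  then have "simple_process n (\<lambda>i. real i * h) \<xi> s \<omega> = 0"
    unfolding simple_process_def
    by (intro sum.neutral ballI) (auto simp del: of_nat_Suc split: split_indicator)
  then show ?thesis using a_nonneg a_le_b by simp
qed

text \<open>The null set of times without convergence depends on \<open>\<omega>\<close>, so
  dominated convergence is applied first in time for fixed \<open>\<omega>\<close> and then over
  \<open>\<omega>\<close>. Controls and their averages are bounded by \<open>b\<close>, whence the
  majorant \<open>(2 * b)\<^sup>2\<close>.\<close>

lemma averaged_approximates:
  assumes \<sigma>: "\<sigma> \<in> controls M F a b" and t: "0 \<le> t"
  defines "\<phi> \<equiv> \<lambda>k. simple_process (2 ^ k) (\<lambda>i. real i * (t / 2 ^ k)) (averaged t \<sigma> k)"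
  shows "(\<lambda>k. sqdist (M \<Otimes>\<^sub>M lborel) (restricted t (\<phi> k)) (restricted t \<sigma>)) \<longlonglongrightarrow> 0"
proof -
  have \<sigma>m: "restricted t \<sigma> \<in> borel_measurable (M \<Otimes>\<^sub>M lborel)"
    using \<sigma> t by (intro restricted_measurable) (auto simp: controls_def)
  have simple: "simple_integrand M F t (2 ^ k) (\<lambda>i. real i * (t / 2 ^ k)) (averaged t \<sigma> k)" for k
    using t by (intro grid_weights_simple averaged_weights[OF \<sigma> t]) auto
  have \<phi>m: "restricted t (\<phi> k) \<in> borel_measurable (M \<Otimes>\<^sub>M lborel)" for k
    unfolding \<phi>_def by (rule simple_measurable(1)[OF simple])
  have \<phi>b: "\<bar>\<phi> k s \<omega>\<bar> \<le> b" if "\<omega> \<in> space M" for k s \<omega>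
    unfolding \<phi>_def using t that by (intro simple_process_bound averaged_weights[OF \<sigma> t]) auto
  define f where "f k \<omega> s = ennreal ((\<phi> k s \<omega> - \<sigma> s \<omega>)\<^sup>2) * indicator {0..t} s" for k \<omega> s
  have fm: "(\<lambda>(\<omega>, s). f k \<omega> s) \<in> borel_measurable (M \<Otimes>\<^sub>M lborel)" for k
  proof -
    have "(\<lambda>(\<omega>, s). f k \<omega> s) = (\<lambda>p. ennreal ((restricted t (\<phi> k) p - restricted t \<sigma> p)\<^sup>2))"
      by (auto simp: f_def restricted_def fun_eq_iff split: split_indicator)
    moreover have "(\<lambda>p. ennreal ((restricted t (\<phi> k) p - restricted t \<sigma> p)\<^sup>2)) \<in> borel_measurable (M \<Otimes>\<^sub>M lborel)"
      by (intro measurable_compose[OF _ measurable_ennreal] borel_measurable_power borel_measurable_diff \<phi>m \<sigma>m)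
    ultimately show ?thesis by simp
  qed
  have fb: "f k \<omega> s \<le> ennreal ((2 * b)\<^sup>2) * indicator {0..t} s" if "\<omega> \<in> space M" for k \<omega> s
  proof (cases "s \<in> {0..t}")
    case True
    then have "a \<le> \<sigma> s \<omega> \<and> \<sigma> s \<omega> \<le> b" using \<sigma> that by (auto simp: controls_def)
    then have "\<bar>\<phi> k s \<omega> - \<sigma> s \<omega>\<bar> \<le> 2 * b" using \<phi>b[OF that, of k s] a_nonneg by linarith
    then have "(\<phi> k s \<omega> - \<sigma> s \<omega>)\<^sup>2 \<le> (2 * b)\<^sup>2" by (metis abs_ge_zero power2_abs power_mono)
    then show ?thesis using True by (simp add: f_def ennreal_leI del: ennreal_power)
  qed (simp add: f_def)
  have cint: "(\<integral>\<^sup>+s. ennreal ((2 * b)\<^sup>2) * indicator {0..t} s \<partial>lborel) = ennreal ((2 * b)\<^sup>2) * ennreal t"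
    using t by (simp add: nn_integral_cmult_indicator)
  have inner: "(\<lambda>k. \<integral>\<^sup>+s. f k \<omega> s \<partial>lborel) \<longlonglongrightarrow> 0" if \<omega>: "\<omega> \<in> space M" for \<omega>
  proof -
    have fs[measurable]: "f k \<omega> \<in> borel_measurable lborel" for k
      using measurable_compose[OF measurable_Pair1'[OF \<omega>] fm[of k]] by simp
    have "(\<lambda>k. \<integral>\<^sup>+s. f k \<omega> s \<partial>lborel) \<longlonglongrightarrow> (\<integral>\<^sup>+s. 0 \<partial>(lborel :: real measure))"
    proof (rule nn_integral_dominated_convergence[where w = "\<lambda>s. ennreal ((2 * b)\<^sup>2) * indicator {0..t} s"])
      show "AE s in lborel. f k \<omega> s \<le> ennreal ((2 * b)\<^sup>2) * indicator {0..t} s" for k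
        using fb[OF \<omega>] by simp
      show "(\<integral>\<^sup>+s. ennreal ((2 * b)\<^sup>2) * indicator {0..t} s \<partial>lborel) < \<infinity>"
        unfolding cint by (simp add: ennreal_mult_less_top)
      have AE0: "AE s in lborel. s \<noteq> (0 :: real)" by (rule AE_lborel_singleton)
      show "AE s in lborel. (\<lambda>k. f k \<omega> s) \<longlonglongrightarrow> 0"
      proof (cases "t = 0")
        case True
        then show ?thesis
          by (intro eventually_mono[OF AE0]) (auto simp: f_def)
      next
        case False
        then have "0 < t" using t by simp
        from AE0 averaged_converge[OF \<sigma> this \<omega>] show ?thesis
        proof eventually_elim
          case (elim s)
          show ?case
          proof (cases "s \<in> {0<..t}")
            case True
            with elim have "(\<lambda>k. \<phi> k s \<omega>) \<longlonglongrightarrow> \<sigma> s \<omega>" by (simp add: \<phi>_def)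
            then have "(\<lambda>k. (\<phi> k s \<omega> - \<sigma> s \<omega>)\<^sup>2) \<longlonglongrightarrow> (\<sigma> s \<omega> - \<sigma> s \<omega>)\<^sup>2"
              by (intro tendsto_intros)
            then have "(\<lambda>k. ennreal ((\<phi> k s \<omega> - \<sigma> s \<omega>)\<^sup>2)) \<longlonglongrightarrow> ennreal 0"
              by (intro tendsto_ennrealI) simp
            then show ?thesis using True by (simp add: f_def)
          next
            case False
            then have "s \<notin> {0..t}" using elim by auto
            then show ?thesis by (simp add: f_def)
          qed
        qed
      qed
    qed simp_all
    then show ?thesis by simp
  qed
  have Im[measurable]: "(\<lambda>\<omega>. \<integral>\<^sup>+s. f k \<omega> s \<partial>lborel) \<in> borel_measurable M" for k
    using fm by (rule lborel.borel_measurable_nn_integral)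
  have "(\<lambda>k. \<integral>\<^sup>+\<omega>. (\<integral>\<^sup>+s. f k \<omega> s \<partial>lborel) \<partial>M) \<longlonglongrightarrow> (\<integral>\<^sup>+\<omega>. 0 \<partial>M)"
  proof (rule nn_integral_dominated_convergence[where w = "\<lambda>_. ennreal ((2 * b)\<^sup>2) * ennreal t"])
    show "AE \<omega> in M. (\<integral>\<^sup>+s. f k \<omega> s \<partial>lborel) \<le> ennreal ((2 * b)\<^sup>2) * ennreal t" for k
      unfolding cint[symmetric] by (intro AE_I2 nn_integral_mono fb)
    show "(\<integral>\<^sup>+\<omega>. ennreal ((2 * b)\<^sup>2) * ennreal t \<partial>M) < \<infinity>"
      by (simp add: emeasure_space_1 ennreal_mult_less_top)
  qed (use inner in simp_all)
  moreover have "sqdist (M \<Otimes>\<^sub>M lborel) (restricted t (\<phi> k)) (restricted t \<sigma>) =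
      (\<integral>\<^sup>+\<omega>. (\<integral>\<^sup>+s. f k \<omega> s \<partial>lborel) \<partial>M)" for k
    unfolding f_def by (rule sqdist_restricted[OF \<phi>m \<sigma>m, symmetric])
  ultimately show ?thesis by simp
qed

section \<open>The two inequalities between the value function and the limit\<close>

lemma expectation_lipschitz_sqdist:
  assumes bl: "bounded_lipschitz B L g" and X[measurable]: "X \<in> borel_measurable M"
    and Y[measurable]: "Y \<in> borel_measurable M" and e: "0 < e" "sqdist M X Y \<le> ennreal (e\<^sup>2 / 2)"
  shows "expectation (\<lambda>\<omega>. g (x + Y \<omega>)) \<le> expectation (\<lambda>\<omega>. g (x + X \<omega>)) + L * e"
proof -
  note int = expectation_abs_le_sqdist[OF X Y e]
  have gX: "integrable M (\<lambda>\<omega>. g (x + X \<omega>))" and gY: "integrable M (\<lambda>\<omega>. g (x + Y \<omega>))"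
    by (rule bounded_lipschitz_integrable[OF bl prob_space_axioms]; measurable)+
  have "expectation (\<lambda>\<omega>. g (x + Y \<omega>)) \<le> expectation (\<lambda>\<omega>. g (x + X \<omega>) + L * \<bar>X \<omega> - Y \<omega>\<bar>)"
  proof (rule integral_mono[OF gY])
    show "g (x + Y \<omega>) \<le> g (x + X \<omega>) + L * \<bar>X \<omega> - Y \<omega>\<bar>" for \<omega>
      using bounded_lipschitzD(2)[OF bl, of "x + Y \<omega>" "x + X \<omega>"] by (simp add: abs_minus_commute)
  qed (use gX int(1) in auto)
  also have "\<dots> = expectation (\<lambda>\<omega>. g (x + X \<omega>)) + L * expectation (\<lambda>\<omega>. \<bar>X \<omega> - Y \<omega>\<bar>)"
    using gX int(1) by simp
  also have "\<dots> \<le> expectation (\<lambda>\<omega>. g (x + X \<omega>)) + L * e"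
    using int(2) bounded_lipschitzD(3)[OF bl] by (intro add_left_mono mult_left_mono) auto
  finally show ?thesis .
qed

text \<open>One sufficiently fine averaged control is enough, since every iterate lies below
  \<open>nisio t g x\<close>. The tolerance \<open>\<epsilon> / (L + 1)\<close> compensates for the
  Lipschitz constant.\<close>

lemma control_expectation_le_nisio:
  assumes \<sigma>: "\<sigma> \<in> controls M F a b" and t: "0 \<le> t" and bl: "bounded_lipschitz B L g"
  shows "expectation (\<lambda>\<omega>. g (x + ito_integral M F W t \<sigma> \<omega>)) \<le> nisio t g x"
proof (rule field_le_epsilon)
  fix \<epsilon> :: real assume "0 < \<epsilon>"
  have L: "0 \<le> L" by (rule bounded_lipschitzD(3)[OF bl])
  define e where "e = \<epsilon> / (L + 1)"
  have "0 < e" using \<open>0 < \<epsilon>\<close> L by (simp add: e_def)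
  have "L * e \<le> (L + 1) * e" using \<open>0 < e\<close> by simp
  then have Le: "L * e \<le> \<epsilon>" using L by (simp add: e_def)
  have \<sigma>m: "restricted t \<sigma> \<in> borel_measurable (M \<Otimes>\<^sub>M lborel)"
    using \<sigma> t by (intro restricted_measurable) (auto simp: controls_def)
  have simple: "simple_integrand M F t (2 ^ k) (\<lambda>i. real i * (t / 2 ^ k)) (averaged t \<sigma> k)" for k
    using t by (intro grid_weights_simple averaged_weights[OF \<sigma> t]) auto
  note ito = is_ito_integral_exists[OF \<sigma>m simple averaged_approximates[OF \<sigma> t]]
  have I: "ito_integral M F W t \<sigma> \<in> borel_measurable M"
    using ito(1) by (simp add: is_ito_integral_def)
  have "0 < ennreal (e\<^sup>2 / 2)" using \<open>0 < e\<close> by simp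
  from order_tendstoD(2)[OF ito(2) this] obtain k where
    k: "sqdist M (grid_integral (t / 2 ^ k) (2 ^ k) (averaged t \<sigma> k)) (ito_integral M F W t \<sigma>) \<le> ennreal (e\<^sup>2 / 2)"
    by (meson eventually_sequentially less_imp_le order_refl)
  have "expectation (\<lambda>\<omega>. g (x + ito_integral M F W t \<sigma> \<omega>)) \<le>
      expectation (\<lambda>\<omega>. g (x + grid_integral (t / 2 ^ k) (2 ^ k) (averaged t \<sigma> k) \<omega>)) + L * e"
    by (rule expectation_lipschitz_sqdist[OF bl simple_measurable(2)[OF simple] I \<open>0 < e\<close> k])
  also have "\<dots> \<le> nisio_approx t k g x + \<epsilon>"
    unfolding nisio_approx_def using t Le
    by (intro add_mono grid_integral_le[OF averaged_weights[OF \<sigma> t] _ bl]) auto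
  also have "\<dots> \<le> nisio t g x + \<epsilon>" using nisio_limit(2)[OF bl t] by simp
  finally show "expectation (\<lambda>\<omega>. g (x + ito_integral M F W t \<sigma> \<omega>)) \<le> nisio t g x + \<epsilon>" .
qed

text \<open>Averaged controls give one inequality. For the other, feedback weights on a dyadic grid
  come within any tolerance of an iterate, and their grid processes are admissible controls.\<close>

theorem control_value_eq_nisio:
  assumes t: "0 \<le> t" and bl: "bounded_lipschitz B L g"
  shows "(SUP \<sigma>\<in>controls M F a b. expectation (\<lambda>\<omega>. g (x + ito_integral M F W t \<sigma> \<omega>))) = nisio t g x"
    (is "?S = _")
proof (rule antisym)
  have "controls M F a b \<noteq> {}"
    using grid_process_control[of 0 0] by (auto simp: grid_weights_def)
  then show "?S \<le> nisio t g x"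
    by (rule cSUP_least) (rule control_expectation_le_nisio[OF _ t bl])
  have bdd: "bdd_above ((\<lambda>\<sigma>. expectation (\<lambda>\<omega>. g (x + ito_integral M F W t \<sigma> \<omega>))) ` controls M F a b)"
    by (rule bdd_aboveI2[of _ _ "nisio t g x"]) (rule control_expectation_le_nisio[OF _ t bl])
  show "nisio t g x \<le> ?S"
  proof (rule LIMSEQ_le_const2[OF nisio_limit(1)[OF bl t]], intro exI[of _ 0] allI impI)
    fix k
    define h where "h = t / 2 ^ k"
    have h: "0 \<le> h" and th: "t = real (2 ^ k) * h" using t by (simp_all add: h_def)
    show "nisio_approx t k g x \<le> ?S"
    proof (rule field_le_epsilon)
      fix \<epsilon> :: real assume "0 < \<epsilon>"
      \<comment> \<open>Each of the \<open>2 ^ k\<close> steps may lose this much.\<close>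
      then have "0 < \<epsilon> / 2 ^ k" by simp
      from grid_integral_attains[OF h bl this, of "2 ^ k" x] obtain \<xi> where
        \<xi>: "grid_weights h (2 ^ k) \<xi>" and
        le: "nisio_approx t k g x - \<epsilon> \<le> expectation (\<lambda>\<omega>. g (x + grid_integral h (2 ^ k) \<xi> \<omega>))"
        by (auto simp: nisio_approx_def h_def)
      note ito = ito_integral_grid_process[OF \<xi> h th]
      note [measurable] = ito(2) bounded_lipschitz_measurable[OF bl]
      have [measurable]: "grid_integral h (2 ^ k) \<xi> \<in> borel_measurable M"
        by (rule simple_measurable(2)[OF grid_weights_simple[OF \<xi> h order_refl]])
      have "expectation (\<lambda>\<omega>. g (x + grid_integral h (2 ^ k) \<xi> \<omega>)) =
          expectation (\<lambda>\<omega>. g (x + ito_integral M F W t (grid_process h (2 ^ k) \<xi>) \<omega>))"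
        using ito(1) by (intro integral_cong_AE) (auto elim!: eventually_mono)
      also have "\<dots> \<le> ?S"
        by (rule cSUP_upper[OF grid_process_control[OF \<xi> h] bdd])
      finally show "nisio_approx t k g x \<le> ?S + \<epsilon>" using le by simp
    qed
  qed
qed

end

theorem proposition5p6:
  fixes M :: "'a measure" and F :: "real \<Rightarrow> 'a measure" and W :: "real \<Rightarrow> 'a \<Rightarrow> real"
    and \<sigma>_low \<sigma>_high :: real
    and S :: "real \<Rightarrow> (real \<Rightarrow> real) \<Rightarrow> real \<Rightarrow> real"
    and f :: "real \<Rightarrow> real"
  assumes "brownian_motion M F W"
    and "0 \<le> \<sigma>_low" and "\<sigma>_low \<le> \<sigma>_high"
    and S_eq: "\<And>t g x. 0 \<le> t \<Longrightarrow> g \<in> BUC \<Longrightarrow>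
      S t g x = (SUP \<sigma>\<in>controls M F \<sigma>_low \<sigma>_high. LINT \<omega>|M. g (x + ito_integral M F W t \<sigma> \<omega>))"
    and "f \<in> W2_infinity"
  shows "(\<forall>t\<ge>0. S t f \<in> W2_infinity) \<and>
    (\<forall>f''. has_weak_deriv 2 f f'' \<longrightarrow>
      (AE x in lebesgue.
        ((\<lambda>h. (S h f x - f x) / h) \<longlongrightarrow> 1/2 * max (\<sigma>_low\<^sup>2 * f'' x) (\<sigma>_high\<^sup>2 * f'' x)) (at_right 0)))"
proof -
  interpret controlled_brownian_motion M F W \<sigma>_low \<sigma>_high
    using assms by (intro controlled_brownian_motion.intro volatility_band.intro)
  obtain B L K d where bl: "bounded_lipschitz B L f" and q: "quadratic_approx K f d"
    using W2_infinity_regularity[OF \<open>f \<in> W2_infinity\<close>] .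
  have S_nisio: "S t f x = nisio t f x" if "0 \<le> t" for t x
    by (simp only: S_eq[OF that bounded_lipschitz_BUC[OF bl]] control_value_eq_nisio[OF that bl])
  have "S t f \<in> W2_infinity" if t: "0 \<le> t" for t
  proof -
    obtain d' where "quadratic_approx K (nisio t f) d'"
      using quadratic_approx_nisio[OF q bl t] by blast
    then have "nisio t f \<in> W2_infinity" by (rule W2_infinityI[OF bounded_lipschitz_nisio[OF bl t]])
    moreover have "S t f = nisio t f" using S_nisio[OF t] by (rule ext)
    ultimately show ?thesis by simp
  qed
  moreover have "AE x in lebesgue.
      ((\<lambda>h. (S h f x - f x) / h) \<longlongrightarrow> 1/2 * max (\<sigma>_low\<^sup>2 * f'' x) (\<sigma>_high\<^sup>2 * f'' x)) (at_right 0)"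
    if "has_weak_deriv 2 f f''" for f''
    using weak_second_derivative_AE[OF quadratic_approx_derivative(1,3)[OF q] that]
  proof eventually_elim
    case (elim x)
    \<comment> \<open>\<open>S\<close> is prescribed for nonnegative times only, which is all that a
      limit from the right sees.\<close>
    have "\<forall>\<^sub>F h in at_right 0. (nisio h f x - f x) / h = (S h f x - f x) / h"
      by (rule eventually_at_rightI[of 0 1]) (simp_all add: S_nisio)
    then show ?case
      by (rule Lim_transform_eventually[OF nisio_generator[OF bl q elim]])
  qed
  ultimately show ?thesis by blast
qed

end
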